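(* Let $f:\Sigma\to\mathcal{Z}$ be an umbilic-free $\Omega$-surface whose middle pencil $d+t\eta^{mid}$ admits a $2$-dimensional space of linear conserved quantities $P$ with $g_0\ne0$ and $g_\infty$ non-degenerate (so that $f$ projects to linear Weingarten surfaces in any space form determined by space form vector and point sphere complex chosen from $P(0)$). Let $\hat f$ be an umbilic-free Darboux transform of $f$ with parameter $m\in\mathbb{R}\setminus\{0\}$, let $\hat s\le\hat f$ be the parallel subbundle of $d+m\eta^{mid}$ implementing this Darboux transform, and assume that $P(m)\le\hat s^\perp$. Then $\hat f$ projects to a linear Weingarten surface (where it immerses) with the same linear Weingarten condition as $f$ in any space form determined by space form vector and point sphere complex chosen from $P(0)$.
   Context: $\mathbb{R}^{4,2}$ is a 6-dimensional real vector space with a non-degenerate symmetric bilinear form $(\,,\,)$ of signature $(4,2)$, $\mathcal{L}$ its lightcone; $\wedge^2\mathbb{R}^{4,2}\cong\mathfrak{o}(4,2)$ via $a\wedge b\,(c)=(a,c)b-(b,c)a$; $a\odot b=\frac12(a\otimes b+b\otimes a)$. $\Sigma$ is a smooth 2-manifold, $\underline{\mathbb{R}}^{4,2}=\Sigma\times\mathbb{R}^{4,2}$, $d$ its trivial connection; $W^{(1)}$ is spanned by sections of a subbundle $W$ and their derivatives. $\mathcal{Z}$ is the Grassmannian of isotropic 2-dimensional subspaces; a smooth $f:\Sigma\to\mathcal{Z}$ (a rank 2 subbundle) is a Legendre map if $f^{(1)}\le f^\perp$ and no non-zero $X\in T\Sigma$ satisfies $d_X\sigma\in f$ for all $\sigma\in\Gamma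 f$. A curvature sphere at $p$ is a line $s(p)\le f(p)$ killed by $\sigma\mapsto d_X\sigma\bmod f$ for all $X$ in some non-zero (maximal) subspace $T_{s(p)}\le T_p\Sigma$. $f$ is umbilic-free if there are exactly two curvature spheres at each point, forming rank 1 bundles $s_1,s_2$ with curvature subbundles $T_1,T_2$. A gauge potential is a closed $\eta\in\Omega^1(f\wedge f^\perp)$ with $[\eta\wedge\eta]=0$ such that $q(X,Y)=\mathrm{tr}(\sigma\mapsto\eta(X)d_Y\sigma:f\to f)$ is non-zero; a Legendre map $f$ is an $\Omega$-surface if $q$ is non-degenerate on a dense open set. Standing assumption: $q$ has constant signature. The gauge orbit is $\{\eta-d\tau:\tau\in\Gamma(\wedge^2f)\}$. With $S_1=\langle\sigma_1,d_Y\sigma_1,d_Yd_Y\sigma_1\rangle$, $S_2=\langle\sigma_2,d_X\sigma_2,d_Xd_X\sigma_2\rangle$ ($\sigma_i\in\Gamma s_i$, $X\in\Gamma T_1$, $Y\in\Gamma T_2$), the middle potential $\eta^{mid}$ is the unique member of the gauge orbit whose $S_1\wedge S_2$-component takes values in $\wedge^2f$; the middle pencil is the family of flat metric connections $\{d+t\eta^{mid}\}_{t\in\mathbb{R}}$. A linear conserved quantity is a degree 1 polynomial $p(t)=p_0+tp_1$, $p_0,p_1\in\Gamma\underline{\mathbb{R}}^{4,2}$, with $(d+t\eta^{mid})p(t)=0$ for all $t$. ($p_0$ is then constant.) A 2-dimensional space of linear conserved quantities is a 2-dimensional real vector space $P$ whose non-zero elements are linear conserved quantities; $P(t)=\{p(t):p\in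 P\}$. On $P$: $g_t(\alpha,\beta)=(\alpha(t),\beta(t))$ for $t\in\mathbb{R}$ and $g_\infty(\alpha,\beta)=(\alpha_0,\beta_1)+(\beta_0,\alpha_1)$. Darboux transforms: for $m\in\mathbb{R}\setminus\{0\}$ let $\hat s$ be a null rank 1 subbundle parallel for $d+m\eta^{mid}$ and nowhere orthogonal to the curvature spheres of $f$; then $\hat f:=(f\cap\hat s^\perp)\oplus\hat s$ is a Darboux transform of $f$ with parameter $m$ (it is again a Legendre map). Space forms: a point sphere complex $\mathfrak{p}$ with $(\mathfrak{p},\mathfrak{p})=\pm1$ and a non-zero space form vector $\mathfrak{q}\in\langle\mathfrak{p}\rangle^\perp$ give $\mathfrak{Q}^3=\{y\in\mathcal{L}:(y,\mathfrak{q})=-1,(y,\mathfrak{p})=0\}$, a (Riemannian or Lorentzian) space form. The projection $\mathfrak{f}$ and tangent plane congruence $\mathfrak{t}$ of a Legendre map $f$ are the sections of $f$ with $(\mathfrak{f},\mathfrak{q})=-1,(\mathfrak{f},\mathfrak{p})=0$ and $(\mathfrak{t},\mathfrak{q})=0,(\mathfrak{t},\mathfrak{p})=-1$. Principal curvatures $\kappa_i$: $d_X\mathfrak{t}+\kappa_id_X\mathfrak{f}=0$ for $X\in T_i$; $K=\kappa_1\kappa_2$, $H=\frac12(\kappa_1+\kappa_2)$. Where it immerses, $\mathfrak{f}$ is linear Weingarten if $aK+2bH+c=0$ for constants $a,b,c\in\mathbb{R}$, not all zero; its linear Weingarten condition is the class $[W]\in\mathbb{P}(S^2\mathbb{R}^{4,2})$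 of $W=a\,\mathfrak{q}\odot\mathfrak{q}+2b\,\mathfrak{q}\odot\mathfrak{p}+c\,\mathfrak{p}\odot\mathfrak{p}$. *)

theory Defs
  imports "HOL-Analysis.Analysis"
begin

section \<open>Smooth maps and smooth surfaces\<close>

text \<open>The set \<open>S\<close> is meant to be open and the domain finite-dimensional; then \<open>Ck_on k S g\<close> is the
  usual notion of \<open>k\<close> times continuously differentiable.\<close>

primrec Ck_on :: "nat \<Rightarrow> 'a::real_normed_vector set \<Rightarrow> ('a \<Rightarrow> 'b::real_normed_vector) \<Rightarrow> bool" where
  "Ck_on 0 S g \<longleftrightarrow> continuous_on S g"
| "Ck_on (Suc k) S g \<longleftrightarrow>
     g differentiable_on S \<and> (\<forall>v. Ck_on k S (\<lambda>x. frechet_derivative g (at x) v))"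

definition smooth_on :: "'a::real_normed_vector set \<Rightarrow> ('a \<Rightarrow> 'b::real_normed_vector) \<Rightarrow> bool" where
  "smooth_on S g \<longleftrightarrow> (\<forall>k. Ck_on k S g)"

text \<open>A type of this class is a smooth 2-manifold (Hausdorff and second countable), whose smooth
  structure is generated by an atlas (not necessarily maximal). A chart is a pair of its domain and the
  coordinate map; the second axiom says that charts are homeomorphisms between open sets.\<close>

class smooth_surface = t2_space + second_countable_topology +
  fixes atlas :: "('a set \<times> ('a \<Rightarrow> real^2)) set"
  assumes atlas_covers: "\<exists>c\<in>atlas. x \<in> fst c"
    and atlas_homeomorphism: "(U, \<phi>) \<in> atlas \<Longrightarrow>
      open U \<and> inj_on \<phi> U \<and> (\<forall>S\<subseteq>U. open S \<longleftrightarrow> open (\<phi> ` S))"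
    and atlas_compatible: "(U, \<phi>) \<in> atlas \<Longrightarrow> (V, \<psi>) \<in> atlas \<Longrightarrow>
      smooth_on (\<phi> ` (U \<inter> V)) (\<psi> \<circ> inv_into U \<phi>)"

definition smooth_map_on :: "'p::smooth_surface set \<Rightarrow> ('p \<Rightarrow> 'b::real_normed_vector) \<Rightarrow> bool" where
  "smooth_map_on W \<sigma> \<longleftrightarrow> (\<forall>(U, \<phi>)\<in>atlas. smooth_on (\<phi> ` (U \<inter> W)) (\<sigma> \<circ> inv_into U \<phi>))"

text \<open>The tangent space at \<open>x\<close> is \<open>real^2\<close>, read in a chart around \<open>x\<close> that is chosen once and for
  all. Vectors at different points are therefore only comparable through other charts; see
  \<open>coord_field\<close> and \<open>smooth_vector_field_on\<close>.\<close>

definition chart_at :: "'p::smooth_surface \<Rightarrow> 'p set \<times> ('p \<Rightarrow> real^2)" where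
  "chart_at x = (SOME c. c \<in> atlas \<and> x \<in> fst c)"

text \<open>\<open>ddir X \<sigma> x\<close> is \<open>d\<^sub>X \<sigma>\<close> for the tangent vector \<open>X\<close> at \<open>x\<close>.\<close>

definition ddir :: "real^2 \<Rightarrow> ('p::smooth_surface \<Rightarrow> 'b::real_normed_vector) \<Rightarrow> 'p \<Rightarrow> 'b" where
  "ddir X \<sigma> x = (case chart_at x of (U, \<phi>) \<Rightarrow>
     frechet_derivative (\<sigma> \<circ> inv_into U \<phi>) (at (\<phi> x)) X)"

text \<open>The vector field whose components in the chart \<open>c\<close> are constantly \<open>v\<close>.\<close>

definition coord_field :: "'p::smooth_surface set \<times> ('p \<Rightarrow> real^2) \<Rightarrow> real^2 \<Rightarrow> 'p \<Rightarrow> real^2" where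
  "coord_field c v y = (case c of (U, \<phi>) \<Rightarrow>
     frechet_derivative (snd (chart_at y) \<circ> inv_into U \<phi>) (at (\<phi> y)) v)"

definition smooth_vector_field_on :: "'p::smooth_surface set \<Rightarrow> ('p \<Rightarrow> real^2) \<Rightarrow> bool" where
  "smooth_vector_field_on W X \<longleftrightarrow> (\<forall>(U, \<phi>)\<in>atlas. smooth_map_on (U \<inter> W) (\<lambda>x. ddir (X x) \<phi> x))"

definition smooth_one_form :: "('p::smooth_surface \<Rightarrow> real^2 \<Rightarrow> 'b::real_normed_vector) \<Rightarrow> bool" where
  "smooth_one_form \<eta> \<longleftrightarrow> (\<forall>x. linear (\<eta> x)) \<and>
     (\<forall>W X. open W \<and> smooth_vector_field_on W X \<longrightarrow> smooth_map_on W (\<lambda>x. \<eta> x (X x)))"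

text \<open>\<open>d\<eta>(X,Y) = d\<^sub>X(\<eta>(Y)) - d\<^sub>Y(\<eta>(X)) - \<eta>([X,Y])\<close>, where \<open>X\<close> and \<open>Y\<close> are extended to coordinate fields
  of the chart at \<open>x\<close>, which commute.\<close>

definition ext_deriv ::
  "('p::smooth_surface \<Rightarrow> real^2 \<Rightarrow> 'b::real_normed_vector) \<Rightarrow> 'p \<Rightarrow> real^2 \<Rightarrow> real^2 \<Rightarrow> 'b" where
  "ext_deriv \<eta> x X Y =
     ddir X (\<lambda>y. \<eta> y (coord_field (chart_at x) Y y)) x -
     ddir Y (\<lambda>y. \<eta> y (coord_field (chart_at x) X y)) x"


section \<open>The space of signature (4,2)\<close>

type_synonym R42 = "(real^4) \<times> (real^2)"

definition inn :: "R42 \<Rightarrow> R42 \<Rightarrow> real" where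
  "inn a b = fst a \<bullet> fst b - snd a \<bullet> snd b"

definition perp :: "R42 set \<Rightarrow> R42 set" where
  "perp S = {v. \<forall>s\<in>S. inn v s = 0}"

text \<open>The exterior square is identified with the skew endomorphisms.\<close>

definition wedge :: "R42 \<Rightarrow> R42 \<Rightarrow> (R42 \<Rightarrow>\<^sub>L R42)" where
  "wedge a b = Blinfun (\<lambda>c. inn a c *\<^sub>R b - inn b c *\<^sub>R a)"

lemma wedge_apply: "blinfun_apply (wedge a b) c = inn a c *\<^sub>R b - inn b c *\<^sub>R a"
proof -
  have "linear (\<lambda>c. inn a c *\<^sub>R b - inn b c *\<^sub>R a)"
    by (rule linearI) (auto simp: inn_def algebra_simps)
  then show ?thesis
    by (simp add: wedge_def bounded_linear_Blinfun_apply linear_conv_bounded_linear)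
qed

definition wedge_space :: "R42 set \<Rightarrow> R42 set \<Rightarrow> (R42 \<Rightarrow>\<^sub>L R42) set" where
  "wedge_space A B = span {wedge a b | a b. a \<in> A \<and> b \<in> B}"

text \<open>Symmetric 2-tensors are represented as bilinear forms, via the non-degenerate form \<open>inn\<close>.\<close>

definition symprod :: "R42 \<Rightarrow> R42 \<Rightarrow> R42 \<Rightarrow> R42 \<Rightarrow> real" where
  "symprod a b u v = (inn a u * inn b v + inn b u * inn a v) / 2"

definition proj_class :: "(R42 \<Rightarrow> R42 \<Rightarrow> real) \<Rightarrow> (R42 \<Rightarrow> R42 \<Rightarrow> real) set" where
  "proj_class W = {\<lambda>u v. r * W u v | r. r \<noteq> 0}"


section \<open>Subbundles of the trivial bundle and Legendre maps\<close>

definition subbundle :: "nat \<Rightarrow> ('p::smooth_surface \<Rightarrow> R42 set) \<Rightarrow> bool" where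
  "subbundle k F \<longleftrightarrow> (\<forall>x. subspace (F x) \<and> dim (F x) = k) \<and>
     (\<forall>x. \<exists>W (\<sigma> :: nat \<Rightarrow> 'p \<Rightarrow> R42). open W \<and> x \<in> W \<and> (\<forall>i<k. smooth_map_on W (\<sigma> i)) \<and>
        (\<forall>y\<in>W. F y = span ((\<lambda>i. \<sigma> i y) ` {..<k})))"

definition isotropic_bundle :: "('p \<Rightarrow> R42 set) \<Rightarrow> bool" where
  "isotropic_bundle F \<longleftrightarrow> (\<forall>x. \<forall>a\<in>F x. \<forall>b\<in>F x. inn a b = 0)"

text \<open>Smooth sections of \<open>F\<close> defined on some neighbourhood of \<open>x\<close>.\<close>

definition sections_at :: "('p::smooth_surface \<Rightarrow> R42 set) \<Rightarrow> 'p \<Rightarrow> ('p \<Rightarrow> R42) set" where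
  "sections_at F x = {\<sigma>. \<exists>W. open W \<and> x \<in> W \<and> smooth_map_on W \<sigma> \<and> (\<forall>y\<in>W. \<sigma> y \<in> F y)}"

definition vector_fields_at :: "('p::smooth_surface \<Rightarrow> (real^2) set) \<Rightarrow> 'p \<Rightarrow> ('p \<Rightarrow> real^2) set" where
  "vector_fields_at T x =
     {X. \<exists>W. open W \<and> x \<in> W \<and> smooth_vector_field_on W X \<and> (\<forall>y\<in>W. X y \<in> T y)}"

definition derived_bundle :: "('p::smooth_surface \<Rightarrow> R42 set) \<Rightarrow> 'p \<Rightarrow> R42 set" where
  "derived_bundle F x =
     span ({\<sigma> x | \<sigma>. \<sigma> \<in> sections_at F x} \<union> {ddir X \<sigma> x | X \<sigma>. \<sigma> \<in> sections_at F x})"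

definition legendre :: "('p::smooth_surface \<Rightarrow> R42 set) \<Rightarrow> bool" where
  "legendre f \<longleftrightarrow> subbundle 2 f \<and> isotropic_bundle f \<and>
     (\<forall>x. derived_bundle f x \<subseteq> perp (f x)) \<and>
     (\<forall>x X. (\<forall>\<sigma>\<in>sections_at f x. ddir X \<sigma> x \<in> f x) \<longrightarrow> X = 0)"

definition curvature_space :: "('p::smooth_surface \<Rightarrow> R42 set) \<Rightarrow> 'p \<Rightarrow> R42 set \<Rightarrow> (real^2) set" where
  "curvature_space f x s = {X. \<forall>\<sigma>\<in>sections_at f x. \<sigma> x \<in> s \<longrightarrow> ddir X \<sigma> x \<in> f x}"

definition curvature_sphere :: "('p::smooth_surface \<Rightarrow> R42 set) \<Rightarrow> 'p \<Rightarrow> R42 set \<Rightarrow> bool" where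
  "curvature_sphere f x s \<longleftrightarrow>
     subspace s \<and> dim s = 1 \<and> s \<subseteq> f x \<and> (\<exists>X\<in>curvature_space f x s. X \<noteq> 0)"

text \<open>\<open>f\<close> is an umbilic-free Legendre map, with curvature sphere bundles \<open>s1\<close> and \<open>s2\<close>.\<close>

definition umbilic_free ::
  "('p::smooth_surface \<Rightarrow> R42 set) \<Rightarrow> ('p \<Rightarrow> R42 set) \<Rightarrow> ('p \<Rightarrow> R42 set) \<Rightarrow> bool" where
  "umbilic_free f s1 s2 \<longleftrightarrow> legendre f \<and> subbundle 1 s1 \<and> subbundle 1 s2 \<and>
     (\<forall>x. s1 x \<noteq> s2 x \<and> {s. curvature_sphere f x s} = {s1 x, s2 x})"


section \<open>Gauge potentials and \<open>\<Omega>\<close>-surfaces\<close>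

type_synonym 'p o_form = "'p \<Rightarrow> real^2 \<Rightarrow> (R42 \<Rightarrow>\<^sub>L R42)"

definition bracket_wedge :: "'p o_form \<Rightarrow> 'p \<Rightarrow> real^2 \<Rightarrow> real^2 \<Rightarrow> (R42 \<Rightarrow>\<^sub>L R42)" where
  "bracket_wedge \<eta> x X Y = 2 *\<^sub>R ((\<eta> x X o\<^sub>L \<eta> x Y) - (\<eta> x Y o\<^sub>L \<eta> x X))"

definition trace_on :: "R42 set \<Rightarrow> (R42 \<Rightarrow> R42) \<Rightarrow> real" where
  "trace_on S T = (let B = (SOME B. B \<subseteq> S \<and> independent B \<and> S \<subseteq> span B)
                   in \<Sum>b\<in>B. representation B (T b) b)"

text \<open>For a Legendre map and \<open>\<eta>\<close> with values in \<open>f \<and> f\<^sup>\<bottom>\<close>, the endomorphism of \<open>f x\<close> whose trace is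
  taken does not depend on the extension \<open>\<sigma>\<close> of its argument \<open>s\<close> to a section of \<open>f\<close>.\<close>

definition quad_diff ::
  "('p::smooth_surface \<Rightarrow> R42 set) \<Rightarrow> 'p o_form \<Rightarrow> 'p \<Rightarrow> real^2 \<Rightarrow> real^2 \<Rightarrow> real" where
  "quad_diff f \<eta> x X Y = trace_on (f x)
     (\<lambda>s. blinfun_apply (\<eta> x X) (ddir Y (SOME \<sigma>. \<sigma> \<in> sections_at f x \<and> \<sigma> x = s) x))"

definition gauge_potential :: "('p::smooth_surface \<Rightarrow> R42 set) \<Rightarrow> 'p o_form \<Rightarrow> bool" where
  "gauge_potential f \<eta> \<longleftrightarrow> smooth_one_form \<eta> \<and>
     (\<forall>x X. \<eta> x X \<in> wedge_space (f x) (perp (f x))) \<and>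
     (\<forall>x X Y. ext_deriv \<eta> x X Y = 0) \<and>
     (\<forall>x X Y. bracket_wedge \<eta> x X Y = 0) \<and>
     (\<exists>x X Y. quad_diff f \<eta> x X Y \<noteq> 0)"

definition omega_surface :: "('p::smooth_surface \<Rightarrow> R42 set) \<Rightarrow> 'p o_form \<Rightarrow> bool" where
  "omega_surface f \<eta> \<longleftrightarrow> legendre f \<and> gauge_potential f \<eta> \<and>
     (\<exists>D. open D \<and> closure D = UNIV \<and>
        (\<forall>x\<in>D. \<forall>X. (\<forall>Y. quad_diff f \<eta> x X Y = 0) \<longrightarrow> X = 0))"

definition pos_index :: "(real^2 \<Rightarrow> real^2 \<Rightarrow> real) \<Rightarrow> nat" where
  "pos_index Q = Max {dim S | S. subspace S \<and> (\<forall>X\<in>S. X \<noteq> 0 \<longrightarrow> Q X X > 0)}"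

definition form_signature :: "(real^2 \<Rightarrow> real^2 \<Rightarrow> real) \<Rightarrow> nat \<times> nat" where
  "form_signature Q = (pos_index Q, pos_index (\<lambda>X Y. - Q X Y))"

definition constant_signature :: "('p::smooth_surface \<Rightarrow> R42 set) \<Rightarrow> 'p o_form \<Rightarrow> bool" where
  "constant_signature f \<eta> \<longleftrightarrow>
     (\<forall>x y. form_signature (quad_diff f \<eta> x) = form_signature (quad_diff f \<eta> y))"

definition gauge_orbit :: "('p::smooth_surface \<Rightarrow> R42 set) \<Rightarrow> 'p o_form \<Rightarrow> 'p o_form set" where
  "gauge_orbit f \<eta> = {\<lambda>x X. \<eta> x X - ddir X \<tau> x | \<tau>.
     smooth_map_on UNIV \<tau> \<and> (\<forall>x. \<tau> x \<in> wedge_space (f x) (f x))}"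

text \<open>\<open>\<langle>\<sigma>, d\<^sub>Y \<sigma>, d\<^sub>Y d\<^sub>Y \<sigma>\<rangle>\<close> for sections \<open>\<sigma>\<close> of \<open>s\<close> and vector fields \<open>Y\<close> in \<open>T\<close>.\<close>

definition second_osculating ::
  "('p::smooth_surface \<Rightarrow> R42 set) \<Rightarrow> ('p \<Rightarrow> (real^2) set) \<Rightarrow> 'p \<Rightarrow> R42 set" where
  "second_osculating s T x = span (\<Union>\<sigma>\<in>sections_at s x. \<Union>Y\<in>vector_fields_at T x.
     {\<sigma> x, ddir (Y x) \<sigma> x, ddir (Y x) (\<lambda>y. ddir (Y y) \<sigma> y) x})"

text \<open>\<open>\<eta>'\<close> is the middle potential in the gauge orbit of \<open>\<eta>\<close>. Since \<open>R42 = S1 \<oplus> S2\<close>, the exterior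
  square is the direct sum of the exterior squares of \<open>S1\<close> and \<open>S2\<close> and of \<open>S1 \<and> S2\<close>; below \<open>\<beta>\<close> is
  the last component of \<open>\<eta>'(X)\<close>.\<close>

definition middle_potential ::
  "('p::smooth_surface \<Rightarrow> R42 set) \<Rightarrow> ('p \<Rightarrow> R42 set) \<Rightarrow> ('p \<Rightarrow> R42 set) \<Rightarrow>
   'p o_form \<Rightarrow> 'p o_form \<Rightarrow> bool" where
  "middle_potential f s1 s2 \<eta> \<eta>' \<longleftrightarrow> \<eta>' \<in> gauge_orbit f \<eta> \<and>
     (let S1 = second_osculating s1 (\<lambda>y. curvature_space f y (s2 y));
          S2 = second_osculating s2 (\<lambda>y. curvature_space f y (s1 y))
      in \<forall>x X. \<exists>\<alpha>1 \<beta> \<alpha>2. \<eta>' x X = \<alpha>1 + \<beta> + \<alpha>2 \<and>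
           \<alpha>1 \<in> wedge_space (S1 x) (S1 x) \<and> \<beta> \<in> wedge_space (S1 x) (S2 x) \<and>
           \<alpha>2 \<in> wedge_space (S2 x) (S2 x) \<and> \<beta> \<in> wedge_space (f x) (f x))"


section \<open>Linear conserved quantities\<close>

text \<open>\<open>conn t \<eta> \<sigma> x X\<close> is \<open>(d + t\<eta>)\<^sub>X \<sigma>\<close> at \<open>x\<close>.\<close>

definition conn :: "real \<Rightarrow> 'p::smooth_surface o_form \<Rightarrow> ('p \<Rightarrow> R42) \<Rightarrow> 'p \<Rightarrow> real^2 \<Rightarrow> R42" where
  "conn t \<eta> \<sigma> x X = ddir X \<sigma> x + t *\<^sub>R blinfun_apply (\<eta> x X) (\<sigma> x)"

text \<open>The pair \<open>(p0, p1)\<close> represents \<open>p0 + t p1\<close>.\<close>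

type_synonym 'p lin_poly = "('p \<Rightarrow> R42) \<times> ('p \<Rightarrow> R42)"

definition lp_eval :: "'p lin_poly \<Rightarrow> real \<Rightarrow> 'p \<Rightarrow> R42" where
  "lp_eval \<alpha> t = (\<lambda>x. fst \<alpha> x + t *\<^sub>R snd \<alpha> x)"

definition lp_zero :: "'p lin_poly" where
  "lp_zero = (\<lambda>_. 0, \<lambda>_. 0)"

definition lp_comb :: "real \<Rightarrow> 'p lin_poly \<Rightarrow> real \<Rightarrow> 'p lin_poly \<Rightarrow> 'p lin_poly" where
  "lp_comb a \<alpha> b \<beta> =
     (\<lambda>x. a *\<^sub>R fst \<alpha> x + b *\<^sub>R fst \<beta> x, \<lambda>x. a *\<^sub>R snd \<alpha> x + b *\<^sub>R snd \<beta> x)"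

definition linear_conserved_quantity :: "'p::smooth_surface o_form \<Rightarrow> 'p lin_poly \<Rightarrow> bool" where
  "linear_conserved_quantity \<eta> \<alpha> \<longleftrightarrow>
     smooth_map_on UNIV (fst \<alpha>) \<and> smooth_map_on UNIV (snd \<alpha>) \<and> snd \<alpha> \<noteq> (\<lambda>_. 0) \<and>
     (\<forall>t x X. conn t \<eta> (lp_eval \<alpha> t) x X = 0)"

definition two_dim_lcq_space :: "'p::smooth_surface o_form \<Rightarrow> 'p lin_poly set \<Rightarrow> bool" where
  "two_dim_lcq_space \<eta> P \<longleftrightarrow>
     (\<exists>\<alpha> \<beta>. (\<forall>a b. lp_comb a \<alpha> b \<beta> = lp_zero \<longrightarrow> a = 0 \<and> b = 0) \<and> P = {lp_comb a \<alpha> b \<beta> | a b. True}) \<and>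
     (\<forall>\<gamma>\<in>P. \<gamma> \<noteq> lp_zero \<longrightarrow> linear_conserved_quantity \<eta> \<gamma>)"

definition lp_eval_space :: "'p lin_poly set \<Rightarrow> real \<Rightarrow> ('p \<Rightarrow> R42) set" where
  "lp_eval_space P t = (\<lambda>\<alpha>. lp_eval \<alpha> t) ` P"

text \<open>For linear conserved quantities on a connected surface the functions of \<open>x\<close> in the next two
  definitions are constant, as the connections \<open>d + t\<eta>\<close> are metric.\<close>

definition g_form :: "real \<Rightarrow> 'p lin_poly \<Rightarrow> 'p lin_poly \<Rightarrow> real" where
  "g_form t \<alpha> \<beta> = (THE c. \<forall>x. inn (lp_eval \<alpha> t x) (lp_eval \<beta> t x) = c)"

definition g_infty :: "'p lin_poly \<Rightarrow> 'p lin_poly \<Rightarrow> real" where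
  "g_infty \<alpha> \<beta> = (THE c. \<forall>x. inn (fst \<alpha> x) (snd \<beta> x) + inn (fst \<beta> x) (snd \<alpha> x) = c)"


section \<open>Darboux transforms\<close>

text \<open>\<open>fh\<close> is the Darboux transform of \<open>f\<close> with parameter \<open>m\<close> implemented by \<open>sh\<close>, where \<open>\<eta>\<close> is the
  middle potential of \<open>f\<close>.\<close>

definition darboux_transform ::
  "('p::smooth_surface \<Rightarrow> R42 set) \<Rightarrow> 'p o_form \<Rightarrow> real \<Rightarrow> ('p \<Rightarrow> R42 set) \<Rightarrow> ('p \<Rightarrow> R42 set) \<Rightarrow> bool" where
  "darboux_transform f \<eta> m sh fh \<longleftrightarrow> m \<noteq> 0 \<and>
     subbundle 1 sh \<and> isotropic_bundle sh \<and>
     (\<forall>x. \<forall>\<sigma>\<in>sections_at sh x. \<forall>X. conn m \<eta> \<sigma> x X \<in> sh x) \<and>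
     (\<forall>x s. curvature_sphere f x s \<longrightarrow> \<not> s \<subseteq> perp (sh x)) \<and>
     (\<forall>x. fh x = {a + b | a b. a \<in> f x \<inter> perp (sh x) \<and> b \<in> sh x})"


section \<open>Space form projections and linear Weingarten surfaces\<close>

definition space_form_vectors :: "R42 \<Rightarrow> R42 \<Rightarrow> bool" where
  "space_form_vectors qq pp \<longleftrightarrow> (inn pp pp = 1 \<or> inn pp pp = - 1) \<and> qq \<noteq> 0 \<and> inn qq pp = 0"

definition space_form_projection ::
  "('p::smooth_surface \<Rightarrow> R42 set) \<Rightarrow> R42 \<Rightarrow> R42 \<Rightarrow> ('p \<Rightarrow> R42) \<Rightarrow> ('p \<Rightarrow> R42) \<Rightarrow> bool" where
  "space_form_projection f qq pp ff tt \<longleftrightarrow>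
     smooth_map_on UNIV ff \<and> smooth_map_on UNIV tt \<and>
     (\<forall>x. ff x \<in> f x \<and> inn (ff x) qq = - 1 \<and> inn (ff x) pp = 0 \<and>
          tt x \<in> f x \<and> inn (tt x) qq = 0 \<and> inn (tt x) pp = - 1)"

definition immersed_at :: "('p::smooth_surface \<Rightarrow> R42) \<Rightarrow> 'p \<Rightarrow> bool" where
  "immersed_at ff x \<longleftrightarrow> (\<forall>X. ddir X ff x = 0 \<longrightarrow> X = 0)"

text \<open>The principal curvature along the curvature subspace \<open>T\<close> at \<open>x\<close>; it exists and is unique
  where \<open>ff\<close> immerses.\<close>

definition principal_curvature ::
  "('p::smooth_surface \<Rightarrow> R42) \<Rightarrow> ('p \<Rightarrow> R42) \<Rightarrow> 'p \<Rightarrow> (real^2) set \<Rightarrow> real" where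
  "principal_curvature ff tt x T = (THE \<kappa>. \<forall>X\<in>T. ddir X tt x + \<kappa> *\<^sub>R ddir X ff x = 0)"

definition satisfies_weingarten ::
  "('p::smooth_surface \<Rightarrow> R42 set) \<Rightarrow> ('p \<Rightarrow> R42 set) \<Rightarrow> ('p \<Rightarrow> R42 set) \<Rightarrow> R42 \<Rightarrow> R42 \<Rightarrow>
   real \<Rightarrow> real \<Rightarrow> real \<Rightarrow> bool" where
  "satisfies_weingarten f s1 s2 qq pp a b c \<longleftrightarrow>
     (\<exists>ff tt. space_form_projection f qq pp ff tt \<and>
       (\<forall>x. immersed_at ff x \<longrightarrow>
         (let \<kappa>1 = principal_curvature ff tt x (curvature_space f x (s1 x));
              \<kappa>2 = principal_curvature ff tt x (curvature_space f x (s2 x));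
              K = \<kappa>1 * \<kappa>2;
              H = (\<kappa>1 + \<kappa>2) / 2
          in a * K + 2 * b * H + c = 0)))"

definition weingarten_tensor ::
  "R42 \<Rightarrow> R42 \<Rightarrow> real \<Rightarrow> real \<Rightarrow> real \<Rightarrow> R42 \<Rightarrow> R42 \<Rightarrow> real" where
  "weingarten_tensor qq pp a b c =
     (\<lambda>u v. a * symprod qq qq u v + 2 * b * symprod qq pp u v + c * symprod pp pp u v)"

text \<open>\<open>f\<close>, with curvature sphere bundles \<open>s1\<close> and \<open>s2\<close>, projects to a linear Weingarten surface, where
  it immerses, in the space form given by \<open>qq\<close> and \<open>pp\<close>, with linear Weingarten condition \<open>C\<close>.\<close>

definition projects_to_linear_weingarten ::
  "('p::smooth_surface \<Rightarrow> R42 set) \<Rightarrow> ('p \<Rightarrow> R42 set) \<Rightarrow> ('p \<Rightarrow> R42 set) \<Rightarrow> R42 \<Rightarrow> R42 \<Rightarrow>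
   (R42 \<Rightarrow> R42 \<Rightarrow> real) set \<Rightarrow> bool" where
  "projects_to_linear_weingarten f s1 s2 qq pp C \<longleftrightarrow>
     (\<exists>a b c. \<not> (a = 0 \<and> b = 0 \<and> c = 0) \<and> C = proj_class (weingarten_tensor qq pp a b c) \<and>
        satisfies_weingarten f s1 s2 qq pp a b c)"

end

theory Submission
  imports Defs
begin

text \<open>
  Once the middle potential is in normal form, the theorem is linear algebra at each point.

  Let \<open>a\<close> and \<open>b\<close> span the curvature spheres of \<open>f\<close> and let \<open>X\<close> and \<open>Y\<close> be the curvature directions,
  so that \<open>d\<^sub>X a\<close> and \<open>d\<^sub>Y b\<close> lie in \<open>f\<close>. The vectors \<open>wX = d\<^sub>X b\<close> and \<open>wY = d\<^sub>Y a\<close> span \<open>f\<^sup>\<bottom>/f\<close>, where the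
  form is positive definite, and they are orthogonal because the second fundamental form is symmetric.
  Closedness of a gauge potential, applied to sections \<open>\<sigma>\<close> of \<open>f\<close>, becomes \<open>\<eta>(X) d\<^sub>Y \<sigma> = \<eta>(Y) d\<^sub>X \<sigma>\<close>, whence
  \<open>\<eta>(X) wY = \<eta>(Y) wX = 0\<close>. For the middle potential \<open>\<eta>(X) wX\<close> has no \<open>a\<close>-component, since \<open>wX\<close> is
  orthogonal to the second osculating space of \<open>a\<close> and \<open>a\<close> does not lie in that of \<open>b\<close>. So modulo the
  exterior square of \<open>f\<close> the middle potential is \<open>C b \<and> wX\<close> along \<open>X\<close> and \<open>B a \<and> wY\<close> along \<open>Y\<close>; this is the locale
  \<open>principal_frame\<close>. The quadratic differential is diagonal with entries proportional to \<open>C\<close> and \<open>B\<close>,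
  and as its signature is constant, \<open>B\<close> and \<open>C\<close> vanish nowhere.

  A conserved quantity \<open>p\<^sub>0 + t p\<^sub>1\<close> has \<open>\<eta> p\<^sub>1 = 0\<close>, which forces \<open>p\<^sub>1\<close> into \<open>f\<close>, and \<open>d p\<^sub>1 = - \<eta> p\<^sub>0\<close> modulo \<open>f\<close>
  then reads \<open>p\<^sub>1 = - B (a,p\<^sub>0) a - C (b,p\<^sub>0) b\<close>. Hence \<open>g_infty\<close> is diagonal in the two covectors that \<open>a\<close> and
  \<open>b\<close> induce on \<open>P(0)\<close>. If it is non-degenerate, these covectors are coordinates, so that \<open>P(0)\<close> separates
  the points of \<open>f(x)\<close> and the projections to space forms exist everywhere; and \<open>a\<close> and \<open>b\<close> are conjugate
  for the inverse \<open>W\<close> of \<open>g_infty\<close>, a symmetric tensor over \<open>P(0)\<close>. Written with the tangent plane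
  congruence and the projection, conjugacy of the curvature spheres is the linear Weingarten equation
  with coefficients \<open>W\<close> (\<open>satisfies_weingartenI\<close>).

  For the Darboux transform let \<open>\<sigma>\<close> span the parallel bundle and put \<open>h1 = (a,\<sigma>)\<close> and \<open>h2 = (b,\<sigma>)\<close>. That
  \<open>P(m)\<close> is orthogonal to \<open>\<sigma>\<close> says that \<open>\<sigma>\<close> acts on \<open>P(0)\<close> as \<open>m (B h1 a + C h2 b)\<close>. With
  \<open>\<rho> = h2 a - h1 b\<close>, parallelism shows that the curvature spheres of the transform are
  \<open>h1 \<sigma> - m C h2 \<rho>\<close> along \<open>X\<close> and \<open>h2 \<sigma> + m B h1 \<rho>\<close> along \<open>Y\<close> (\<open>darboux_spheres\<close>). They are conjugate for
  the same \<open>W\<close> (\<open>conjugate_darboux\<close>). They would coincide if \<open>B h1\<^sup>2 + C h2\<^sup>2 = 0\<close>, so being umbilic-free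
  excludes this, and a non-zero value of this expression is also what makes \<open>P(0)\<close> separate the points of
  the plane of the transform.
\<close>

section \<open>Calculus of smooth maps\<close>

abbreviation FD :: "('a::real_normed_vector \<Rightarrow> 'b::real_normed_vector) \<Rightarrow> 'a \<Rightarrow> 'a \<Rightarrow> 'b" where
  "FD g u v \<equiv> frechet_derivative g (at u) v"

lemma frechet_derivative_cong_open:
  assumes "open S" "x \<in> S" "\<And>y. y \<in> S \<Longrightarrow> g y = h y"
  shows "FD g x = FD h x"
proof -
  have "(g has_derivative D) (at x) \<longleftrightarrow> (h has_derivative D) (at x)" for D
    using assms by (metis has_derivative_transform_within_open)
  then show ?thesis
    by (simp add: frechet_derivative_def)
qed

lemma differentiable_on_cong:
  "(\<And>x. x \<in> S \<Longrightarrow> g x = h x) \<Longrightarrow> g differentiable_on S \<longleftrightarrow> h differentiable_on S"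
  unfolding differentiable_on_def by (metis differentiable_transform_within zero_less_one)

lemma Ck_on_cong:
  assumes "open S"
  shows "(\<And>x. x \<in> S \<Longrightarrow> g x = h x) \<Longrightarrow> Ck_on k S g \<longleftrightarrow> Ck_on k S h"
proof (induction k arbitrary: g h)
  case 0
  then show ?case by (simp cong: continuous_on_cong)
next
  case (Suc k)
  have "Ck_on k S (\<lambda>x. FD g x v) \<longleftrightarrow> Ck_on k S (\<lambda>x. FD h x v)" for v
    using frechet_derivative_cong_open[OF assms _ Suc.prems] by (intro Suc.IH) auto
  then show ?case
    using differentiable_on_cong[of S g h] Suc.prems by simp
qed

lemma smooth_on_cong:
  "open S \<Longrightarrow> (\<And>x. x \<in> S \<Longrightarrow> g x = h x) \<Longrightarrow> smooth_on S g \<longleftrightarrow> smooth_on S h"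
  unfolding smooth_on_def using Ck_on_cong by blast

lemma Ck_on_subset: "Ck_on k S g \<Longrightarrow> T \<subseteq> S \<Longrightarrow> Ck_on k T g"
  by (induction k arbitrary: g) (auto intro: continuous_on_subset differentiable_on_subset)

lemma smooth_on_subset: "smooth_on S g \<Longrightarrow> T \<subseteq> S \<Longrightarrow> smooth_on T g"
  unfolding smooth_on_def using Ck_on_subset by blast

lemma Ck_on_Suc_imp: "Ck_on (Suc k) S g \<Longrightarrow> Ck_on k S g"
  by (induction k arbitrary: g) (auto intro: differentiable_imp_continuous_on)

lemma Ck_on_local:
  assumes "open S" "\<And>x. x \<in> S \<Longrightarrow> \<exists>T. open T \<and> x \<in> T \<and> Ck_on k T g"
  shows "Ck_on k S g"
  using assms(2)
proof (induction k arbitrary: g)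
  case 0
  have "continuous (at x) g" if x: "x \<in> S" for x
  proof -
    obtain T where "open T" "x \<in> T" "continuous_on T g" using 0[OF x] by auto
    then show ?thesis by (simp add: continuous_on_eq_continuous_at)
  qed
  then show ?case
    unfolding Ck_on.simps by (intro continuous_at_imp_continuous_on ballI)
next
  case (Suc k)
  have "g differentiable (at x)" if "x \<in> S" for x
    using Suc.prems[OF that] by (metis Ck_on.simps(2) at_within_open differentiable_on_def)
  then have "g differentiable_on S"
    by (intro differentiable_at_imp_differentiable_on)
  moreover have "Ck_on k S (\<lambda>x. FD g x v)" for v
    using Suc.prems by (intro Suc.IH) (metis Ck_on.simps(2))
  ultimately show ?case by simp
qed

lemma smooth_on_local:
  assumes "open S" "\<And>x. x \<in> S \<Longrightarrow> \<exists>T. open T \<and> x \<in> T \<and> smooth_on T g"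
  shows "smooth_on S g"
  unfolding smooth_on_def using assms Ck_on_local unfolding smooth_on_def by metis

lemma smooth_on_imp_differentiable:
  "smooth_on S g \<Longrightarrow> open S \<Longrightarrow> x \<in> S \<Longrightarrow> g differentiable (at x)"
  unfolding smooth_on_def by (metis Ck_on.simps(2) at_within_open differentiable_on_def)

lemma smooth_on_imp_continuous_on: "smooth_on S g \<Longrightarrow> continuous_on S g"
  unfolding smooth_on_def by (metis Ck_on.simps(1))

lemma smooth_on_frechet_derivative:
  "smooth_on S g \<Longrightarrow> smooth_on S (\<lambda>x. FD g x v)"
  unfolding smooth_on_def by (metis Ck_on.simps(2))

lemma Ck_on_const: "Ck_on k S (\<lambda>x. c)"
  by (induction k arbitrary: c) auto

lemma smooth_on_const [simp]: "smooth_on S (\<lambda>x. c)"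
  by (simp add: smooth_on_def Ck_on_const)

lemma Ck_on_Suc_at:
  assumes "open S" "x \<in> S" "Ck_on (Suc k) S g"
  shows "(g has_derivative FD g x) (at x)"
  using assms by (metis Ck_on.simps(2) at_within_open differentiable_on_def frechet_derivative_works)

lemma Ck_on_SucI:
  assumes "open S" "\<And>x. x \<in> S \<Longrightarrow> (g has_derivative g' x) (at x)" "\<And>v. Ck_on k S (\<lambda>x. g' x v)"
  shows "Ck_on (Suc k) S g"
proof -
  have "Ck_on k S (\<lambda>x. FD g x v)" for v
    using Ck_on_cong[OF assms(1), of "\<lambda>x. FD g x v" "\<lambda>x. g' x v" k]
      assms(3)[of v] frechet_derivative_at[OF assms(2)] by metis
  moreover have "g differentiable_on S"
    using assms(2) by (meson differentiable_at_imp_differentiable_on differentiable_def)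
  ultimately show ?thesis by simp
qed

lemma Ck_on_add:
  assumes "open S"
  shows "Ck_on k S g \<Longrightarrow> Ck_on k S h \<Longrightarrow> Ck_on k S (\<lambda>x. g x + h x)"
proof (induction k arbitrary: g h)
  case 0
  then show ?case by (auto intro: continuous_intros)
next
  case (Suc k)
  show ?case
  proof (rule Ck_on_SucI[OF assms has_derivative_add])
    show "(g has_derivative FD g x) (at x)"
      "(h has_derivative FD h x) (at x)" if "x \<in> S" for x
      using Ck_on_Suc_at[OF assms that] Suc.prems by blast+
    show "Ck_on k S (\<lambda>x. FD g x v + FD h x v)" for v
      using Suc by simp
  qed
qed

text \<open>Induction on \<open>k\<close> for all pairs of factors at once: by the product rule a derivative of the product is a
  sum of two such products in which one factor has been differentiated.\<close>

lemma Ck_on_bilinear: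
  assumes "open S" "bounded_bilinear B"
  shows "Ck_on k S g \<Longrightarrow> Ck_on k S h \<Longrightarrow> Ck_on k S (\<lambda>x. B (g x) (h x))"
proof (induction k arbitrary: g h)
  case 0
  then show ?case using bounded_bilinear.continuous_on[OF assms(2)] by auto
next
  case (Suc k)
  show ?case
  proof (rule Ck_on_SucI[OF assms(1) bounded_bilinear.FDERIV[OF assms(2)]])
    show "(g has_derivative FD g x) (at x)"
      "(h has_derivative FD h x) (at x)" if "x \<in> S" for x
      using Ck_on_Suc_at[OF assms(1) that] Suc.prems by blast+
    show "Ck_on k S (\<lambda>x. B (g x) (FD h x v) +
        B (FD g x v) (h x))" for v
      using Suc.prems Ck_on_Suc_imp[OF Suc.prems(1)] Ck_on_Suc_imp[OF Suc.prems(2)]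
      by (intro Ck_on_add assms Suc.IH) auto
  qed
qed

lemma Ck_on_linear:
  assumes "open S" "bounded_linear L" "Ck_on k S g"
  shows "Ck_on k S (\<lambda>x. L (g x))"
proof -
  have "bounded_bilinear (\<lambda>(r::real) y. r *\<^sub>R L y)"
    using bounded_bilinear.comp[OF bounded_bilinear_scaleR bounded_linear_ident assms(2)] .
  from Ck_on_bilinear[OF assms(1) this Ck_on_const[of k S 1] assms(3)] show ?thesis by simp
qed

lemma Ck_on_sum:
  assumes "open S" "\<And>i. i \<in> I \<Longrightarrow> Ck_on k S (g i)"
  shows "Ck_on k S (\<lambda>x. \<Sum>i\<in>I. g i x)"
  using assms(2)
proof (induction I rule: infinite_finite_induct)
  case (insert i I)
  then show ?case using Ck_on_add[OF assms(1), of k "g i" "\<lambda>x. \<Sum>i\<in>I. g i x"] by simp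
qed (auto simp: Ck_on_const)

lemma frechet_derivative_axis_sum:
  fixes g :: "real^'n \<Rightarrow> 'b::real_normed_vector"
  assumes "g differentiable (at x)"
  shows "FD g x v = (\<Sum>i\<in>UNIV. (v $ i) *\<^sub>R FD g x (axis i 1))"
proof -
  have l: "linear (FD g x)"
    using assms by (rule linear_frechet_derivative)
  have "v = (\<Sum>i\<in>UNIV. (v $ i) *\<^sub>R axis i 1)"
    by (simp add: basis_expansion scalar_mult_eq_scaleR[symmetric])
  then show ?thesis
    using linear_sum[OF l, of "\<lambda>i. (v $ i) *\<^sub>R axis i 1" UNIV] linear_scale[OF l] by simp
qed

text \<open>With respect to the coordinates of the intermediate space the chain rule is a sum of products of the
  partial derivatives of \<open>g\<close>, composed with \<open>h\<close>, and the derivatives of the components of \<open>h\<close>. The induction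
  hypothesis is applied to the partial derivatives.\<close>

lemma Ck_on_compose:
  fixes g :: "real^'n \<Rightarrow> 'b::real_normed_vector" and h :: "'a::real_normed_vector \<Rightarrow> real^'n"
  assumes "open S" "open T" "h ` S \<subseteq> T"
  shows "Ck_on k T g \<Longrightarrow> Ck_on k S h \<Longrightarrow> Ck_on k S (g \<circ> h)"
proof (induction k arbitrary: g)
  case 0
  then show ?case
    by (metis Ck_on.simps(1) assms(3) continuous_on_compose continuous_on_subset)
next
  case (Suc k)
  have gk: "Ck_on k T g" and hk: "Ck_on k S h"
    using Suc.prems Ck_on_Suc_imp by blast+
  show ?case
  proof (rule Ck_on_SucI[OF assms(1)])
    fix x assume x: "x \<in> S"
    have "(g has_derivative frechet_derivative g (at (h x))) (at (h x))"
      using x assms Suc.prems by (intro Ck_on_Suc_at) auto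
    moreover from this have "frechet_derivative g (at (h x)) =
        (\<lambda>w. \<Sum>i\<in>UNIV. (w $ i) *\<^sub>R frechet_derivative g (at (h x)) (axis i 1))"
      by (intro ext frechet_derivative_axis_sum) (auto simp: differentiable_def)
    ultimately have "(g has_derivative (\<lambda>w. \<Sum>i\<in>UNIV. (w $ i) *\<^sub>R
        ((\<lambda>y. frechet_derivative g (at y) (axis i 1)) \<circ> h) x)) (at (h x))"
      by simp
    then show "((g \<circ> h) has_derivative (\<lambda>w. \<Sum>i\<in>UNIV. (w $ i) *\<^sub>R
        ((\<lambda>y. frechet_derivative g (at y) (axis i 1)) \<circ> h) x) \<circ> frechet_derivative h (at x)) (at x)"
      using Ck_on_Suc_at[OF assms(1) x Suc.prems(2)] by (rule diff_chain_at[rotated])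
  next
    have "Ck_on k S (\<lambda>x. \<Sum>i\<in>UNIV. (frechet_derivative h (at x) v $ i) *\<^sub>R
        ((\<lambda>y. frechet_derivative g (at y) (axis i 1)) \<circ> h) x)" for v
      using Suc.prems hk
      by (intro Ck_on_sum Ck_on_bilinear[OF _ bounded_bilinear_scaleR] Suc.IH assms
          Ck_on_linear[OF _ bounded_linear_vec_nth]) auto
    then show "Ck_on k S (\<lambda>x. ((\<lambda>w. \<Sum>i\<in>UNIV. (w $ i) *\<^sub>R
        ((\<lambda>y. frechet_derivative g (at y) (axis i 1)) \<circ> h) x) \<circ> frechet_derivative h (at x)) v)" for v
      by (simp add: o_def)
  qed
qed

lemma Ck_on_inverse:
  fixes g :: "'a::real_normed_vector \<Rightarrow> real"
  assumes "open S" "\<And>x. x \<in> S \<Longrightarrow> g x \<noteq> 0"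
  shows "Ck_on k S g \<Longrightarrow> Ck_on k S (\<lambda>x. inverse (g x))"
proof (induction k)
  case 0
  then show ?case using assms by (auto intro: continuous_intros)
next
  case (Suc k)
  show ?case
  proof (rule Ck_on_SucI[OF assms(1) Deriv.has_derivative_inverse])
    show "(g has_derivative FD g x) (at x)" if "x \<in> S" for x
      using Ck_on_Suc_at[OF assms(1) that Suc.prems] .
    show "Ck_on k S (\<lambda>x. - (inverse (g x) * FD g x v * inverse (g x)))" for v
      using Suc.prems Suc.IH[OF Ck_on_Suc_imp[OF Suc.prems]]
      by (intro Ck_on_linear[OF _ bounded_linear_minus[OF bounded_linear_ident]]
          Ck_on_bilinear[OF _ bounded_bilinear_mult] assms) auto
  qed (use assms in auto)
qed

text \<open>Both iterated derivatives are the limit of the second difference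
  \<open>(g (x + hv + hw) - g (x + hv) - g (x + hw) + g x) / h\<^sup>2\<close>, to which the mean value theorem
  applies in either order.\<close>

lemma second_difference:
  fixes g :: "'a::real_normed_vector \<Rightarrow> real"
  assumes "open S" "x \<in> S" "Ck_on 2 S g" "0 < e"
  shows "\<exists>d>0. \<forall>h. 0 < h \<and> h < d \<longrightarrow> \<bar>(g (x + h *\<^sub>R v + h *\<^sub>R w) - g (x + h *\<^sub>R v) - g (x + h *\<^sub>R w) + g x) / h^2 -
      FD (\<lambda>y. FD g y v) x w\<bar> < e"
proof -
  define gv where "gv y = FD g y v" for y
  define gw where "gw y = FD gv y w" for y
  have g1: "Ck_on (Suc 0) S gv" "Ck_on (Suc 1) S g" "continuous_on S gw"
    using assms(3) by (auto simp: numeral_2_eq_2 gv_def[abs_def] gw_def[abs_def])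
  have "continuous (at x) gw"
    using g1(3) assms(1,2) by (simp add: continuous_on_eq_continuous_at)
  then obtain r where r: "0 < r" "\<And>y. dist y x < r \<Longrightarrow> \<bar>gw y - gw x\<bar> < e"
    using assms(4) unfolding continuous_at_eps_delta by (auto simp: dist_real_def)
  obtain r' where r': "0 < r'" "ball x r' \<subseteq> S"
    using assms(1,2) open_contains_ball by blast
  define d where "d = min r r' / (norm v + norm w + 1)"
  have pos: "0 < norm v + norm w + 1" by (simp add: add_nonneg_pos)
  then have d: "0 < d" using r r' by (simp add: d_def)
  have near: "dist (x + s *\<^sub>R v + t *\<^sub>R w) x < min r r'" if "0 \<le> s" "s \<le> h" "0 \<le> t" "t \<le> h" "h < d" for s t h
  proof -
    have "dist (x + s *\<^sub>R v + t *\<^sub>R w) x = norm (s *\<^sub>R v + t *\<^sub>R w)" by (simp add: dist_norm)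
    also have "\<dots> \<le> s * norm v + t * norm w"
      using norm_triangle_ineq[of "s *\<^sub>R v" "t *\<^sub>R w"] that by simp
    also have "\<dots> \<le> h * norm v + h * norm w" using that by (intro add_mono mult_right_mono) auto
    also have "\<dots> \<le> h * (norm v + norm w + 1)" using that by (simp add: algebra_simps)
    also have "\<dots> < d * (norm v + norm w + 1)" using that pos by simp
    also have "\<dots> = min r r'" using pos by (simp add: d_def)
    finally show ?thesis .
  qed
  have inS: "x + s *\<^sub>R v + t *\<^sub>R w \<in> S" if "0 \<le> s" "s \<le> h" "0 \<le> t" "t \<le> h" "h < d" for s t h
    using near[OF that] r'(2) by (auto simp: dist_commute subset_iff)
  have Dg: "((\<lambda>s. g (x + s *\<^sub>R v + c)) has_real_derivative gv (x + s *\<^sub>R v + c)) (at s)"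
    if "x + s *\<^sub>R v + c \<in> S" for s c
  proof -
    have "((\<lambda>s. x + s *\<^sub>R v + c) has_derivative (\<lambda>s. s *\<^sub>R v)) (at s)"
      by (auto intro!: derivative_eq_intros)
    from has_derivative_compose[OF this Ck_on_Suc_at[OF assms(1) that g1(2)]]
    have "((\<lambda>s. g (x + s *\<^sub>R v + c)) has_derivative (\<lambda>r. FD g (x + s *\<^sub>R v + c) (r *\<^sub>R v))) (at s)" .
    moreover have "linear (FD g (x + s *\<^sub>R v + c))"
      using Ck_on_Suc_at[OF assms(1) that g1(2)] by (rule has_derivative_linear)
    ultimately show ?thesis
      by (simp add: has_field_derivative_def gv_def linear_scale mult_commute_abs)
  qed
  have Dgv: "((\<lambda>t. gv (c + t *\<^sub>R w)) has_real_derivative gw (c + t *\<^sub>R w)) (at t)"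
    if "c + t *\<^sub>R w \<in> S" for t c
  proof -
    have "((\<lambda>t. c + t *\<^sub>R w) has_derivative (\<lambda>s. s *\<^sub>R w)) (at t)"
      by (auto intro!: derivative_eq_intros)
    from has_derivative_compose[OF this Ck_on_Suc_at[OF assms(1) that g1(1)]]
    have "((\<lambda>t. gv (c + t *\<^sub>R w)) has_derivative (\<lambda>r. FD gv (c + t *\<^sub>R w) (r *\<^sub>R w))) (at t)" .
    moreover have "linear (FD gv (c + t *\<^sub>R w))"
      using Ck_on_Suc_at[OF assms(1) that g1(1)] by (rule has_derivative_linear)
    ultimately show ?thesis
      by (simp add: has_field_derivative_def gw_def linear_scale mult_commute_abs)
  qed
  have "\<bar>(g (x + h *\<^sub>R v + h *\<^sub>R w) - g (x + h *\<^sub>R v) - g (x + h *\<^sub>R w) + g x) / h^2 - gw x\<bar> < e"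
    if h: "0 < h" "h < d" for h
  proof -
    have "\<exists>s. 0 < s \<and> s < h \<and> (g (x + h *\<^sub>R v + h *\<^sub>R w) - g (x + h *\<^sub>R v + 0)) - (g (x + 0 *\<^sub>R v + h *\<^sub>R w) - g (x + 0 *\<^sub>R v + 0))
        = (h - 0) * (gv (x + s *\<^sub>R v + h *\<^sub>R w) - gv (x + s *\<^sub>R v + 0))"
      using h inS[of _ h h] inS[of _ h 0]
      by (intro MVT2[where f="\<lambda>s. g (x + s *\<^sub>R v + h *\<^sub>R w) - g (x + s *\<^sub>R v + 0)"] DERIV_diff Dg) auto
    then obtain s where s: "0 < s" "s < h"
      "g (x + h *\<^sub>R v + h *\<^sub>R w) - g (x + h *\<^sub>R v) - g (x + h *\<^sub>R w) + g x = h * (gv (x + s *\<^sub>R v + h *\<^sub>R w) - gv (x + s *\<^sub>R v))"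
      by (auto simp: algebra_simps)
    have "\<exists>t. 0 < t \<and> t < h \<and> gv (x + s *\<^sub>R v + h *\<^sub>R w) - gv (x + s *\<^sub>R v + 0 *\<^sub>R w)
        = (h - 0) * gw (x + s *\<^sub>R v + t *\<^sub>R w)"
      using h s inS[of s h] by (intro MVT2[where f="\<lambda>t. gv (x + s *\<^sub>R v + t *\<^sub>R w)"] Dgv) auto
    then obtain t where t: "0 < t" "t < h"
      "gv (x + s *\<^sub>R v + h *\<^sub>R w) - gv (x + s *\<^sub>R v) = h * gw (x + s *\<^sub>R v + t *\<^sub>R w)"
      by auto
    have "(g (x + h *\<^sub>R v + h *\<^sub>R w) - g (x + h *\<^sub>R v) - g (x + h *\<^sub>R w) + g x) / h^2 = gw (x + s *\<^sub>R v + t *\<^sub>R w)"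
      using h s t by (simp add: power2_eq_square)
    then show ?thesis
      using near[of s h t] h s t r(2) by simp
  qed
  then show ?thesis
    using d unfolding gw_def gv_def[abs_def] by blast
qed

lemma second_derivative_symmetric_real:
  fixes g :: "'a::real_normed_vector \<Rightarrow> real"
  assumes "open S" "x \<in> S" "Ck_on 2 S g"
  shows "FD (\<lambda>y. FD g y v) x w =
    FD (\<lambda>y. FD g y w) x v"
proof (rule ccontr)
  let ?a = "FD (\<lambda>y. FD g y v) x w"
  let ?b = "FD (\<lambda>y. FD g y w) x v"
  assume "?a \<noteq> ?b"
  define e where "e = \<bar>?a - ?b\<bar> / 2"
  have "0 < e" using \<open>?a \<noteq> ?b\<close> by (simp add: e_def)
  from second_difference[OF assms this, of v w] second_difference[OF assms this, of w v]
  obtain d d' where dd: "0 < d" "0 < d'"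
    "\<And>h. 0 < h \<Longrightarrow> h < d \<Longrightarrow> \<bar>(g (x + h *\<^sub>R v + h *\<^sub>R w) - g (x + h *\<^sub>R v) - g (x + h *\<^sub>R w) + g x) / h^2 - ?a\<bar> < e"
    "\<And>h. 0 < h \<Longrightarrow> h < d' \<Longrightarrow> \<bar>(g (x + h *\<^sub>R w + h *\<^sub>R v) - g (x + h *\<^sub>R w) - g (x + h *\<^sub>R v) + g x) / h^2 - ?b\<bar> < e"
    by blast
  define h where "h = min d d' / 2"
  define q where "q = (g (x + h *\<^sub>R v + h *\<^sub>R w) - g (x + h *\<^sub>R v) - g (x + h *\<^sub>R w) + g x) / h^2"
  have "0 < h" "h < d" "h < d'" using dd by (auto simp: h_def)
  then have "\<bar>q - ?a\<bar> < e" "\<bar>q - ?b\<bar> < e"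
    using dd(3)[of h] dd(4)[of h] by (simp_all add: q_def algebra_simps)
  then have "\<bar>?a - ?b\<bar> < 2 * e" by arith
  then show False by (simp add: e_def)
qed

lemma frechet_derivative_linear_image:
  assumes "bounded_linear L" "g differentiable (at x)"
  shows "FD (\<lambda>y. L (g y)) x v = L (FD g x v)"
  using bounded_linear.has_derivative[OF assms(1) frechet_derivative_works[THEN iffD1, OF assms(2)]]
  by (metis frechet_derivative_at)

lemma second_derivative_symmetric:
  fixes g :: "'a::real_normed_vector \<Rightarrow> 'b::real_inner"
  assumes "open S" "x \<in> S" "Ck_on 2 S g"
  shows "FD (\<lambda>y. FD g y v) x w =
    FD (\<lambda>y. FD g y w) x v"
proof -
  have g1: "Ck_on (Suc 0) S (\<lambda>y. FD g y u)" "Ck_on (Suc 1) S g" for u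
    using assms(3) by (auto simp: numeral_2_eq_2)
  have "FD (\<lambda>y. FD (\<lambda>z. g z \<bullet> c) y v) x w =
      FD (\<lambda>y. FD g y v) x w \<bullet> c" for c v w
  proof -
    have "FD (\<lambda>z. g z \<bullet> c) y v = FD g y v \<bullet> c" if "y \<in> S" for y
      using Ck_on_Suc_at[OF assms(1) that g1(2)]
      by (intro frechet_derivative_linear_image[of "\<lambda>z. z \<bullet> c"] bounded_linear_inner_left)
        (auto simp: differentiable_def)
    then have "FD (\<lambda>y. FD (\<lambda>z. g z \<bullet> c) y v) x w =
        FD (\<lambda>y. FD g y v \<bullet> c) x w"
      using frechet_derivative_cong_open[OF assms(1,2), of "\<lambda>y. FD (\<lambda>z. g z \<bullet> c) y v"
          "\<lambda>y. FD g y v \<bullet> c"] by simp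
    also have "\<dots> = FD (\<lambda>y. FD g y v) x w \<bullet> c"
      using Ck_on_Suc_at[OF assms(1,2) g1(1)]
      by (intro frechet_derivative_linear_image[of "\<lambda>z. z \<bullet> c"] bounded_linear_inner_left)
        (auto simp: differentiable_def)
    finally show ?thesis .
  qed
  moreover have "Ck_on 2 S (\<lambda>z. g z \<bullet> c)" for c
    using Ck_on_linear[OF assms(1) bounded_linear_inner_left assms(3)] .
  ultimately have "FD (\<lambda>y. FD g y v) x w \<bullet> c =
      FD (\<lambda>y. FD g y w) x v \<bullet> c" for c
    using second_derivative_symmetric_real[OF assms(1,2), of "\<lambda>z. g z \<bullet> c"] by simp
  then show ?thesis by (metis vector_eq_rdot)
qed

lemma smooth_on_bilinear:
  "open S \<Longrightarrow> bounded_bilinear B \<Longrightarrow> smooth_on S g \<Longrightarrow> smooth_on S h \<Longrightarrow> smooth_on S (\<lambda>x. B (g x) (h x))"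
  by (simp add: smooth_on_def Ck_on_bilinear)

lemma smooth_on_linear:
  "open S \<Longrightarrow> bounded_linear L \<Longrightarrow> smooth_on S g \<Longrightarrow> smooth_on S (\<lambda>x. L (g x))"
  by (simp add: smooth_on_def Ck_on_linear)

lemma smooth_on_add:
  "open S \<Longrightarrow> smooth_on S g \<Longrightarrow> smooth_on S h \<Longrightarrow> smooth_on S (\<lambda>x. g x + h x)"
  by (simp add: smooth_on_def Ck_on_add)

lemma smooth_on_compose:
  fixes g :: "real^'n \<Rightarrow> 'b::real_normed_vector"
  shows "open S \<Longrightarrow> open T \<Longrightarrow> h ` S \<subseteq> T \<Longrightarrow> smooth_on T g \<Longrightarrow> smooth_on S h \<Longrightarrow> smooth_on S (g \<circ> h)"
  unfolding smooth_on_def using Ck_on_compose by blast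

lemma smooth_on_inverse:
  fixes g :: "'a::real_normed_vector \<Rightarrow> real"
  shows "open S \<Longrightarrow> (\<And>x. x \<in> S \<Longrightarrow> g x \<noteq> 0) \<Longrightarrow> smooth_on S g \<Longrightarrow> smooth_on S (\<lambda>x. inverse (g x))"
  by (simp add: smooth_on_def Ck_on_inverse)

lemma smooth_on_eq:
  "open S \<Longrightarrow> smooth_on S h \<Longrightarrow> (\<And>x. x \<in> S \<Longrightarrow> g x = h x) \<Longrightarrow> smooth_on S g"
  by (rule smooth_on_cong[THEN iffD2])

section \<open>Charts and directional derivatives on a surface\<close>

definition in_chart :: "'p set \<times> ('p \<Rightarrow> real^2) \<Rightarrow> ('p \<Rightarrow> 'b) \<Rightarrow> real^2 \<Rightarrow> 'b" where
  "in_chart c g = g \<circ> inv_into (fst c) (snd c)"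

lemma chart_at_atlas: "chart_at x \<in> atlas" and mem_chart_at: "x \<in> fst (chart_at x)"
  unfolding chart_at_def using someI_ex[OF atlas_covers[of x, unfolded Bex_def]] by auto

lemma open_chart: "c \<in> atlas \<Longrightarrow> open (fst c)"
  and inj_on_chart: "c \<in> atlas \<Longrightarrow> inj_on (snd c) (fst c)"
  and open_chart_image: "c \<in> atlas \<Longrightarrow> open W \<Longrightarrow> open (snd c ` (fst c \<inter> W))"
  using atlas_homeomorphism[of "fst c" "snd c"] by (auto simp: open_Int)

lemma chart_inv: "c \<in> atlas \<Longrightarrow> y \<in> fst c \<Longrightarrow> inv_into (fst c) (snd c) (snd c y) = y"
  using inj_on_chart by (rule inv_into_f_f)

lemma in_chart_apply: "c \<in> atlas \<Longrightarrow> y \<in> fst c \<Longrightarrow> in_chart c g (snd c y) = g y"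
  by (simp add: in_chart_def chart_inv)

lemma smooth_map_on_chart:
  "smooth_map_on W g \<Longrightarrow> c \<in> atlas \<Longrightarrow> smooth_on (snd c ` (fst c \<inter> W)) (in_chart c g)"
  unfolding smooth_map_on_def in_chart_def by (auto simp: split_beta)

lemma smooth_map_onI:
  "(\<And>c. c \<in> atlas \<Longrightarrow> smooth_on (snd c ` (fst c \<inter> W)) (in_chart c g)) \<Longrightarrow> smooth_map_on W g"
  unfolding smooth_map_on_def in_chart_def by (auto simp: split_beta)

lemma smooth_transition:
  "c \<in> atlas \<Longrightarrow> c' \<in> atlas \<Longrightarrow> smooth_on (snd c ` (fst c \<inter> fst c')) (in_chart c (snd c'))"
  unfolding in_chart_def using atlas_compatible[of "fst c" "snd c" "fst c'" "snd c'"] by simp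

lemma smooth_map_on_differentiable:
  assumes "smooth_map_on W g" "open W" "c \<in> atlas" "y \<in> fst c" "y \<in> W"
  shows "in_chart c g differentiable (at (snd c y))"
  using smooth_on_imp_differentiable[OF smooth_map_on_chart[OF assms(1,3)] open_chart_image[OF assms(3,2)]]
    assms(4,5) by blast

lemma transition_differentiable:
  assumes "c \<in> atlas" "c' \<in> atlas" "y \<in> fst c" "y \<in> fst c'"
  shows "in_chart c (snd c') differentiable (at (snd c y))"
  using smooth_on_imp_differentiable[OF smooth_transition[OF assms(1,2)] open_chart_image[OF assms(1) open_chart[OF assms(2)]]]
    assms(3,4) by blast

lemma in_chart_compose:
  assumes "c \<in> atlas" "c' \<in> atlas" "u \<in> snd c' ` (fst c' \<inter> fst c)"
  shows "in_chart c' g u = (in_chart c g \<circ> in_chart c' (snd c)) u"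
  using assms by (auto simp: in_chart_apply)

lemma chain_rule_chart:
  assumes "c \<in> atlas" "c' \<in> atlas" "y \<in> fst c" "y \<in> fst c'"
    "in_chart c g differentiable (at (snd c y))"
  shows "FD (in_chart c' g) (snd c' y) v =
    FD (in_chart c g) (snd c y) (FD (in_chart c' (snd c)) (snd c' y) v)"
    and "in_chart c' g differentiable (at (snd c' y))"
proof -
  let ?h = "in_chart c' (snd c)"
  have h: "?h (snd c' y) = snd c y" using assms by (simp add: in_chart_apply)
  have "(?h has_derivative FD ?h (snd c' y)) (at (snd c' y))"
    using transition_differentiable[OF assms(2,1,4,3)] by (simp only: frechet_derivative_works)
  moreover have "(in_chart c g has_derivative FD (in_chart c g) (snd c y)) (at (?h (snd c' y)))"
    using assms(5) by (simp only: frechet_derivative_works h)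
  ultimately have "(in_chart c g \<circ> ?h has_derivative FD (in_chart c g) (snd c y) \<circ>
      FD ?h (snd c' y)) (at (snd c' y))"
    by (rule diff_chain_at)
  then have *: "(in_chart c' g has_derivative FD (in_chart c g) (snd c y) \<circ>
      FD ?h (snd c' y)) (at (snd c' y))"
  proof (rule has_derivative_transform_within_open)
    show "open (snd c' ` (fst c' \<inter> fst c))"
      using open_chart_image[OF assms(2) open_chart[OF assms(1)]] .
    show "snd c' y \<in> snd c' ` (fst c' \<inter> fst c)" using assms by simp
    show "(in_chart c g \<circ> ?h) u = in_chart c' g u" if "u \<in> snd c' ` (fst c' \<inter> fst c)" for u
      by (rule in_chart_compose[OF assms(1,2) that, symmetric])
  qed
  show "FD (in_chart c' g) (snd c' y) v =
    FD (in_chart c g) (snd c y) (FD ?h (snd c' y) v)"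
    by (simp add: frechet_derivative_at[OF *, symmetric])
  show "in_chart c' g differentiable (at (snd c' y))"
    using * by (rule differentiableI)
qed

lemma in_chart_self_derivative:
  assumes "c \<in> atlas" "y \<in> fst c"
  shows "FD (in_chart c (snd c)) (snd c y) v = v"
proof -
  have "FD (in_chart c (snd c)) (snd c y) = FD (\<lambda>u. u) (snd c y)"
    using assms open_chart_image[OF assms(1), of UNIV]
    by (intro frechet_derivative_cong_open[of "snd c ` fst c"]) (auto simp: in_chart_apply)
  then show ?thesis by simp
qed

lemma ddir_eq: "ddir X g x = FD (in_chart (chart_at x) g) (snd (chart_at x) x) X"
  unfolding ddir_def in_chart_def by (simp add: split_beta)

lemma coord_field_eq: "coord_field c v y = FD (in_chart c (snd (chart_at y))) (snd c y) v"
  unfolding coord_field_def in_chart_def by (simp add: split_beta)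

text \<open>Tangent vectors are read in a chart that varies with the point. The next lemmas convert between that chart
  and a fixed one: \<open>ddir Z (snd c) y\<close> are the components of \<open>Z\<close> in the chart \<open>c\<close>, and \<open>coord_field\<close> is the
  inverse of this map.\<close>

lemma ddir_in_chart:
  assumes "c \<in> atlas" "y \<in> fst c" "in_chart c g differentiable (at (snd c y))"
  shows "ddir Z g y = FD (in_chart c g) (snd c y) (ddir Z (snd c) y)"
  using chain_rule_chart(1)[OF assms(1) chart_at_atlas assms(2) mem_chart_at assms(3)]
  by (simp add: ddir_eq)

lemma ddir_coord_field:
  assumes "c \<in> atlas" "y \<in> fst c"
  shows "ddir (coord_field c v y) (snd c) y = v"
  using chain_rule_chart(1)[OF chart_at_atlas assms(1) mem_chart_at assms(2)
      transition_differentiable[OF chart_at_atlas assms(1) mem_chart_at assms(2)], of v]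
    in_chart_self_derivative[OF assms]
  by (simp add: ddir_eq coord_field_eq)

lemma coord_field_ddir:
  assumes "c \<in> atlas" "y \<in> fst c"
  shows "coord_field c (ddir Z (snd c) y) y = Z"
proof -
  let ?d = "chart_at y"
  have "FD (in_chart ?d (snd ?d)) (snd ?d y) Z =
      FD (in_chart c (snd ?d)) (snd c y) (FD (in_chart ?d (snd c)) (snd ?d y) Z)"
    by (intro chain_rule_chart(1) assms chart_at_atlas mem_chart_at transition_differentiable)
  then show ?thesis
    unfolding ddir_eq coord_field_eq in_chart_self_derivative[OF chart_at_atlas mem_chart_at] by (rule sym)
qed

lemma ddir_coord_field_in_chart:
  assumes "c \<in> atlas" "y \<in> fst c" "in_chart c g differentiable (at (snd c y))"
  shows "ddir (coord_field c v y) g y = FD (in_chart c g) (snd c y) v"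
  using ddir_in_chart[OF assms] ddir_coord_field[OF assms(1,2)] by simp

lemma coord_field_chart_at: "coord_field (chart_at x) v x = v"
  by (simp add: coord_field_eq in_chart_self_derivative chart_at_atlas mem_chart_at)

text \<open>In a second chart the components are a derivative of the transition map, which is smooth in a third
  chart because it is composed with another transition map.\<close>

lemma smooth_vector_field_coord_field:
  assumes "c \<in> atlas"
  shows "smooth_vector_field_on (fst c) (coord_field c v)"
  unfolding smooth_vector_field_on_def
proof (intro ballI, clarify)
  fix V and \<psi> :: "'a \<Rightarrow> real^2"
  assume V: "(V, \<psi>) \<in> atlas"
  show "smooth_map_on (V \<inter> fst c) (\<lambda>x. ddir (coord_field c v x) \<psi> x)"
  proof (rule smooth_map_onI)
    fix d :: "'a set \<times> ('a \<Rightarrow> real^2)" assume d: "d \<in> atlas"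
    let ?S = "snd d ` (fst d \<inter> (V \<inter> fst c))"
    let ?g = "\<lambda>u. FD (in_chart c \<psi>) u v"
    have oS: "open ?S" using open_chart_image[OF d] open_chart[OF assms] open_chart[OF V] by auto
    have "smooth_on ?S (in_chart d (snd c))"
      using smooth_transition[OF d assms] by (rule smooth_on_subset) auto
    moreover have "smooth_on (snd c ` (fst c \<inter> V)) ?g"
      using smooth_transition[OF assms V] unfolding fst_conv snd_conv by (rule smooth_on_frechet_derivative)
    moreover have "in_chart d (snd c) ` ?S \<subseteq> snd c ` (fst c \<inter> V)"
    proof
      fix u assume "u \<in> in_chart d (snd c) ` ?S"
      then obtain y where "y \<in> fst d" "y \<in> V" "y \<in> fst c" "u = in_chart d (snd c) (snd d y)" by blast
      then show "u \<in> snd c ` (fst c \<inter> V)" by (simp add: in_chart_apply[OF d])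
    qed
    moreover have "open (snd c ` (fst c \<inter> V))"
      using open_chart_image[OF assms] open_chart[OF V] by simp
    ultimately have comp: "smooth_on ?S (?g \<circ> in_chart d (snd c))"
      using oS by (intro smooth_on_compose)
    have eq: "in_chart d (\<lambda>x. ddir (coord_field c v x) \<psi> x) u = (?g \<circ> in_chart d (snd c)) u" if "u \<in> ?S" for u
    proof -
      obtain y where y: "y \<in> fst d" "y \<in> V" "y \<in> fst c" "u = snd d y" using \<open>u \<in> ?S\<close> by blast
      have "in_chart c \<psi> differentiable (at (snd c y))"
        using transition_differentiable[OF assms V y(3)] y(2) unfolding fst_conv snd_conv .
      then have "ddir (coord_field c v y) \<psi> y = ?g (snd c y)"
        by (rule ddir_coord_field_in_chart[OF assms y(3)])
      then show ?thesis by (simp add: in_chart_apply[OF d] in_chart_apply[OF assms] y)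
    qed
    show "smooth_on ?S (in_chart d (\<lambda>x. ddir (coord_field c v x) \<psi> x))"
      using smooth_on_eq[OF oS comp eq] .
  qed
qed

lemma smooth_map_on_subset: "smooth_map_on W g \<Longrightarrow> W' \<subseteq> W \<Longrightarrow> smooth_map_on W' g"
  by (rule smooth_map_onI, rule smooth_on_subset[OF smooth_map_on_chart]) auto

lemma smooth_map_on_const [simp]: "smooth_map_on W (\<lambda>x. c)"
  by (rule smooth_map_onI) (simp add: in_chart_def o_def)

lemma smooth_map_on_bilinear:
  assumes "open W" "bounded_bilinear B" "smooth_map_on W g" "smooth_map_on W h"
  shows "smooth_map_on W (\<lambda>x. B (g x) (h x))"
  using smooth_on_bilinear[OF open_chart_image[OF _ assms(1)] assms(2)] assms(3,4)
  by (intro smooth_map_onI) (auto simp: in_chart_def o_def dest!: smooth_map_on_chart)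

lemma smooth_map_on_add:
  "open W \<Longrightarrow> smooth_map_on W g \<Longrightarrow> smooth_map_on W h \<Longrightarrow> smooth_map_on W (\<lambda>x. g x + h x)"
  using smooth_on_add[OF open_chart_image]
  by (intro smooth_map_onI) (auto simp: in_chart_def o_def dest!: smooth_map_on_chart)

lemma smooth_map_on_inverse:
  fixes g :: "'p::smooth_surface \<Rightarrow> real"
  assumes "open W" "smooth_map_on W g" "\<And>x. x \<in> W \<Longrightarrow> g x \<noteq> 0"
  shows "smooth_map_on W (\<lambda>x. inverse (g x))"
proof (rule smooth_map_onI)
  fix c :: "'p set \<times> ('p \<Rightarrow> real^2)" assume c: "c \<in> atlas"
  have "smooth_on (snd c ` (fst c \<inter> W)) (\<lambda>u. inverse (in_chart c g u))"
    using assms(3) c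
    by (intro smooth_on_inverse open_chart_image smooth_map_on_chart assms) (auto simp: in_chart_apply)
  then show "smooth_on (snd c ` (fst c \<inter> W)) (in_chart c (\<lambda>x. inverse (g x)))"
    by (simp add: in_chart_def o_def)
qed

lemma smooth_map_on_local:
  assumes "open W" "\<And>x. x \<in> W \<Longrightarrow> \<exists>V h. open V \<and> x \<in> V \<and> smooth_map_on V h \<and> (\<forall>y\<in>V. g y = h y)"
  shows "smooth_map_on W g"
proof (rule smooth_map_onI, rule smooth_on_local)
  fix c :: "'a set \<times> ('a \<Rightarrow> real^2)" assume c: "c \<in> atlas"
  then show "open (snd c ` (fst c \<inter> W))" using assms(1) by (rule open_chart_image)
  fix u assume "u \<in> snd c ` (fst c \<inter> W)"
  then obtain x where x: "x \<in> fst c" "x \<in> W" "u = snd c x" by auto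
  then obtain V h where V: "open V" "x \<in> V" "smooth_map_on V h" "\<forall>y\<in>V. g y = h y" using assms(2) by blast
  have "in_chart c g u = in_chart c h u" if "u \<in> snd c ` (fst c \<inter> V)" for u
    using that V(4) c by (auto simp: in_chart_apply)
  then have "smooth_on (snd c ` (fst c \<inter> V)) (in_chart c g)"
    by (rule smooth_on_eq[OF open_chart_image[OF c V(1)] smooth_map_on_chart[OF V(3) c]])
  then show "\<exists>T. open T \<and> u \<in> T \<and> smooth_on T (in_chart c g)"
    using open_chart_image[OF c V(1)] x V(2) by blast
qed

lemma ddir_cong:
  assumes "open W" "x \<in> W" "\<And>y. y \<in> W \<Longrightarrow> g y = h y"
  shows "ddir X g x = ddir X h x"
proof -
  have "FD (in_chart (chart_at x) g) (snd (chart_at x) x) =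
      FD (in_chart (chart_at x) h) (snd (chart_at x) x)"
    using assms mem_chart_at[of x] open_chart_image[OF chart_at_atlas assms(1), of x]
    by (intro frechet_derivative_cong_open[of "snd (chart_at x) ` (fst (chart_at x) \<inter> W)"])
      (auto simp: in_chart_apply[OF chart_at_atlas])
  then show ?thesis by (simp add: ddir_eq)
qed

definition diff_at :: "('p::smooth_surface \<Rightarrow> 'b::real_normed_vector) \<Rightarrow> 'p \<Rightarrow> bool" where
  "diff_at g x \<longleftrightarrow> in_chart (chart_at x) g differentiable (at (snd (chart_at x) x))"

lemma diff_atI: "smooth_map_on W g \<Longrightarrow> open W \<Longrightarrow> x \<in> W \<Longrightarrow> diff_at g x"
  unfolding diff_at_def by (intro smooth_map_on_differentiable chart_at_atlas mem_chart_at)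

lemma diff_at_ddir: "diff_at g x \<Longrightarrow>
    (in_chart (chart_at x) g has_derivative (\<lambda>X. ddir X g x)) (at (snd (chart_at x) x))"
  by (simp add: diff_at_def ddir_eq frechet_derivative_works)

lemma linear_ddir: "diff_at g x \<Longrightarrow> linear (\<lambda>X. ddir X g x)"
  using diff_at_ddir by (rule has_derivative_linear)

lemma ddir_const [simp]: "ddir X (\<lambda>x. c) x = 0"
  by (simp add: ddir_eq in_chart_def o_def)

lemma diff_at_const [simp]: "diff_at (\<lambda>x. c) x"
  by (simp add: diff_at_def in_chart_def o_def)

lemma has_derivative_imp_ddir:
  assumes "(in_chart (chart_at x) g has_derivative D) (at (snd (chart_at x) x))"
  shows "diff_at g x" "ddir X g x = D X"
  using assms frechet_derivative_at[OF assms] by (auto simp: diff_at_def ddir_eq intro: differentiableI)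

lemma
  assumes "diff_at g x" "diff_at h x"
  shows ddir_add: "ddir X (\<lambda>y. g y + h y) x = ddir X g x + ddir X h x"
    and diff_at_add: "diff_at (\<lambda>y. g y + h y) x"
proof -
  have "(in_chart (chart_at x) (\<lambda>y. g y + h y) has_derivative (\<lambda>X. ddir X g x + ddir X h x))
      (at (snd (chart_at x) x))"
    using has_derivative_add[OF assms[THEN diff_at_ddir]] by (simp add: in_chart_def o_def)
  from has_derivative_imp_ddir[OF this]
  show "ddir X (\<lambda>y. g y + h y) x = ddir X g x + ddir X h x" "diff_at (\<lambda>y. g y + h y) x" by simp_all
qed

lemma
  assumes "bounded_bilinear B" "diff_at g x" "diff_at h x"
  shows ddir_bilinear: "ddir X (\<lambda>y. B (g y) (h y)) x = B (g x) (ddir X h x) + B (ddir X g x) (h x)"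
    and diff_at_bilinear: "diff_at (\<lambda>y. B (g y) (h y)) x"
proof -
  have "((\<lambda>u. B (in_chart (chart_at x) g u) (in_chart (chart_at x) h u)) has_derivative
      (\<lambda>X. B (g x) (ddir X h x) + B (ddir X g x) (h x))) (at (snd (chart_at x) x))"
    using bounded_bilinear.FDERIV[OF assms(1) assms(2,3)[THEN diff_at_ddir]]
    unfolding in_chart_apply[OF chart_at_atlas mem_chart_at] .
  then have "(in_chart (chart_at x) (\<lambda>y. B (g y) (h y)) has_derivative
      (\<lambda>X. B (g x) (ddir X h x) + B (ddir X g x) (h x))) (at (snd (chart_at x) x))"
    by (simp add: in_chart_def o_def)
  from has_derivative_imp_ddir[OF this]
  show "ddir X (\<lambda>y. B (g y) (h y)) x = B (g x) (ddir X h x) + B (ddir X g x) (h x)"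
    "diff_at (\<lambda>y. B (g y) (h y)) x" by simp_all
qed

lemma ddir_scale: "diff_at g x \<Longrightarrow> ddir X (\<lambda>y. r *\<^sub>R g y) x = r *\<^sub>R ddir X g x"
  and diff_at_scale: "diff_at g x \<Longrightarrow> diff_at (\<lambda>y. r *\<^sub>R g y) x"
  using ddir_bilinear[OF bounded_bilinear_scaleR, of "\<lambda>_. r" x g]
    diff_at_bilinear[OF bounded_bilinear_scaleR, of "\<lambda>_. r" x g] by simp_all

text \<open>The map is constant on the preimage of a ball in a chart, hence locally constant.\<close>

lemma ddir_zero_imp_constant:
  fixes g :: "'p::smooth_surface \<Rightarrow> 'b::real_normed_vector"
  assumes "connected (UNIV :: 'p set)" "smooth_map_on UNIV g" "\<And>x X. ddir X g x = 0"
  shows "g x = g y"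
proof -
  have "\<exists>V. open V \<and> x \<in> V \<and> (\<forall>y\<in>V. g y = g x)" for x
  proof -
    define c where "c = chart_at x"
    have c: "c \<in> atlas" "x \<in> fst c" by (simp_all add: c_def chart_at_atlas mem_chart_at)
    have "open (snd c ` fst c)" using open_chart_image[OF c(1), of UNIV] by simp
    then obtain r where r: "0 < r" "ball (snd c x) r \<subseteq> snd c ` fst c"
      using c open_contains_ball by blast
    have D: "(in_chart c g has_derivative (\<lambda>v. 0)) (at u)" if u: "u \<in> ball (snd c x) r" for u
    proof -
      obtain y where y: "y \<in> fst c" "u = snd c y" using u r by blast
      have d: "in_chart c g differentiable (at u)"
        using smooth_map_on_differentiable[OF assms(2) open_UNIV c(1) y(1)] y by simp
      have "FD (in_chart c g) u v = 0" for v
        using ddir_coord_field_in_chart[OF c(1) y(1), of g v] d y assms(3) by simp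
      then have "FD (in_chart c g) u = (\<lambda>v. 0)" by (rule ext)
      then show ?thesis using d by (simp add: frechet_derivative_works)
    qed
    define V where "V = fst c \<inter> (snd c -` ball (snd c x) r)"
    have "V \<subseteq> fst c" "snd c ` V = ball (snd c x) r" using r by (auto simp: V_def)
    then have "open V" using atlas_homeomorphism[of "fst c" "snd c"] c(1)
      by (metis open_ball prod.collapse)
    moreover have "x \<in> V" using c r by (simp add: V_def)
    moreover have "g y = g x" if "y \<in> V" for y
    proof -
      have "in_chart c g (snd c y) = in_chart c g (snd c x)"
        using that r D by (intro has_derivative_zero_unique[of "ball (snd c x) r"])
          (auto simp: V_def intro: has_derivative_at_withinI)
      then show ?thesis using that c by (simp add: in_chart_apply V_def)
    qed
    ultimately show ?thesis by blast
  qed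
  then have "g constant_on UNIV"
    by (intro locally_constant_imp_constant[OF assms(1)]) (auto simp: open_openin[symmetric])
  then show ?thesis by (auto simp: constant_on_def)
qed

section \<open>Linear algebra in signature (4,2)\<close>

lemma inn_commute: "inn a b = inn b a"
  by (simp add: inn_def inner_commute)

lemma inn_simps [simp]:
  "inn (a + b) c = inn a c + inn b c" "inn a (b + c) = inn a b + inn a c"
  "inn (a - b) c = inn a c - inn b c" "inn a (b - c) = inn a b - inn a c"
  "inn (r *\<^sub>R a) b = r * inn a b" "inn a (r *\<^sub>R b) = r * inn a b"
  "inn (- a) b = - inn a b" "inn a (- b) = - inn a b" "inn 0 a = 0" "inn a 0 = 0"
  by (simp_all add: inn_def algebra_simps)

lemma bounded_bilinear_inn: "bounded_bilinear inn"
  unfolding bilinear_conv_bounded_bilinear[symmetric] bilinear_def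
  by (intro conjI allI linearI) simp_all

text \<open>Exchanges \<open>inn\<close> with the Euclidean inner product, so that orthogonality may be imported from there.\<close>

definition reflect :: "R42 \<Rightarrow> R42" where
  "reflect v = (fst v, - snd v)"

lemma inn_reflect: "inn (reflect u) v = u \<bullet> v" "inn u (reflect v) = u \<bullet> v"
  by (simp_all add: reflect_def inn_def inner_prod_def)

lemma reflect_reflect [simp]: "reflect (reflect u) = u"
  by (simp add: reflect_def)

lemma inn_eq_inner_reflect: "inn u v = reflect u \<bullet> v"
  using inn_reflect(1)[of "reflect u"] by simp

lemma subspace_perp: "subspace (perp S)"
  by (auto simp: subspace_def perp_def)

lemma subspace_inn_zero: "subspace {v. inn e v = 0}"
  by (auto simp: subspace_def)

text \<open>The reflection of the Euclidean component of \<open>v\<close> orthogonal to \<open>S\<close>.\<close>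

lemma separating_vector:
  assumes "subspace S" "v \<notin> S"
  obtains e where "inn e v \<noteq> 0" "\<And>s. s \<in> S \<Longrightarrow> inn e s = 0"
proof -
  obtain y z where yz: "y \<in> span S" "\<And>w. w \<in> span S \<Longrightarrow> orthogonal z w" "v = y + z"
    using orthogonal_subspace_decomp_exists[of S v] by metis
  have "S = span S" using assms(1) by (simp add: span_eq_iff[THEN iffD2])
  then have "z \<noteq> 0" using yz assms(2) by auto
  have "z \<bullet> y = 0" using yz(1,2) by (simp add: orthogonal_def)
  then have "inn (reflect z) v = z \<bullet> z" using yz(3) by (simp add: inn_reflect inner_add_right)
  moreover have "inn (reflect z) s = 0" if "s \<in> S" for s
    using yz(2)[of s] span_base[OF that] by (simp add: inn_reflect orthogonal_def)
  ultimately show ?thesis using that[of "reflect z"] \<open>z \<noteq> 0\<close> by simp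
qed

lemma span_pair:
  fixes v :: "'a::real_vector"
  shows "v \<in> span {a, b} \<longleftrightarrow> (\<exists>\<alpha> \<beta>. v = \<alpha> *\<^sub>R a + \<beta> *\<^sub>R b)"
proof -
  have "v \<in> span {a, b} \<longleftrightarrow> (\<exists>\<alpha> \<beta>. v - \<alpha> *\<^sub>R a = \<beta> *\<^sub>R b)"
    unfolding span_insert span_singleton by auto
  then show ?thesis by (simp add: diff_eq_eq add.commute)
qed

lemma span_single: "v \<in> span {a} \<longleftrightarrow> (\<exists>\<alpha>. v = \<alpha> *\<^sub>R a)"
  by (auto simp: span_singleton)

definition isotropic_frame :: "R42 \<Rightarrow> R42 \<Rightarrow> bool" where
  "isotropic_frame a b \<longleftrightarrow> inn a a = 0 \<and> inn a b = 0 \<and> inn b b = 0 \<and>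
     (\<forall>\<alpha> \<beta>. \<alpha> *\<^sub>R a + \<beta> *\<^sub>R b = 0 \<longrightarrow> \<alpha> = 0 \<and> \<beta> = 0)"

lemma isotropic_frame_commute: "isotropic_frame a b \<longleftrightarrow> isotropic_frame b a"
  unfolding isotropic_frame_def by (metis add.commute inn_commute)

lemma isotropic_frame_nonzero: "isotropic_frame a b \<Longrightarrow> a \<noteq> 0 \<and> b \<noteq> 0"
  unfolding isotropic_frame_def by (metis scaleR_zero_left scaleR_zero_right add_0 zero_neq_one)

lemma perp_pair: "v \<in> perp (span {a, b}) \<longleftrightarrow> inn v a = 0 \<and> inn v b = 0"
proof
  assume "inn v a = 0 \<and> inn v b = 0"
  then show "v \<in> perp (span {a, b})" by (auto simp: perp_def span_pair)
qed (auto simp: perp_def span_base)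

lemma dual_frame:
  assumes "isotropic_frame a b"
  obtains e where "inn e a = 1" "inn e b = 0"
proof -
  have "a \<notin> span {b}"
  proof
    assume "a \<in> span {b}"
    then obtain \<alpha> where "1 *\<^sub>R a + (- \<alpha>) *\<^sub>R b = 0" by (auto simp: span_single)
    then show False using assms unfolding isotropic_frame_def by (metis zero_neq_one)
  qed
  then obtain e where e: "inn e a \<noteq> 0" "\<And>s. s \<in> span {b} \<Longrightarrow> inn e s = 0"
    using separating_vector[OF subspace_span] by metis
  show ?thesis using that[of "(1 / inn e a) *\<^sub>R e"] e(1) e(2)[OF span_base, of b] by simp
qed

lemma dim_perp: "subspace F \<Longrightarrow> dim (perp F) + dim F = 6"
proof -
  assume F: "subspace F"
  have lin: "linear reflect" by (rule linearI) (auto simp: reflect_def)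
  have inj: "inj reflect" by (rule inj_on_inverseI[of _ reflect]) simp
  have sub: "subspace (reflect ` F)" using F lin by (intro linear_subspace_image)
  have "perp F = {y \<in> UNIV. \<forall>x \<in> reflect ` F. orthogonal x y}"
    by (auto simp: perp_def orthogonal_def inn_eq_inner_reflect[symmetric] inn_commute)
  moreover have "dim (reflect ` F) = dim F" using lin inj by (intro dim_image_eq) (auto intro: inj_on_subset)
  moreover have "dim (UNIV :: R42 set) = 6" by (simp add: dim_UNIV)
  ultimately show ?thesis
    using dim_subspace_orthogonal_to_vectors[OF sub subspace_UNIV] by simp
qed

text \<open>The form is positive definite on \<open>F\<^sup>\<bottom> / F\<close> for an isotropic plane \<open>F\<close>: the projection of \<open>F\<close> to
  the negative definite factor is onto, so every vector of \<open>F\<^sup>\<bottom>\<close> may be moved by \<open>F\<close> into the positive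
  definite factor.\<close>

lemma isotropic_plane_quotient_definite:
  assumes "isotropic_frame a b" "inn v a = 0" "inn v b = 0"
  shows "inn v v \<ge> 0" "inn v v = 0 \<Longrightarrow> v \<in> span {a, b}"
proof -
  have z: "inn a a = 0" "inn a b = 0" "inn b b = 0" "inn b a = 0"
    using assms(1) by (auto simp: isotropic_frame_def inn_commute)
  have inj: "\<alpha> = 0 \<and> \<beta> = 0" if "\<alpha> *\<^sub>R snd a + \<beta> *\<^sub>R snd b = 0" for \<alpha> \<beta>
  proof -
    let ?w = "\<alpha> *\<^sub>R a + \<beta> *\<^sub>R b"
    have "snd ?w = 0" using that by simp
    moreover have "inn ?w ?w = 0" by (simp add: z)
    ultimately have "fst ?w \<bullet> fst ?w = 0" unfolding inn_def by (simp only: inner_zero_left)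
    then have "?w = 0" using \<open>snd ?w = 0\<close> by (simp add: prod_eq_iff)
    then show ?thesis using assms(1) by (simp add: isotropic_frame_def)
  qed
  have "snd v \<in> span {snd a, snd b}"
  proof -
    have ne: "snd a \<noteq> snd b" using inj[of 1 "-1"] by auto
    have "independent {snd a, snd b}"
    proof (rule independent_if_scalars_zero)
      fix f x assume "(\<Sum>x\<in>{snd a, snd b}. f x *\<^sub>R x) = 0" "x \<in> {snd a, snd b}"
      then show "f x = 0" using ne inj[of "f (snd a)" "f (snd b)"] by auto
    qed simp
    then have "span {snd a, snd b} = UNIV"
      using ne dim_eq_full[of "{snd a, snd b}"] dim_eq_card_independent[of "{snd a, snd b}"] by simp
    then show ?thesis by simp
  qed
  then obtain \<alpha> \<beta> where ab: "snd v = \<alpha> *\<^sub>R snd a + \<beta> *\<^sub>R snd b"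
    by (auto simp: span_pair)
  let ?w = "v - (\<alpha> *\<^sub>R a + \<beta> *\<^sub>R b)"
  have "snd ?w = 0" using ab by simp
  then have "inn ?w ?w = fst ?w \<bullet> fst ?w" unfolding inn_def by (simp only: inner_zero_left diff_zero)
  moreover have "inn ?w ?w = inn v v" using assms(2,3) z by (simp add: inn_commute[of a v] inn_commute[of b v])
  ultimately have *: "inn v v = fst ?w \<bullet> fst ?w" by simp
  then show "inn v v \<ge> 0" by simp
  show "v \<in> span {a, b}" if "inn v v = 0"
  proof -
    have "?w = 0" using * that \<open>snd ?w = 0\<close> by (simp add: prod_eq_iff)
    then show ?thesis by (auto simp: span_pair)
  qed
qed

text \<open>The vectors \<open>a\<close>, \<open>b\<close>, \<open>w\<close> and \<open>u\<close> are independent and lie in \<open>F\<^sup>\<bottom>\<close>, which has dimension \<open>6 - 2\<close>.\<close>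

lemma perp_plane_expansion:
  assumes F: "isotropic_frame a b" and v: "inn v a = 0" "inn v b = 0"
    and w: "inn w a = 0" "inn w b = 0" "inn w w \<noteq> 0" and u: "inn u a = 0" "inn u b = 0" "inn u u \<noteq> 0"
    and wu: "inn w u = 0"
  shows "v - (inn v w / inn w w) *\<^sub>R w - (inn v u / inn u u) *\<^sub>R u \<in> span {a, b}"
proof -
  have z: "inn a a = 0" "inn a b = 0" "inn b b = 0" "inn b a = 0"
    using F by (auto simp: isotropic_frame_def inn_commute)
  have ind4: "\<alpha> = 0 \<and> \<beta> = 0 \<and> \<gamma> = 0 \<and> \<delta> = 0"
    if e: "\<alpha> *\<^sub>R a + \<beta> *\<^sub>R b + \<gamma> *\<^sub>R w + \<delta> *\<^sub>R u = 0" for \<alpha> \<beta> \<gamma> \<delta>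
  proof -
    have "inn (\<alpha> *\<^sub>R a + \<beta> *\<^sub>R b + \<gamma> *\<^sub>R w + \<delta> *\<^sub>R u) w = 0"
      "inn (\<alpha> *\<^sub>R a + \<beta> *\<^sub>R b + \<gamma> *\<^sub>R w + \<delta> *\<^sub>R u) u = 0" by (simp_all only: e inn_simps)
    then have "\<gamma> = 0" "\<delta> = 0" using w u wu by (simp_all add: inn_commute)
    then show ?thesis using e F by (simp add: isotropic_frame_def)
  qed
  have d: "a \<noteq> b" "a \<noteq> w" "a \<noteq> u" "b \<noteq> w" "b \<noteq> u" "w \<noteq> u"
    using ind4[of 1 "-1" 0 0] ind4[of 1 0 "-1" 0] ind4[of 1 0 0 "-1"] ind4[of 0 1 "-1" 0]
      ind4[of 0 1 0 "-1"] ind4[of 0 0 1 "-1"] by auto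
  have ind: "independent {a, b, w, u}"
  proof (rule independent_if_scalars_zero)
    fix f x assume "(\<Sum>x\<in>{a, b, w, u}. f x *\<^sub>R x) = 0" "x \<in> {a, b, w, u}"
    then show "f x = 0" using d ind4[of "f a" "f b" "f w" "f u"] by (auto simp: add.assoc)
  qed simp
  have "dim (span {a, b}) = 2"
    using ind d dim_eq_card_independent[of "{a, b}"] independent_mono[OF ind, of "{a, b}"] by simp
  then have "dim (perp (span {a, b})) = 4" using dim_perp[OF subspace_span, of "{a, b}"] by simp
  moreover have "dim (span {a, b, w, u}) = 4"
    using ind d dim_eq_card_independent[OF ind] by simp
  moreover have "span {a, b, w, u} \<subseteq> perp (span {a, b})"
    using z w u by (intro span_minimal subspace_perp) (auto simp: perp_pair)
  ultimately have "span {a, b, w, u} = perp (span {a, b})"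
    by (intro subspace_dim_equal subspace_span subspace_perp) auto
  moreover have "v \<in> perp (span {a, b})" using v by (simp add: perp_pair)
  ultimately have "v \<in> span {a, b, w, u}" by simp
  then obtain \<alpha> \<beta> where "v - \<alpha> *\<^sub>R a - \<beta> *\<^sub>R b \<in> span {w, u}"
    by (auto simp: span_insert[of _ "insert _ _"])
  then obtain \<gamma> \<delta> where "v - \<alpha> *\<^sub>R a - \<beta> *\<^sub>R b = \<gamma> *\<^sub>R w + \<delta> *\<^sub>R u"
    by (auto simp: span_pair)
  then have e: "v = \<alpha> *\<^sub>R a + \<beta> *\<^sub>R b + \<gamma> *\<^sub>R w + \<delta> *\<^sub>R u"
    by (simp add: algebra_simps)
  have "inn a w = 0" "inn b w = 0" "inn a u = 0" "inn b u = 0" "inn u w = 0"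
    using w u wu by (simp_all add: inn_commute)
  then have "v - (inn v w / inn w w) *\<^sub>R w - (inn v u / inn u u) *\<^sub>R u = \<alpha> *\<^sub>R a + \<beta> *\<^sub>R b"
    using w(3) u(3) wu by (simp add: e)
  then show ?thesis unfolding span_pair by blast
qed

lemma wedge_space_induct [consumes 1, case_names wedge zero add scale]:
  assumes "\<omega> \<in> wedge_space A B" "\<And>a b. a \<in> A \<Longrightarrow> b \<in> B \<Longrightarrow> Q (wedge a b)"
    "Q 0" "\<And>u v. Q u \<Longrightarrow> Q v \<Longrightarrow> Q (u + v)" "\<And>r u. Q u \<Longrightarrow> Q (r *\<^sub>R u)"
  shows "Q \<omega>"
proof -
  have "subspace {u. Q u}" using assms(3-5) by (auto simp: subspace_def)
  moreover have "{wedge a b | a b. a \<in> A \<and> b \<in> B} \<subseteq> {u. Q u}" using assms(2) by auto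
  ultimately have "wedge_space A B \<subseteq> {u. Q u}" unfolding wedge_space_def by (rule span_minimal[rotated])
  then show ?thesis using assms(1) by blast
qed

lemma wedge_space_skew: "\<omega> \<in> wedge_space A B \<Longrightarrow> inn (\<omega> u) v = - inn u (\<omega> v)"
proof (induction rule: wedge_space_induct)
  case (wedge a b)
  then show ?case by (simp add: wedge_apply inn_commute)
qed (simp_all add: blinfun.add_left blinfun.scaleR_left algebra_simps)

lemma wedge_space_commute: "wedge_space A B = wedge_space B A"
proof -
  have "wedge_space A B \<subseteq> wedge_space B A" for A B
  proof
    fix \<omega> assume "\<omega> \<in> wedge_space A B"
    then show "\<omega> \<in> wedge_space B A"
    proof (induction rule: wedge_space_induct)
      case (wedge a b)
      have "wedge a b = - wedge b a"
        by (rule blinfun_eqI) (simp add: wedge_apply blinfun.minus_left)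
      moreover have "wedge b a \<in> wedge_space B A"
        using wedge unfolding wedge_space_def by (blast intro: span_base)
      ultimately show ?case unfolding wedge_space_def by (simp only: span_neg)
    qed (auto simp: wedge_space_def intro: span_zero span_add span_scale)
  qed
  then show ?thesis by blast
qed

lemma wedge_space_range:
  assumes "\<omega> \<in> wedge_space A B" "subspace V" "A \<subseteq> V" "B \<subseteq> V"
  shows "\<omega> c \<in> V"
  using assms(1)
proof (induction rule: wedge_space_induct)
  case (wedge a b)
  then show ?case using assms by (auto simp: wedge_apply intro!: subspace_diff subspace_scale)
qed (use assms(2) in \<open>auto simp: blinfun.add_left blinfun.scaleR_left intro: subspace_0 subspace_add subspace_scale\<close>)

lemma wedge_space_kernel:
  assumes "\<omega> \<in> wedge_space A B" "\<And>a. a \<in> A \<Longrightarrow> inn a c = 0" "\<And>b. b \<in> B \<Longrightarrow> inn b c = 0"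
  shows "\<omega> c = 0"
  using assms(1)
proof (induction rule: wedge_space_induct)
  case (wedge a b)
  then show ?case using assms by (simp add: wedge_apply)
qed (simp_all add: blinfun.add_left blinfun.scaleR_left)

text \<open>On \<open>F\<^sup>\<bottom>\<close> the factor in \<open>F\<close> pairs to zero, so only multiples of that factor remain.\<close>

lemma wedge_space_perp_image:
  assumes "\<omega> \<in> wedge_space F (perp F)" "subspace F" "c \<in> perp F"
  shows "\<omega> c \<in> F"
  using assms(1)
proof (induction rule: wedge_space_induct)
  case (wedge a b)
  then have "inn a c = 0" using assms(3) by (auto simp: perp_def inn_commute)
  then show ?case using assms wedge by (auto simp: wedge_apply intro!: subspace_neg subspace_scale)
qed (use assms(2) in \<open>auto simp: blinfun.add_left blinfun.scaleR_left intro: subspace_0 subspace_add subspace_scale\<close>)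

text \<open>A sum of two rank one maps has the trace that one expects, whatever basis is chosen: \<open>\<phi> s \<cdot> v\<close>
  contributes \<open>\<Sum>b. \<phi> b \<cdot> v\<^sub>b = \<phi> v\<close>.\<close>

lemma trace_on_rank_one_sum:
  fixes v1 v2 :: R42
  assumes S: "subspace S" and \<phi>: "linear \<phi>1" "linear \<phi>2" and v: "v1 \<in> S" "v2 \<in> S"
    and T: "\<And>s. s \<in> S \<Longrightarrow> T s = \<phi>1 s *\<^sub>R v1 + \<phi>2 s *\<^sub>R v2"
  shows "trace_on S T = \<phi>1 v1 + \<phi>2 v2"
proof -
  define B where "B = (SOME B. B \<subseteq> S \<and> independent B \<and> S \<subseteq> span B)"
  have "\<exists>B. B \<subseteq> S \<and> independent B \<and> S \<subseteq> span B"
    by (rule basis_exists[of S]) blast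
  then have B: "B \<subseteq> S" "independent B" "S \<subseteq> span B"
    unfolding B_def by (metis (mono_tags, lifting) someI_ex)+
  have fin: "finite B" using B(2) by (rule independent_imp_finite)
  have rank1: "(\<Sum>b\<in>B. representation B (\<phi> b *\<^sub>R w) b) = \<phi> w" if "linear \<phi>" "w \<in> S" for \<phi> :: "R42 \<Rightarrow> real" and w
  proof -
    have w: "w \<in> span B" using that B by blast
    have "\<phi> w = \<phi> (\<Sum>b\<in>B. representation B w b *\<^sub>R b)"
      using sum_representation_eq[OF B(2) w fin] by simp
    also have "\<dots> = (\<Sum>b\<in>B. representation B w b * \<phi> b)"
      using that(1) by (simp add: linear_sum linear_scale)
    also have "\<dots> = (\<Sum>b\<in>B. representation B (\<phi> b *\<^sub>R w) b)"
      using representation_scale[OF B(2) w] by (simp add: mult.commute)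
    finally show ?thesis by simp
  qed
  have "representation B (T b) b = representation B (\<phi>1 b *\<^sub>R v1) b + representation B (\<phi>2 b *\<^sub>R v2) b"
    if "b \<in> B" for b
    using that B v T by (subst T) (auto intro!: representation_add[THEN fun_cong] span_scale)
  then have "trace_on S T = (\<Sum>b\<in>B. representation B (\<phi>1 b *\<^sub>R v1) b) + (\<Sum>b\<in>B. representation B (\<phi>2 b *\<^sub>R v2) b)"
    unfolding trace_on_def B_def[symmetric] Let_def by (simp add: sum.distrib)
  then show ?thesis using rank1 \<phi> v by simp
qed

text \<open>A subspace on which a diagonal form is positive definite has at most as many dimensions as there are
  positive diagonal entries.\<close>

lemma pos_index_diagonal:
  fixes Q :: "real^2 \<Rightarrow> real^2 \<Rightarrow> real"
  assumes ind: "\<And>x y. x *\<^sub>R X + y *\<^sub>R Y = 0 \<Longrightarrow> x = 0 \<and> y = 0"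
    and spn: "\<And>Z. \<exists>x y. Z = x *\<^sub>R X + y *\<^sub>R Y"
    and Q: "\<And>x y. Q (x *\<^sub>R X + y *\<^sub>R Y) (x *\<^sub>R X + y *\<^sub>R Y) = x^2 * q1 + y^2 * q2"
  shows "pos_index Q = (if q1 > 0 then 1 else 0) + (if q2 > 0 then 1 else 0)"
proof -
  define P where "P = {dim S | S. subspace S \<and> (\<forall>X\<in>S. X \<noteq> 0 \<longrightarrow> Q X X > 0)}"
  have le2: "dim S \<le> 2" for S :: "(real^2) set" using dim_subset_UNIV[of S] by simp
  then have "P \<subseteq> {..2}" by (auto simp: P_def)
  then have finP: "finite P" by (rule finite_subset) simp
  have XY: "X \<noteq> 0" "Y \<noteq> 0" using ind[of 1 0] ind[of 0 1] by auto
  have QX: "Q X X = q1" and QY: "Q Y Y = q2" using Q[of 1 0] Q[of 0 1] by simp_all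
  have full: "S = UNIV" if "subspace S" "dim S = 2" for S :: "(real^2) set"
    using that subspace_dim_equal[of S UNIV] by simp
  have full': "q1 > 0 \<and> q2 > 0" if P2: "2 \<in> P"
  proof -
    obtain S where "subspace S" "dim S = 2" "\<forall>X\<in>S. X \<noteq> 0 \<longrightarrow> Q X X > 0" using P2 unfolding P_def by auto
    then show ?thesis using full[of S] QX QY XY by auto
  qed
  have zero: "0 \<in> P" unfolding P_def
    by (rule CollectI, rule exI[of _ "{0}"]) (simp add: subspace_single_0)
  have one: "1 \<in> P" if "q1 > 0 \<or> q2 > 0"
  proof -
    have line: "1 \<in> P" if "Z \<noteq> 0" "Q Z Z > 0" "\<And>r. Q (r *\<^sub>R Z) (r *\<^sub>R Z) = r^2 * Q Z Z" for Z
    proof -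
      have "\<forall>X\<in>span {Z}. X \<noteq> 0 \<longrightarrow> Q X X > 0" using that by (auto simp: span_singleton)
      moreover have "dim (span {Z}) = 1" using that(1) by (simp add: dim_singleton)
      ultimately show ?thesis unfolding P_def using subspace_span[of "{Z}"] by force
    qed
    show ?thesis using \<open>q1 > 0 \<or> q2 > 0\<close> line[of X] line[of Y] XY QX QY Q[of _ 0] Q[of 0] by auto
  qed
  have two: "2 \<in> P" if q: "q1 > 0" "q2 > 0"
  proof -
    have "Q Z Z > 0" if "Z \<noteq> 0" for Z
    proof -
      obtain x y where Z: "Z = x *\<^sub>R X + y *\<^sub>R Y" using spn by blast
      then have "x \<noteq> 0 \<or> y \<noteq> 0" using that by auto
      then show ?thesis unfolding Z Q using q
        by (cases "x = 0") (auto intro!: add_pos_nonneg)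
    qed
    then show ?thesis unfolding P_def by (intro CollectI exI[of _ UNIV]) auto
  qed
  have onepos: "q1 > 0 \<or> q2 > 0" if P1: "1 \<in> P"
  proof -
    obtain S where S: "dim S = 1" "\<forall>X\<in>S. X \<noteq> 0 \<longrightarrow> Q X X > 0" using P1 by (auto simp: P_def)
    then have "\<not> S \<subseteq> {0}" using dim_eq_0[of S] by simp
    then obtain Z where "Z \<in> S" "Z \<noteq> 0" by blast
    then have "Q Z Z > 0" using S by blast
    moreover obtain x y where Z: "Z = x *\<^sub>R X + y *\<^sub>R Y" using spn by blast
    ultimately have "x^2 * q1 + y^2 * q2 > 0" by (simp add: Q)
    then show ?thesis by (smt (verit) mult_nonneg_nonpos zero_le_power2)
  qed
  have idx: "pos_index Q = Max P" by (simp add: pos_index_def P_def)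
  have PMax: "Max P \<in> P" using finP zero by (intro Max_in) auto
  have bnd: "n \<le> Max P" if "n \<in> P" for n using finP that by simp
  have "Max P \<le> 2" using \<open>P \<subseteq> {..2}\<close> PMax by auto
  then have cases: "Max P = 0 \<or> Max P = 1 \<or> Max P = 2" by linarith
  show ?thesis
    using cases PMax bnd[of 1] bnd[of 2] one two onepos full' unfolding idx by auto
qed

section \<open>Sections of subbundles and curvature spheres\<close>

lemma sections_atD: "\<sigma> \<in> sections_at F x \<Longrightarrow> diff_at \<sigma> x"
  "\<sigma> \<in> sections_at F x \<Longrightarrow> \<sigma> x \<in> F x"
  unfolding sections_at_def by (auto intro: diff_atI)

lemma sections_at_add:
  assumes "\<And>y. subspace (F y)" "\<sigma> \<in> sections_at F x" "\<tau> \<in> sections_at F x"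
  shows "(\<lambda>y. \<sigma> y + \<tau> y) \<in> sections_at F x"
proof -
  obtain W where W: "open W" "x \<in> W" "smooth_map_on W \<sigma>" "\<forall>y\<in>W. \<sigma> y \<in> F y"
    using assms(2) unfolding sections_at_def by blast
  obtain V where V: "open V" "x \<in> V" "smooth_map_on V \<tau>" "\<forall>y\<in>V. \<tau> y \<in> F y"
    using assms(3) unfolding sections_at_def by blast
  have "smooth_map_on (W \<inter> V) (\<lambda>y. \<sigma> y + \<tau> y)"
    using W V by (intro smooth_map_on_add) (auto intro: smooth_map_on_subset)
  then show ?thesis
    unfolding sections_at_def using W V assms(1)
    by (intro CollectI exI[of _ "W \<inter> V"]) (auto intro: subspace_add)
qed

lemma sections_at_scale:
  assumes "\<And>y. subspace (F y)" "\<sigma> \<in> sections_at F x"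
  shows "(\<lambda>y. r *\<^sub>R \<sigma> y) \<in> sections_at F x"
proof -
  obtain W where W: "open W" "x \<in> W" "smooth_map_on W \<sigma>" "\<forall>y\<in>W. \<sigma> y \<in> F y"
    using assms(2) unfolding sections_at_def by blast
  then have "smooth_map_on W (\<lambda>y. r *\<^sub>R \<sigma> y)"
    by (intro smooth_map_on_bilinear[OF _ bounded_bilinear_scaleR]) auto
  then show ?thesis
    unfolding sections_at_def using W assms(1)
    by (intro CollectI exI[of _ W]) (auto intro: subspace_scale)
qed

lemma ddir_combination:
  assumes "diff_at \<sigma> x" "diff_at \<tau> x"
  shows "ddir X (\<lambda>y. r *\<^sub>R \<sigma> y + t *\<^sub>R \<tau> y) x = r *\<^sub>R ddir X \<sigma> x + t *\<^sub>R ddir X \<tau> x"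
  using ddir_add[OF diff_at_scale diff_at_scale, OF assms] ddir_scale[OF assms(1)] ddir_scale[OF assms(2)] by simp

lemma section_difference:
  assumes "\<And>y. subspace (F y)" "\<sigma> \<in> sections_at F x" "\<tau> \<in> sections_at F x"
  shows "(\<lambda>y. \<sigma> y - r *\<^sub>R \<tau> y) \<in> sections_at F x"
    and "ddir X (\<lambda>y. \<sigma> y - r *\<^sub>R \<tau> y) x = ddir X \<sigma> x - r *\<^sub>R ddir X \<tau> x"
  using sections_at_add[OF assms(1,2) sections_at_scale[OF assms(1,3), of "- r"]]
    ddir_combination[OF sections_atD(1)[OF assms(2)] sections_atD(1)[OF assms(3)], of X 1 "- r"] by simp_all

lemma ddir_direction_combination:
  assumes "diff_at \<sigma> x"
  shows "ddir (p *\<^sub>R X + q *\<^sub>R Y) \<sigma> x = p *\<^sub>R ddir X \<sigma> x + q *\<^sub>R ddir Y \<sigma> x"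
  using linear_add[OF linear_ddir[OF assms]] linear_scale[OF linear_ddir[OF assms]] by metis

lemma subbundle_subspace: "subbundle k F \<Longrightarrow> subspace (F x)"
  and subbundle_dim: "subbundle k F \<Longrightarrow> dim (F x) = k"
  by (auto simp: subbundle_def)

text \<open>The values of local sections form a subspace that contains a local frame.\<close>

lemma subbundle_section:
  assumes "subbundle k F" "v \<in> F x"
  obtains \<sigma> where "\<sigma> \<in> sections_at F x" "\<sigma> x = v"
proof -
  obtain W and \<rho> :: "nat \<Rightarrow> 'a \<Rightarrow> R42" where W: "open W" "x \<in> W" "\<And>i. i < k \<Longrightarrow> smooth_map_on W (\<rho> i)"
    "\<And>y. y \<in> W \<Longrightarrow> F y = span ((\<lambda>i. \<rho> i y) ` {..<k})"
    using assms(1) unfolding subbundle_def by metis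
  define V where "V = (\<lambda>\<sigma>. \<sigma> x) ` sections_at F x"
  note sub = subbundle_subspace[OF assms(1)]
  have "(\<lambda>y. 0) \<in> sections_at F x"
    unfolding sections_at_def using sub by (auto intro!: exI[of _ UNIV] subspace_0)
  have "subspace V"
    unfolding subspace_def
  proof (intro conjI ballI allI)
    show "0 \<in> V" unfolding V_def by (rule image_eqI[OF _ \<open>(\<lambda>y. 0) \<in> sections_at F x\<close>]) simp
    show "u + w \<in> V" if uw: "u \<in> V" "w \<in> V" for u w
    proof -
      obtain \<sigma> \<tau> where "\<sigma> \<in> sections_at F x" "\<tau> \<in> sections_at F x" "u = \<sigma> x" "w = \<tau> x"
        using uw by (auto simp: V_def)
      then show ?thesis unfolding V_def using sections_at_add[where F=F and \<sigma>=\<sigma> and \<tau>=\<tau> and x=x, OF sub]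
        by (intro image_eqI[of _ _ "\<lambda>y. \<sigma> y + \<tau> y"]) auto
    qed
    show "r *\<^sub>R u \<in> V" if u: "u \<in> V" for r u
    proof -
      obtain \<sigma> where "\<sigma> \<in> sections_at F x" "u = \<sigma> x" using u by (auto simp: V_def)
      then show ?thesis unfolding V_def using sections_at_scale[where F=F and \<sigma>=\<sigma> and r=r and x=x, OF sub]
        by (intro image_eqI[of _ _ "\<lambda>y. r *\<^sub>R \<sigma> y"]) auto
    qed
  qed
  moreover have "\<rho> i x \<in> V" if "i < k" for i
  proof -
    have "\<rho> i y \<in> F y" if "y \<in> W" for y
      unfolding W(4)[OF that] using \<open>i < k\<close> by (intro span_base) auto
    then have "\<rho> i \<in> sections_at F x"
      unfolding sections_at_def using W(1,2) W(3)[OF \<open>i < k\<close>] by blast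
    then show ?thesis by (auto simp: V_def)
  qed
  ultimately have "span ((\<lambda>i. \<rho> i x) ` {..<k}) \<subseteq> V" by (intro span_minimal) auto
  then show ?thesis using that assms(2) W(2,4) unfolding V_def by blast
qed

lemma dim_span_line: "(a::R42) \<noteq> 0 \<Longrightarrow> dim (span {a}) = 1"
  using dim_eq_card_independent[of "{a}"] by simp

lemma line_eq_span:
  fixes s :: "R42 set"
  assumes "subspace s" "dim s = 1" "a \<in> s" "a \<noteq> 0"
  shows "s = span {a}"
proof -
  have "dim (span {a}) = 1" using assms(4) by (rule dim_span_line)
  moreover have "span {a} \<subseteq> s" using assms by (intro span_minimal) auto
  ultimately show ?thesis
    using assms subspace_dim_equal[OF subspace_span assms(1), of "{a}"] by simp
qed

lemma line_generator:
  fixes s :: "R42 set"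
  assumes "dim s = 1"
  obtains a where "a \<in> s" "a \<noteq> 0"
  using assms dim_eq_0[of s] by force

lemma subbundle_line_frame:
  assumes "subbundle 1 s"
  obtains W a where "open W" "x \<in> W" "smooth_map_on W a" "\<And>y. y \<in> W \<Longrightarrow> s y = span {a y} \<and> a y \<noteq> 0"
proof -
  obtain W and \<rho> :: "nat \<Rightarrow> 'a \<Rightarrow> R42" where W: "open W" "x \<in> W" "\<And>i. i < 1 \<Longrightarrow> smooth_map_on W (\<rho> i)"
    "\<And>y. y \<in> W \<Longrightarrow> s y = span ((\<lambda>i. \<rho> i y) ` {..<1})"
    using assms unfolding subbundle_def by metis
  have "(\<lambda>i. \<rho> i y) ` {..<1} = {\<rho> 0 y}" for y by (auto simp: lessThan_Suc)
  then have s: "s y = span {\<rho> 0 y}" if "y \<in> W" for y using W(4)[OF that] by simp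
  moreover have "\<rho> 0 y \<noteq> 0" if "y \<in> W" for y
    using s[OF that] subbundle_dim[OF assms, of y] by auto
  ultimately show ?thesis using that[of W "\<rho> 0"] W by simp
qed

lemma plane_basis:
  fixes X Y :: "real^2"
  assumes "\<And>x y. x *\<^sub>R X + y *\<^sub>R Y = 0 \<Longrightarrow> x = 0 \<and> y = 0"
  shows "\<exists>x y. Z = x *\<^sub>R X + y *\<^sub>R Y"
proof -
  have ne: "X \<noteq> Y" using assms[of 1 "-1"] by auto
  have "independent {X, Y}"
  proof (rule independent_if_scalars_zero)
    fix f x assume "(\<Sum>x\<in>{X, Y}. f x *\<^sub>R x) = 0" "x \<in> {X, Y}"
    then show "f x = 0" using ne assms[of "f X" "f Y"] by auto
  qed simp
  then have "span {X, Y} = UNIV"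
    using ne dim_eq_full[of "{X, Y}"] dim_eq_card_independent[of "{X, Y}"] by simp
  then show ?thesis using span_pair[of Z X Y] by simp
qed

lemma legendre_subspace: "legendre f \<Longrightarrow> subspace (f x)"
  and legendre_isotropic: "legendre f \<Longrightarrow> u \<in> f x \<Longrightarrow> v \<in> f x \<Longrightarrow> inn u v = 0"
  unfolding legendre_def isotropic_bundle_def by (auto dest: subbundle_subspace)

lemma legendre_immersion:
  "legendre f \<Longrightarrow> (\<And>\<sigma>. \<sigma> \<in> sections_at f x \<Longrightarrow> ddir X \<sigma> x \<in> f x) \<Longrightarrow> X = 0"
  unfolding legendre_def by blast

lemma legendre_section: "legendre f \<Longrightarrow> v \<in> f x \<Longrightarrow> \<exists>\<sigma>\<in>sections_at f x. \<sigma> x = v"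
  unfolding legendre_def by (metis subbundle_section)

lemma legendre_contact:
  assumes "legendre f" "\<sigma> \<in> sections_at f x" "v \<in> f x"
  shows "inn (ddir X \<sigma> x) v = 0"
proof -
  have "ddir X \<sigma> x \<in> derived_bundle f x"
    unfolding derived_bundle_def using assms(2) by (intro span_base) blast
  then show ?thesis using assms unfolding legendre_def perp_def by blast
qed

lemma umbilic_free_commute: "umbilic_free f s1 s2 \<Longrightarrow> umbilic_free f s2 s1"
  unfolding umbilic_free_def by (auto simp: insert_commute)

lemma umbilic_free_legendre: "umbilic_free f s1 s2 \<Longrightarrow> legendre f"
  by (simp add: umbilic_free_def)

lemma umbilic_free_sphere:
  assumes "umbilic_free f s1 s2"
  shows "subbundle 1 s1" "curvature_sphere f x (s1 x)" "s1 x \<subseteq> f x" "subspace (s1 x)" "dim (s1 x) = 1"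
    "\<exists>X\<in>curvature_space f x (s1 x). X \<noteq> 0"
proof -
  show "subbundle 1 s1" using assms by (simp add: umbilic_free_def)
  show cs: "curvature_sphere f x (s1 x)" using assms unfolding umbilic_free_def by blast
  then show "s1 x \<subseteq> f x" "subspace (s1 x)" "dim (s1 x) = 1" "\<exists>X\<in>curvature_space f x (s1 x). X \<noteq> 0"
    by (auto simp: curvature_sphere_def)
qed

lemmas umbilic_free_sphere2 = umbilic_free_sphere[OF umbilic_free_commute]

text \<open>Two distinct lines in a plane span it.\<close>

lemma umbilic_free_frame:
  assumes U: "umbilic_free f s1 s2" and a: "a \<in> s1 x" "a \<noteq> 0" and b: "b \<in> s2 x" "b \<noteq> 0"
  shows "s1 x = span {a}" "s2 x = span {b}" "f x = span {a, b}" "isotropic_frame a b"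
proof -
  note L = umbilic_free_legendre[OF U]
  show s1: "s1 x = span {a}" and s2: "s2 x = span {b}"
    using line_eq_span umbilic_free_sphere(4,5)[OF U, of x] umbilic_free_sphere2(4,5)[OF U, of x] a b by blast+
  have sub: "a \<in> f x" "b \<in> f x" using umbilic_free_sphere(3)[OF U] umbilic_free_sphere2(3)[OF U] a b by auto
  have ne: "s1 x \<noteq> s2 x" using U by (simp add: umbilic_free_def)
  have ind: "\<alpha> = 0 \<and> \<beta> = 0" if e: "\<alpha> *\<^sub>R a + \<beta> *\<^sub>R b = 0" for \<alpha> \<beta>
  proof (rule ccontr)
    assume n: "\<not> (\<alpha> = 0 \<and> \<beta> = 0)"
    have "\<beta> \<noteq> 0" using n e a by auto
    have "\<beta> *\<^sub>R b = (- \<alpha>) *\<^sub>R a" using e by (simp add: eq_neg_iff_add_eq_0 add.commute)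
    then have "b = (1 / \<beta>) *\<^sub>R (- \<alpha>) *\<^sub>R a"
      using \<open>\<beta> \<noteq> 0\<close> by (metis divide_self_if scaleR_one scaleR_scaleR times_divide_eq_left mult_1)
    then have "b = (- \<alpha> / \<beta>) *\<^sub>R a" by simp
    then have "b \<in> s1 x" unfolding s1 span_single by blast
    then show False using line_eq_span[of "s1 x" b] umbilic_free_sphere(4,5)[OF U, of x] b s2 ne by simp
  qed
  show I: "isotropic_frame a b"
    unfolding isotropic_frame_def using ind legendre_isotropic[OF L] sub by blast
  have d: "a \<noteq> b" using ind[of 1 "-1"] by auto
  have "independent {a, b}"
  proof (rule independent_if_scalars_zero)
    fix g x assume "(\<Sum>x\<in>{a, b}. g x *\<^sub>R x) = 0" "x \<in> {a, b}"
    then show "g x = 0" using d ind[of "g a" "g b"] by auto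
  qed simp
  then have "dim (span {a, b}) = 2" using d dim_eq_card_independent[of "{a, b}"] by simp
  moreover have "span {a, b} \<subseteq> f x" using sub legendre_subspace[OF L] by (intro span_minimal) auto
  moreover have "dim (f x) = 2" using L by (auto simp: legendre_def dest: subbundle_dim)
  ultimately have "span {a, b} = f x"
    by (intro subspace_dim_equal[OF subspace_span legendre_subspace[OF L]]) simp_all
  then show "f x = span {a, b}" by simp
qed

lemma umbilic_free_frame_exists:
  assumes U: "umbilic_free f s1 s2"
  obtains W a b where "open W" "x \<in> W" "smooth_map_on W a" "smooth_map_on W b"
    "\<And>y. y \<in> W \<Longrightarrow> s1 y = span {a y} \<and> s2 y = span {b y} \<and> f y = span {a y, b y} \<and> isotropic_frame (a y) (b y)"
proof -
  obtain W a where a: "open W" "x \<in> W" "smooth_map_on W a" "\<And>y. y \<in> W \<Longrightarrow> s1 y = span {a y} \<and> a y \<noteq> 0"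
    using subbundle_line_frame[OF umbilic_free_sphere(1)[OF U]] by blast
  obtain V b where b: "open V" "x \<in> V" "smooth_map_on V b" "\<And>y. y \<in> V \<Longrightarrow> s2 y = span {b y} \<and> b y \<noteq> 0"
    using subbundle_line_frame[OF umbilic_free_sphere2(1)[OF U]] by blast
  have "s1 y = span {a y} \<and> s2 y = span {b y} \<and> f y = span {a y, b y} \<and> isotropic_frame (a y) (b y)"
    if "y \<in> W \<inter> V" for y
  proof -
    have "a y \<in> s1 y" "b y \<in> s2 y" "a y \<noteq> 0" "b y \<noteq> 0" using a(4) b(4) that by (auto simp: span_base)
    from umbilic_free_frame[OF U this(1,3,2,4)] show ?thesis by (intro conjI)
  qed
  moreover have "smooth_map_on (W \<inter> V) a" "smooth_map_on (W \<inter> V) b"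
    using a(3) b(3) by (auto intro: smooth_map_on_subset)
  ultimately show ?thesis using that[of "W \<inter> V" a b] a(1,2) b(1,2) by (simp add: open_Int)
qed

text \<open>Along a common curvature direction the derivatives of all sections of \<open>f = s1 + s2\<close> would stay in \<open>f\<close>,
  against the immersion condition.\<close>

lemma curvature_spaces_disjoint:
  assumes U: "umbilic_free f s1 s2" and X: "X \<in> curvature_space f x (s1 x)" "X \<in> curvature_space f x (s2 x)"
  shows "X = 0"
proof (rule legendre_immersion[OF umbilic_free_legendre[OF U]])
  fix \<sigma> assume \<sigma>: "\<sigma> \<in> sections_at f x"
  note L = umbilic_free_legendre[OF U]
  note sub = legendre_subspace[OF L]
  obtain a b where ab: "a \<in> s1 x" "a \<noteq> 0" "b \<in> s2 x" "b \<noteq> 0"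
    using line_generator umbilic_free_sphere(5)[OF U] umbilic_free_sphere2(5)[OF U] by metis
  note fr = umbilic_free_frame[OF U ab]
  obtain \<alpha> \<beta> where \<sigma>x: "\<sigma> x = \<alpha> *\<^sub>R a + \<beta> *\<^sub>R b"
    using sections_atD(2)[OF \<sigma>] unfolding fr(3) span_pair by blast
  obtain \<rho> where \<rho>: "\<rho> \<in> sections_at f x" "\<rho> x = a"
    using legendre_section[OF L] ab(1) umbilic_free_sphere(3)[OF U] by blast
  let ?\<tau> = "\<lambda>y. \<sigma> y - \<alpha> *\<^sub>R \<rho> y"
  note \<tau> = section_difference[OF sub \<sigma> \<rho>(1), where r=\<alpha>]
  have "?\<tau> x \<in> s2 x" using ab(3) umbilic_free_sphere2(4)[OF U, of x] by (simp add: \<sigma>x \<rho> subspace_scale)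
  then have "ddir X ?\<tau> x \<in> f x" using X(2) \<tau>(1) by (simp only: curvature_space_def mem_Collect_eq)
  moreover have "ddir X \<rho> x \<in> f x" using X(1) \<rho> ab(1) by (simp add: curvature_space_def)
  moreover have "ddir X \<sigma> x = ddir X ?\<tau> x + \<alpha> *\<^sub>R ddir X \<rho> x" by (simp add: \<tau>(2))
  ultimately show "ddir X \<sigma> x \<in> f x" using sub by (simp add: subspace_add subspace_scale)
qed

lemma curvature_space_scale:
  assumes "legendre f" "X \<in> curvature_space f x s"
  shows "r *\<^sub>R X \<in> curvature_space f x s"
  unfolding curvature_space_def
proof (intro CollectI ballI impI)
  fix \<sigma> assume \<sigma>: "\<sigma> \<in> sections_at f x" "\<sigma> x \<in> s"
  then have "ddir X \<sigma> x \<in> f x" using assms(2) by (simp add: curvature_space_def)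
  then show "ddir (r *\<^sub>R X) \<sigma> x \<in> f x"
    using ddir_direction_combination[OF sections_atD(1)[OF \<sigma>(1)], of r X 0 X] legendre_subspace[OF assms(1)]
    by (simp add: subspace_scale)
qed

lemma curvature_frame:
  assumes U: "umbilic_free f s1 s2" and X: "X \<in> curvature_space f x (s1 x)" "X \<noteq> 0"
    and Y: "Y \<in> curvature_space f x (s2 x)" "Y \<noteq> 0"
  shows "p *\<^sub>R X + q *\<^sub>R Y = 0 \<Longrightarrow> p = 0 \<and> q = 0" "\<exists>p q. Z = p *\<^sub>R X + q *\<^sub>R Y"
proof -
  have ind: "p = 0 \<and> q = 0" if e: "p *\<^sub>R X + q *\<^sub>R Y = 0" for p q
  proof -
    have e': "p *\<^sub>R X = (- q) *\<^sub>R Y" using e by (simp add: eq_neg_iff_add_eq_0)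
    have "p *\<^sub>R X \<in> curvature_space f x (s1 x)"
      using curvature_space_scale[OF umbilic_free_legendre[OF U]] X by blast
    moreover have "p *\<^sub>R X \<in> curvature_space f x (s2 x)"
      unfolding e' using curvature_space_scale[OF umbilic_free_legendre[OF U]] Y by blast
    ultimately have "p *\<^sub>R X = 0" by (rule curvature_spaces_disjoint[OF U])
    then show ?thesis using e X Y by simp
  qed
  then show "p *\<^sub>R X + q *\<^sub>R Y = 0 \<Longrightarrow> p = 0 \<and> q = 0" .
  show "\<exists>p q. Z = p *\<^sub>R X + q *\<^sub>R Y" using plane_basis[of X Y] ind by blast
qed

text \<open>For an arbitrary section the derivative modulo \<open>f\<close> depends only on the value at the point, since
  the two curvature directions span the tangent plane and the zero vector lies in both curvature spheres.\<close>

lemma ddir_vanishing_section: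
  assumes U: "umbilic_free f s1 s2" and \<sigma>: "\<sigma> \<in> sections_at f x" "\<sigma> x = 0"
  shows "ddir Z \<sigma> x \<in> f x"
proof -
  obtain X Y where X: "X \<in> curvature_space f x (s1 x)" "X \<noteq> 0" and Y: "Y \<in> curvature_space f x (s2 x)" "Y \<noteq> 0"
    using umbilic_free_sphere(6)[OF U] umbilic_free_sphere2(6)[OF U] by meson
  obtain p q where Z: "Z = p *\<^sub>R X + q *\<^sub>R Y" using curvature_frame(2)[OF U X Y] by blast
  have "\<sigma> x \<in> s1 x" "\<sigma> x \<in> s2 x"
    using \<sigma>(2) umbilic_free_sphere(4)[OF U] umbilic_free_sphere2(4)[OF U] by (simp_all add: subspace_0)
  then have "ddir X \<sigma> x \<in> f x" "ddir Y \<sigma> x \<in> f x" using X Y \<sigma>(1) by (simp_all add: curvature_space_def)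
  moreover have "ddir Z \<sigma> x = p *\<^sub>R ddir X \<sigma> x + q *\<^sub>R ddir Y \<sigma> x"
    unfolding Z by (rule ddir_direction_combination[OF sections_atD(1)[OF \<sigma>(1)]])
  ultimately show ?thesis
    using legendre_subspace[OF umbilic_free_legendre[OF U]] by (simp add: subspace_add subspace_scale)
qed

lemma ddir_section_cong:
  assumes U: "umbilic_free f s1 s2" and \<sigma>: "\<sigma> \<in> sections_at f x" "\<tau> \<in> sections_at f x" "\<sigma> x = r *\<^sub>R \<tau> x"
  shows "ddir Z \<sigma> x - r *\<^sub>R ddir Z \<tau> x \<in> f x"
proof -
  note sub = legendre_subspace[OF umbilic_free_legendre[OF U]]
  note d = section_difference[OF sub \<sigma>(1,2), where r=r]
  show ?thesis using ddir_vanishing_section[OF U d(1), of Z] by (simp add: d(2) \<sigma>(3))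
qed

text \<open>One section suffices to recognise a curvature sphere: any other section with value on the line differs
  from a multiple of it by a section that vanishes at the point.\<close>

lemma curvature_sphereI:
  assumes U: "umbilic_free f s1 s2" and \<sigma>: "\<sigma> \<in> sections_at f x" "\<sigma> x \<noteq> 0" and X: "ddir X \<sigma> x \<in> f x"
  shows "X \<in> curvature_space f x (span {\<sigma> x})"
    "X \<noteq> 0 \<Longrightarrow> curvature_sphere f x (span {\<sigma> x})"
proof -
  note sub = legendre_subspace[OF umbilic_free_legendre[OF U]]
  show cs: "X \<in> curvature_space f x (span {\<sigma> x})"
    unfolding curvature_space_def
  proof (intro CollectI ballI impI)
    fix \<tau> assume \<tau>: "\<tau> \<in> sections_at f x" "\<tau> x \<in> span {\<sigma> x}"
    then obtain r where r: "\<tau> x = r *\<^sub>R \<sigma> x" by (auto simp: span_single)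
    have "(ddir X \<tau> x - r *\<^sub>R ddir X \<sigma> x) + r *\<^sub>R ddir X \<sigma> x \<in> f x"
      using ddir_section_cong[OF U \<tau>(1) \<sigma>(1) r] X sub by (intro subspace_add subspace_scale) auto
    then show "ddir X \<tau> x \<in> f x" by simp
  qed
  show "curvature_sphere f x (span {\<sigma> x})" if "X \<noteq> 0"
    unfolding curvature_sphere_def using cs that \<sigma>(2) sections_atD(2)[OF \<sigma>(1)] sub
    by (auto simp: dim_span_line[unfolded dim_span] intro: span_minimal[THEN subsetD])
qed

text \<open>The difference of the two sections has its value in \<open>s\<close>.\<close>

lemma ddir_along_curvature:
  assumes L: "legendre f" and X: "X \<in> curvature_space f x s"
    and \<sigma>: "\<sigma> \<in> sections_at f x" "b \<in> sections_at f x" and v: "\<sigma> x - \<beta> *\<^sub>R b x \<in> s"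
  shows "ddir X \<sigma> x - \<beta> *\<^sub>R ddir X b x \<in> f x"
proof -
  note d = section_difference[OF legendre_subspace[OF L] \<sigma>, where r=\<beta>]
  have "ddir X (\<lambda>y. \<sigma> y - \<beta> *\<^sub>R b y) x \<in> f x"
    using X[unfolded curvature_space_def mem_Collect_eq, THEN bspec, OF d(1)] v by simp
  then show ?thesis by (simp add: d(2))
qed

section \<open>Legendre maps in curvature direction frames\<close>

lemma smooth_on_has_derivative:
  "smooth_on S g \<Longrightarrow> open S \<Longrightarrow> u \<in> S \<Longrightarrow> (g has_derivative FD g u) (at u)"
  using smooth_on_imp_differentiable frechet_derivative_works by blast

lemma FD_linear:
  assumes "smooth_on S g" "open S" "u \<in> S"
  shows "FD g u (v + w) = FD g u v + FD g u w" "FD g u (r *\<^sub>R v) = r *\<^sub>R FD g u v"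
    "FD g u (v - w) = FD g u v - FD g u w"
  using has_derivative_linear[OF smooth_on_has_derivative[OF assms]]
  by (simp_all add: linear_add linear_scale linear_diff)

lemma FD_bilinear:
  assumes "bounded_bilinear M" "smooth_on S g" "smooth_on S h" "open S" "u \<in> S"
  shows "FD (\<lambda>y. M (g y) (h y)) u v = M (g u) (FD h u v) + M (FD g u v) (h u)"
  using bounded_bilinear.FDERIV[OF assms(1) smooth_on_has_derivative[OF assms(2,4,5)]
      smooth_on_has_derivative[OF assms(3,4,5)]] frechet_derivative_at by metis

lemma FD_bilinear_zero:
  assumes "bounded_bilinear M" "smooth_on S g" "smooth_on S h" "open S" "u \<in> S"
    "\<And>y. y \<in> S \<Longrightarrow> M (g y) (h y) = 0"
  shows "M (FD g u v) (h u) = - M (g u) (FD h u v)"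
proof -
  have "FD (\<lambda>y. M (g y) (h y)) u v = FD (\<lambda>y. 0) u v"
    using frechet_derivative_cong_open[OF assms(4,5), of "\<lambda>y. M (g y) (h y)" "\<lambda>y. 0"] assms(6) by simp
  then show ?thesis
    using FD_bilinear[OF assms(1-5), of v] by (simp add: add_eq_0_iff)
qed

lemma FD_axis_sum:
  fixes g :: "real^'n \<Rightarrow> 'b::real_normed_vector"
  assumes "smooth_on S g" "open S" "u \<in> S"
  shows "FD g u v = (\<Sum>i\<in>UNIV. (v $ i) *\<^sub>R FD g u (axis i 1))"
  using frechet_derivative_axis_sum[OF smooth_on_imp_differentiable[OF assms]] .

lemma smooth_on_sum:
  "open S \<Longrightarrow> (\<And>i. i \<in> I \<Longrightarrow> smooth_on S (g i)) \<Longrightarrow> smooth_on S (\<lambda>x. \<Sum>i\<in>I. g i x)"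
  by (simp add: smooth_on_def Ck_on_sum)

lemma
  fixes g :: "real^'n \<Rightarrow> 'b::real_normed_vector"
  assumes g: "smooth_on S g" and X: "smooth_on S X" and S: "open S"
  shows smooth_on_FD_field: "smooth_on S (\<lambda>y. FD g y (X y))"
    and FD_FD_field: "u \<in> S \<Longrightarrow> FD (\<lambda>y. FD g y (X y)) u w = FD (\<lambda>y. FD g y (X u)) u w + FD g u (FD X u w)"
proof -
  have Xi: "smooth_on S (\<lambda>y. X y $ i)" for i
    using smooth_on_linear[OF S bounded_linear_vec_nth X] .
  have Dg: "smooth_on S (\<lambda>y. FD g y c)" for c using smooth_on_frechet_derivative[OF g] .
  have "smooth_on S (\<lambda>y. \<Sum>i\<in>UNIV. (X y $ i) *\<^sub>R FD g y (axis i 1))"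
    by (intro smooth_on_sum smooth_on_bilinear[OF _ bounded_bilinear_scaleR] Xi Dg S)
  then show sm: "smooth_on S (\<lambda>y. FD g y (X y))"
    by (rule smooth_on_eq[OF S]) (rule FD_axis_sum[OF g S])
  show "FD (\<lambda>y. FD g y (X y)) u w = FD (\<lambda>y. FD g y (X u)) u w + FD g u (FD X u w)" if u: "u \<in> S"
  proof -
    have tm: "((\<lambda>y. (Z y $ i) *\<^sub>R FD g y (axis i 1)) has_derivative
        (\<lambda>w. (Z u $ i) *\<^sub>R FD (\<lambda>y. FD g y (axis i 1)) u w + (FD Z u w $ i) *\<^sub>R FD g u (axis i 1))) (at u)"
      if Z: "smooth_on S Z" for i and Z :: "real^'n \<Rightarrow> real^'n"
      using bounded_bilinear.FDERIV[OF bounded_bilinear_scaleR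
          bounded_linear.has_derivative[OF bounded_linear_vec_nth smooth_on_has_derivative[OF Z S u]]
          smooth_on_has_derivative[OF Dg S u]] .
    have field: "FD (\<lambda>y. FD g y (Z y)) u w =
        (\<Sum>i\<in>UNIV. (Z u $ i) *\<^sub>R FD (\<lambda>y. FD g y (axis i 1)) u w + (FD Z u w $ i) *\<^sub>R FD g u (axis i 1))"
      if Z: "smooth_on S Z" for Z
    proof -
      have "((\<lambda>y. \<Sum>i\<in>UNIV. (Z y $ i) *\<^sub>R FD g y (axis i 1)) has_derivative
        (\<lambda>w. \<Sum>i\<in>UNIV. (Z u $ i) *\<^sub>R FD (\<lambda>y. FD g y (axis i 1)) u w + (FD Z u w $ i) *\<^sub>R FD g u (axis i 1))) (at u)"
        by (intro has_derivative_sum tm Z)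
      then have "((\<lambda>y. FD g y (Z y)) has_derivative
        (\<lambda>w. \<Sum>i\<in>UNIV. (Z u $ i) *\<^sub>R FD (\<lambda>y. FD g y (axis i 1)) u w + (FD Z u w $ i) *\<^sub>R FD g u (axis i 1))) (at u)"
        by (rule has_derivative_transform_within_open[OF _ S u]) (rule FD_axis_sum[OF g S, symmetric])
      from frechet_derivative_at[OF this, symmetric] show ?thesis by simp
    qed
    show ?thesis
      using field[OF X] field[of "\<lambda>_. X u"] FD_axis_sum[OF g S u, of "FD X u w"] by (simp add: sum.distrib)
  qed
qed

lemma smooth_second_derivative_symmetric:
  fixes g :: "'a::real_normed_vector \<Rightarrow> 'b::real_inner"
  assumes "smooth_on S g" "open S" "u \<in> S"
  shows "FD (\<lambda>y. FD g y v) u w = FD (\<lambda>y. FD g y w) u v"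
proof -
  have "Ck_on 2 S g" using assms(1) by (simp add: smooth_on_def)
  then show ?thesis by (rule second_derivative_symmetric[OF assms(2,3)])
qed

text \<open>The second derivative of \<open>g\<close> is symmetric, so only the derivatives of the fields contribute: \<open>[Y,X] g\<close>.\<close>

lemma FD_commutator:
  fixes g :: "real^'n \<Rightarrow> 'b::real_inner"
  assumes g: "smooth_on S g" and X: "smooth_on S X" and Y: "smooth_on S Y" and S: "open S" "u \<in> S"
  shows "FD (\<lambda>y. FD g y (X y)) u (Y u) = FD (\<lambda>y. FD g y (Y y)) u (X u) + FD g u (FD X u (Y u) - FD Y u (X u))"
  using FD_FD_field[OF g X S, of "Y u"] FD_FD_field[OF g Y S, of "X u"]
    smooth_second_derivative_symmetric[OF g S, of "X u" "Y u"] FD_linear(3)[OF g S]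
  by simp

lemma perp_span_inn: "w \<in> perp F \<Longrightarrow> v \<in> F \<Longrightarrow> inn w v = 0"
  by (simp add: perp_def)

text \<open>The coordinate expression of an umbilic-free Legendre map near a point: \<open>A\<close> and \<open>B\<close> span the
  curvature spheres.\<close>

locale contact_frame =
  fixes \<Omega> :: "(real^2) set" and A B :: "real^2 \<Rightarrow> R42"
  assumes open_dom: "open \<Omega>"
    and smooth_A: "smooth_on \<Omega> A" and smooth_B: "smooth_on \<Omega> B"
    and frame: "u \<in> \<Omega> \<Longrightarrow> isotropic_frame (A u) (B u)"
    and contact_A: "u \<in> \<Omega> \<Longrightarrow> FD A u v \<in> perp (span {A u, B u})"
    and contact_B: "u \<in> \<Omega> \<Longrightarrow> FD B u v \<in> perp (span {A u, B u})"
    and kernel_A: "u \<in> \<Omega> \<Longrightarrow> \<exists>X. X \<noteq> 0 \<and> FD A u X \<in> span {A u, B u}"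
    and kernel_B: "u \<in> \<Omega> \<Longrightarrow> \<exists>Y. Y \<noteq> 0 \<and> FD B u Y \<in> span {A u, B u}"
    and immersion: "u \<in> \<Omega> \<Longrightarrow> FD A u v \<in> span {A u, B u} \<Longrightarrow> FD B u v \<in> span {A u, B u} \<Longrightarrow> v = 0"
begin

lemma swap: "contact_frame \<Omega> B A"
proof
  have c: "{B u, A u} = {A u, B u}" for u by auto
  show "isotropic_frame (B u) (A u)" if "u \<in> \<Omega>" for u
    using frame[OF that] by (simp only: isotropic_frame_commute)
  show "FD B u v \<in> perp (span {B u, A u})" "FD A u v \<in> perp (span {B u, A u})"
    "\<exists>X. X \<noteq> 0 \<and> FD B u X \<in> span {B u, A u}" "\<exists>Y. Y \<noteq> 0 \<and> FD A u Y \<in> span {B u, A u}"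
    if "u \<in> \<Omega>" for u v
    unfolding c using contact_B[OF that] contact_A[OF that] kernel_B[OF that] kernel_A[OF that] .
  show "v = 0" if "u \<in> \<Omega>" "FD B u v \<in> span {B u, A u}" "FD A u v \<in> span {B u, A u}" for u v
    using that(2,3) unfolding c by (intro immersion[OF that(1)])
qed (rule open_dom smooth_A smooth_B)+

lemma restrict:
  assumes "open S" "S \<subseteq> \<Omega>"
  shows "contact_frame S A B"
proof
  show "smooth_on S A" "smooth_on S B"
    using smooth_on_subset[OF smooth_A assms(2)] smooth_on_subset[OF smooth_B assms(2)] .
  show "v = 0" if "u \<in> S" "FD A u v \<in> span {A u, B u}" "FD B u v \<in> span {A u, B u}" for u v
    using that assms(2) by (intro immersion[of u v]) auto
qed (use assms in \<open>auto intro!: frame contact_A contact_B kernel_A kernel_B\<close>)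

text \<open>Differentiate \<open>(\<tau>,A) = (\<tau>,B) = 0\<close>; the derivatives of \<open>A\<close> and \<open>B\<close> are orthogonal to \<open>\<tau>\<close>.\<close>

lemma section_contact:
  assumes "open S" "S \<subseteq> \<Omega>" "smooth_on S \<tau>" "\<And>y. y \<in> S \<Longrightarrow> \<tau> y \<in> span {A y, B y}" "u \<in> S"
  shows "FD \<tau> u v \<in> perp (span {A u, B u})"
proof -
  have A: "smooth_on S A" "smooth_on S B" using smooth_A smooth_B assms(2) smooth_on_subset by blast+
  have iso: "inn (\<tau> y) (A y) = 0" "inn (\<tau> y) (B y) = 0" if "y \<in> S" for y
    using assms(4)[OF that] frame[of y] assms(2) that
    by (auto simp: span_pair isotropic_frame_def inn_commute)
  have "inn (FD \<tau> u v) (A u) = 0" "inn (FD \<tau> u v) (B u) = 0"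
    using FD_bilinear_zero[OF bounded_bilinear_inn assms(3) A(1) assms(1,5) iso(1), of v]
      FD_bilinear_zero[OF bounded_bilinear_inn assms(3) A(2) assms(1,5) iso(2), of v]
      perp_span_inn[OF contact_A assms(4)] perp_span_inn[OF contact_B assms(4)] assms(2,5)
    by (auto simp: inn_commute[of "\<tau> u"])
  then show ?thesis by (simp add: perp_pair)
qed

text \<open>The symmetry of the second fundamental form, obtained by differentiating \<open>(dA(v), \<tau>) = 0\<close>.\<close>

lemma mixed_contact:
  assumes "open S" "S \<subseteq> \<Omega>" "smooth_on S \<tau>" "\<And>y. y \<in> S \<Longrightarrow> \<tau> y \<in> span {A y, B y}" "u \<in> S"
  shows "inn (FD A u v) (FD \<tau> u w) = inn (FD A u w) (FD \<tau> u v)"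
proof -
  have A: "smooth_on S A" using smooth_A assms(2) smooth_on_subset by blast
  have z: "inn (FD A y v) (\<tau> y) = 0" if "y \<in> S" for v y
    using perp_span_inn[OF contact_A assms(4)] that assms(2) by blast
  have "inn (FD (\<lambda>y. FD A y v) u w) (\<tau> u) = - inn (FD A u v) (FD \<tau> u w)" for v w
    using FD_bilinear_zero[OF bounded_bilinear_inn smooth_on_frechet_derivative[OF A] assms(3,1,5) z] .
  then show ?thesis
    using smooth_second_derivative_symmetric[OF A assms(1,5), of v w] by (metis add.inverse_inverse)
qed

lemma definite:
  assumes "u \<in> \<Omega>" "v \<in> perp (span {A u, B u})" "v \<notin> span {A u, B u}"
  shows "inn v v \<noteq> 0"
  using isotropic_plane_quotient_definite(2)[OF frame[OF assms(1)], of v] assms(2,3) by (auto simp: perp_pair)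

text \<open>The direction along which \<open>A\<close> is a curvature sphere is a smooth line field: it is the kernel of
  \<open>dA\<close> modulo the plane, hence of the linear form \<open>v \<mapsto> (dA(v\<^sub>0), dA(v))\<close> for any fixed \<open>v\<^sub>0\<close> outside it.\<close>

lemma kernel_field:
  assumes u0: "u0 \<in> \<Omega>"
  obtains S X where "open S" "u0 \<in> S" "S \<subseteq> \<Omega>" "smooth_on S X"
    "\<And>u. u \<in> S \<Longrightarrow> X u \<noteq> 0 \<and> FD A u (X u) \<in> span {A u, B u}"
    "\<And>u v. u \<in> S \<Longrightarrow> FD A u v \<in> span {A u, B u} \<Longrightarrow> \<exists>r. v = r *\<^sub>R X u"
proof -
  obtain v0 where v0: "v0 \<noteq> 0" "FD B u0 v0 \<in> span {A u0, B u0}" using kernel_B[OF u0] by blast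
  then have "FD A u0 v0 \<notin> span {A u0, B u0}" using immersion[OF u0] by blast
  then have G0: "inn (FD A u0 v0) (FD A u0 v0) \<noteq> 0" using definite[OF u0 contact_A[OF u0]] by blast
  define l where "l u v = inn (FD A u v0) (FD A u v)" for u v
  have lsm: "smooth_on \<Omega> (\<lambda>u. l u v)" for v
    unfolding l_def
    by (rule smooth_on_bilinear[OF open_dom bounded_bilinear_inn]; rule smooth_on_frechet_derivative[OF smooth_A])
  define S where "S = {u \<in> \<Omega>. l u v0 \<noteq> 0}"
  have "S = \<Omega> \<inter> (\<lambda>u. l u v0) -` (- {0})" by (auto simp: S_def)
  then have S: "open S" using continuous_open_preimage[OF smooth_on_imp_continuous_on[OF lsm] open_dom, of "- {0}" v0] by auto
  define X :: "real^2 \<Rightarrow> real^2" where "X u = (- l u (axis 2 1)) *\<^sub>R axis 1 1 + l u (axis 1 1) *\<^sub>R axis 2 1" for u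
  have X1: "X u $ 1 = - l u (axis 2 1)" "X u $ 2 = l u (axis 1 1)" for u by (simp_all add: X_def axis_def)
  have "smooth_on \<Omega> X"
    unfolding X_def
    by (rule smooth_on_add[OF open_dom]; rule smooth_on_bilinear[OF open_dom bounded_bilinear_scaleR])
      (rule smooth_on_linear[OF open_dom bounded_linear_minus[OF bounded_linear_ident] lsm] lsm smooth_on_const)+
  then have Xsm: "smooth_on S X" by (rule smooth_on_subset) (auto simp: S_def)
  have main: "X u \<noteq> 0" "l u v = 0 \<Longrightarrow> \<exists>r. v = r *\<^sub>R X u" if u: "u \<in> S" for u v
  proof -
    have l2: "l u v = v $ 1 * l u (axis 1 1) + v $ 2 * l u (axis 2 1)" for v
      using FD_axis_sum[OF smooth_A open_dom, of u v] u by (simp add: S_def l_def sum_2)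
    have ne: "l u (axis 1 1) \<noteq> 0 \<or> l u (axis 2 1) \<noteq> 0" using l2[of v0] u by (auto simp: S_def)
    then show "X u \<noteq> 0" using X1[of u] by (metis neg_equal_0_iff_equal zero_index)
    assume "l u v = 0"
    then have e: "v $ 1 * l u (axis 1 1) = - (v $ 2 * l u (axis 2 1))" using l2[of v] by simp
    show "\<exists>r. v = r *\<^sub>R X u"
    proof (cases "l u (axis 1 1) = 0")
      case True
      then have "v = (- (v $ 1) / l u (axis 2 1)) *\<^sub>R X u"
        using ne e by (simp add: vec_eq_iff forall_2 X1)
      then show ?thesis by blast
    next
      case False
      then have "v = (v $ 2 / l u (axis 1 1)) *\<^sub>R X u"
        using e by (simp add: vec_eq_iff forall_2 X1 field_simps)
      then show ?thesis by blast
    qed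
  qed
  have ker: "\<exists>r. v = r *\<^sub>R X u" if "u \<in> S" "FD A u v \<in> span {A u, B u}" for u v
    using that perp_span_inn[OF contact_A that(2)] by (intro main) (auto simp: l_def S_def)
  have "FD A u (X u) \<in> span {A u, B u}" if u: "u \<in> S" for u
  proof -
    have uO: "u \<in> \<Omega>" using u by (simp add: S_def)
    obtain Z where Z: "Z \<noteq> 0" "FD A u Z \<in> span {A u, B u}" using kernel_A[OF uO] by blast
    obtain r where r: "Z = r *\<^sub>R X u" using ker[OF u Z(2)] by blast
    then have "X u = (1 / r) *\<^sub>R Z" using Z(1) by auto
    then have "FD A u (X u) = (1 / r) *\<^sub>R FD A u Z" using FD_linear(2)[OF smooth_A open_dom uO] by simp
    then show ?thesis using Z(2) by (simp add: span_scale)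
  qed
  then show ?thesis
    using that[of S X] S u0 G0 Xsm main(1) ker by (simp add: S_def l_def subset_iff)
qed

end

text \<open>By \<open>kernel_X\<close> and \<open>kernel_Y\<close> any other field in one of the two curvature directions is a multiple of
  \<open>X\<close> or \<open>Y\<close>.\<close>

locale curvature_fields = contact_frame +
  fixes X Y :: "real^2 \<Rightarrow> real^2"
  assumes smooth_X: "smooth_on \<Omega> X" and smooth_Y: "smooth_on \<Omega> Y"
    and X: "u \<in> \<Omega> \<Longrightarrow> X u \<noteq> 0 \<and> FD A u (X u) \<in> span {A u, B u}"
    and Y: "u \<in> \<Omega> \<Longrightarrow> Y u \<noteq> 0 \<and> FD B u (Y u) \<in> span {A u, B u}"
    and kernel_X: "u \<in> \<Omega> \<Longrightarrow> FD A u v \<in> span {A u, B u} \<Longrightarrow> \<exists>r. v = r *\<^sub>R X u"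
    and kernel_Y: "u \<in> \<Omega> \<Longrightarrow> FD B u v \<in> span {A u, B u} \<Longrightarrow> \<exists>r. v = r *\<^sub>R Y u"
begin

lemma swap_fields: "curvature_fields \<Omega> B A Y X"
proof -
  interpret s: contact_frame \<Omega> B A by (rule swap)
  have c: "{B u, A u} = {A u, B u}" for u by auto
  show ?thesis
  proof
    show "Y u \<noteq> 0 \<and> FD B u (Y u) \<in> span {B u, A u}" "X u \<noteq> 0 \<and> FD A u (X u) \<in> span {B u, A u}"
      if "u \<in> \<Omega>" for u
      unfolding c using Y[OF that] X[OF that] .
    show "\<exists>r. v = r *\<^sub>R Y u" if "u \<in> \<Omega>" "FD B u v \<in> span {B u, A u}" for u v
      using kernel_Y[OF that(1)] that(2) unfolding c .
    show "\<exists>r. v = r *\<^sub>R X u" if "u \<in> \<Omega>" "FD A u v \<in> span {B u, A u}" for u v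
      using kernel_X[OF that(1)] that(2) unfolding c .
  qed (rule smooth_X smooth_Y)+
qed

lemma conjugate:
  assumes "u \<in> \<Omega>"
  shows "inn (FD A u (Y u)) (FD B u (X u)) = 0"
proof -
  have "inn (FD A u (Y u)) (FD B u (X u)) = inn (FD A u (X u)) (FD B u (Y u))"
    using mixed_contact[OF open_dom _ smooth_B _ assms] by (simp add: span_base)
  also have "\<dots> = 0"
    using perp_span_inn[OF contact_B[OF assms]] X[OF assms] by (simp add: inn_commute)
  finally show ?thesis .
qed

text \<open>Move one derivative across \<open>(d\<^sub>Y A, d\<^sub>X B) = 0\<close> and commute \<open>Y\<close> past \<open>X\<close>. Every remaining term is a second
  fundamental form that involves \<open>d\<^sub>X A\<close> or \<open>d\<^sub>Y B\<close>, which lie in the plane.\<close>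

lemma osculating_orthogonal:
  assumes u: "u \<in> \<Omega>"
  shows "inn (FD (\<lambda>y. FD A y (Y y)) u (Y u)) (FD B u (X u)) = 0"
proof -
  let ?\<tau> = "\<lambda>y. FD B y (Y y)"
  have \<tau>: "smooth_on \<Omega> ?\<tau>" using smooth_on_FD_field[OF smooth_B smooth_Y open_dom] .
  have "inn (FD (\<lambda>y. FD A y (Y y)) u (Y u)) (FD B u (X u)) =
      - inn (FD A u (Y u)) (FD (\<lambda>y. FD B y (X y)) u (Y u))"
    using FD_bilinear_zero[OF bounded_bilinear_inn smooth_on_FD_field[OF smooth_A smooth_Y open_dom]
        smooth_on_FD_field[OF smooth_B smooth_X open_dom] open_dom u conjugate] .
  moreover have "FD (\<lambda>y. FD B y (X y)) u (Y u) = FD ?\<tau> u (X u) + FD B u (FD X u (Y u) - FD Y u (X u))"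
    by (rule FD_commutator[OF smooth_B smooth_X smooth_Y open_dom u])
  moreover have "inn (FD A u (Y u)) (FD ?\<tau> u (X u)) = 0"
  proof -
    have "inn (FD A u (Y u)) (FD ?\<tau> u (X u)) = inn (FD A u (X u)) (FD ?\<tau> u (Y u))"
      using mixed_contact[OF open_dom _ \<tau> _ u] Y by blast
    also have "\<dots> = 0"
      using perp_span_inn[OF section_contact[OF open_dom _ \<tau> _ u]] X[OF u] Y by (subst inn_commute) blast
    finally show ?thesis .
  qed
  moreover have "inn (FD A u (Y u)) (FD B u V) = 0" for V
  proof -
    have "inn (FD A u (Y u)) (FD B u V) = inn (FD A u V) (FD B u (Y u))"
      using mixed_contact[OF open_dom _ smooth_B _ u] by (simp add: span_base)
    then show ?thesis using perp_span_inn[OF contact_A[OF u]] Y[OF u] by simp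
  qed
  ultimately show ?thesis by simp
qed

lemma transverse_B: "u \<in> \<Omega> \<Longrightarrow> FD B u (X u) \<notin> span {A u, B u}"
  using immersion X by blast

text \<open>Pairing with \<open>B\<close> excludes the second derivative from a linear combination, since
  \<open>(d\<^sub>X d\<^sub>X B, B) = - (d\<^sub>X B, d\<^sub>X B) \<noteq> 0\<close>, and pairing with \<open>d\<^sub>X B\<close> then excludes the first.\<close>

lemma sphere_not_osculating:
  assumes u: "u \<in> \<Omega>"
  shows "A u \<notin> span {B u, FD B u (X u), FD (\<lambda>y. FD B y (X y)) u (X u)}"
proof
  let ?w = "FD B u (X u)" and ?q = "FD (\<lambda>y. FD B y (X y)) u (X u)"
  assume "A u \<in> span {B u, ?w, ?q}"
  then obtain x where "A u - x *\<^sub>R B u \<in> span {?w, ?q}" by (auto simp: span_insert[of _ "insert _ _"])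
  then obtain y z where "A u - x *\<^sub>R B u = y *\<^sub>R ?w + z *\<^sub>R ?q" by (auto simp: span_pair)
  then have e: "A u = x *\<^sub>R B u + (y *\<^sub>R ?w + z *\<^sub>R ?q)" by (simp add: algebra_simps)
  have N: "inn ?w ?w \<noteq> 0" using definite[OF u contact_B[OF u] transverse_B[OF u]] .
  have w: "inn ?w (A u) = 0" "inn ?w (B u) = 0" using contact_B[OF u] by (simp_all add: perp_pair)
  have "inn ?q (B u) = - inn ?w ?w"
    by (rule FD_bilinear_zero[OF bounded_bilinear_inn smooth_on_FD_field[OF smooth_B smooth_X open_dom]
        smooth_B open_dom u]) (use contact_B in \<open>simp add: perp_pair\<close>)
  then have "inn (A u) (B u) = - (z * inn ?w ?w)"
    using frame[OF u] w by (subst e) (simp add: isotropic_frame_def)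
  then have z: "z = 0" using N frame[OF u] by (simp add: isotropic_frame_def)
  have "inn ?w (A u) = y * inn ?w ?w"
    by (subst e) (simp add: z w)
  then have "1 *\<^sub>R A u + (- x) *\<^sub>R B u = 0" using z N w e by simp
  then show False using frame[OF u] unfolding isotropic_frame_def by (metis zero_neq_one)
qed

text \<open>Another section of the line of \<open>B\<close> is \<open>g B\<close> and another field in the direction of \<open>X\<close> is \<open>h X\<close>, with smooth
  \<open>g\<close> and \<open>h\<close>. By the product rule no new vectors enter the first two derivatives.\<close>

lemma osculating_rescale:
  assumes S: "open S" "S \<subseteq> \<Omega>" "u \<in> S" and \<sigma>: "smooth_on S \<sigma>" "\<And>y. y \<in> S \<Longrightarrow> \<sigma> y \<in> span {B y}"
    and X': "smooth_on S X'" "\<And>y. y \<in> S \<Longrightarrow> FD A y (X' y) \<in> span {A y, B y}"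
  shows "{\<sigma> u, FD \<sigma> u (X' u), FD (\<lambda>y. FD \<sigma> y (X' y)) u (X' u)} \<subseteq>
    span {B u, FD B u (X u), FD (\<lambda>y. FD B y (X y)) u (X u)}" (is "_ \<subseteq> ?V")
proof -
  have B: "smooth_on S B" and Xs: "smooth_on S X"
    using smooth_B smooth_X S(2) smooth_on_subset by blast+
  have B0: "B y \<noteq> 0" and X0: "X y \<noteq> 0" if "y \<in> S" for y
    using isotropic_frame_nonzero[OF frame] X S(2) that by blast+
  define g where "g y = (\<sigma> y \<bullet> B y) * inverse (B y \<bullet> B y)" for y
  define h where "h y = (X' y \<bullet> X y) * inverse (X y \<bullet> X y)" for y
  have gs: "smooth_on S g" and hs: "smooth_on S h"
    unfolding g_def h_def using B0 X0
    by (intro smooth_on_bilinear[OF S(1) bounded_bilinear_mult] smooth_on_inverse S(1)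
        smooth_on_bilinear[OF S(1) bounded_bilinear_inner] \<sigma>(1) B X'(1) Xs; simp)+
  have ge: "\<sigma> y = g y *\<^sub>R B y" if "y \<in> S" for y
    using \<sigma>(2)[OF that] B0[OF that] by (auto simp: span_single g_def)
  have he: "X' y = h y *\<^sub>R X y" if "y \<in> S" for y
  proof -
    obtain r where "X' y = r *\<^sub>R X y" using kernel_X[OF _ X'(2)[OF \<open>y \<in> S\<close>]] \<open>y \<in> S\<close> S(2) by blast
    then show ?thesis using X0[OF \<open>y \<in> S\<close>] by (simp add: h_def)
  qed
  \<comment> \<open>\<open>FD \<sigma> y (X' y) = p y *\<^sub>R FD B y (X y) + q y *\<^sub>R B y\<close>\<close>
  define p where "p y = h y * g y" for y
  define q where "q y = FD g y (X' y)" for y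
  have ps: "smooth_on S p" and qs: "smooth_on S q"
    unfolding p_def q_def by (intro smooth_on_bilinear[OF S(1) bounded_bilinear_mult] smooth_on_FD_field gs hs X' S(1))+
  have W: "smooth_on S (\<lambda>y. FD B y (X y))" using smooth_on_FD_field[OF B Xs S(1)] .
  have d1: "FD \<sigma> y (X' y) = p y *\<^sub>R FD B y (X y) + q y *\<^sub>R B y" if y: "y \<in> S" for y
  proof -
    have "FD \<sigma> y (X' y) = FD (\<lambda>z. g z *\<^sub>R B z) y (X' y)"
      using frechet_derivative_cong_open[OF S(1) y, of \<sigma> "\<lambda>z. g z *\<^sub>R B z"] ge by simp
    also have "\<dots> = g y *\<^sub>R FD B y (X' y) + FD g y (X' y) *\<^sub>R B y"
      by (rule FD_bilinear[OF bounded_bilinear_scaleR gs B S(1) y])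
    also have "FD B y (X' y) = h y *\<^sub>R FD B y (X y)"
      using FD_linear(2)[OF B S(1) y, of "h y" "X y"] he[OF y] by simp
    finally show ?thesis by (simp add: p_def q_def mult.commute)
  qed
  have "FD (\<lambda>y. FD \<sigma> y (X' y)) u (X' u) = FD (\<lambda>y. p y *\<^sub>R FD B y (X y) + q y *\<^sub>R B y) u (X' u)"
    using frechet_derivative_cong_open[OF S(1,3), of "\<lambda>y. FD \<sigma> y (X' y)" "\<lambda>y. p y *\<^sub>R FD B y (X y) + q y *\<^sub>R B y"] d1
    by simp
  also have "\<dots> = (p u *\<^sub>R FD (\<lambda>y. FD B y (X y)) u (X' u) + FD p u (X' u) *\<^sub>R FD B u (X u)) +
      (q u *\<^sub>R FD B u (X' u) + FD q u (X' u) *\<^sub>R B u)"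
  proof -
    have "((\<lambda>y. p y *\<^sub>R FD B y (X y) + q y *\<^sub>R B y) has_derivative
      (\<lambda>v. (p u *\<^sub>R FD (\<lambda>y. FD B y (X y)) u v + FD p u v *\<^sub>R FD B u (X u)) +
        (q u *\<^sub>R FD B u v + FD q u v *\<^sub>R B u))) (at u)"
      by (rule has_derivative_add;
          rule bounded_bilinear.FDERIV[OF bounded_bilinear_scaleR smooth_on_has_derivative[OF _ S(1,3)]
            smooth_on_has_derivative[OF _ S(1,3)]])
        (rule ps qs W B)+
    from frechet_derivative_at[OF this, symmetric] show ?thesis by simp
  qed
  finally have d2: "FD (\<lambda>y. FD \<sigma> y (X' y)) u (X' u) =
      (p u *\<^sub>R FD (\<lambda>y. FD B y (X y)) u (X' u) + FD p u (X' u) *\<^sub>R FD B u (X u)) +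
      (q u *\<^sub>R FD B u (X' u) + FD q u (X' u) *\<^sub>R B u)" .
  have "B u \<in> ?V" "FD B u (X u) \<in> ?V" "FD (\<lambda>y. FD B y (X y)) u (X u) \<in> ?V" by (simp_all add: span_base)
  moreover have "FD (\<lambda>y. FD B y (X y)) u (X' u) = h u *\<^sub>R FD (\<lambda>y. FD B y (X y)) u (X u)"
    "FD B u (X' u) = h u *\<^sub>R FD B u (X u)"
    using FD_linear(2)[OF W S(1,3)] FD_linear(2)[OF B S(1,3)] he[OF S(3)] by simp_all
  ultimately show ?thesis
    unfolding d2 using d1[OF S(3)] ge[OF S(3)] by (simp add: span_add span_scale)
qed

end

section \<open>Adapted frames on the surface\<close>

lemma coord_field_linear:
  assumes "c \<in> atlas" "y \<in> fst c"
  shows "linear (\<lambda>v. coord_field c v y)"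
  using linear_frechet_derivative[OF transition_differentiable[OF assms(1) chart_at_atlas assms(2) mem_chart_at]]
  by (simp add: coord_field_eq)

text \<open>The conditions of \<open>contact_frame\<close> are those of an umbilic-free Legendre map at the points of \<open>W\<close>, with
  tangent vectors converted to the fixed chart \<open>c\<close>.\<close>

lemma contact_frame_in_chart:
  fixes f s1 s2 :: "'p::smooth_surface \<Rightarrow> R42 set"
  assumes U: "umbilic_free f s1 s2" and c: "c \<in> atlas" and W: "open W" "W \<subseteq> fst c"
    and ab: "smooth_map_on W a" "smooth_map_on W b"
    and fr: "\<And>y. y \<in> W \<Longrightarrow> s1 y = span {a y} \<and> s2 y = span {b y} \<and> f y = span {a y, b y} \<and>
      isotropic_frame (a y) (b y)"
  shows "contact_frame (snd c ` W) (in_chart c a) (in_chart c b)"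
proof -
  note L = umbilic_free_legendre[OF U]
  have int: "fst c \<inter> W = W" using W(2) by blast
  have sa: "a \<in> sections_at f y" "b \<in> sections_at f y" if "y \<in> W" for y
    unfolding sections_at_def using W(1) ab that fr by (auto intro!: exI[of _ W] span_base)
  have ap: "in_chart c g (snd c y) = g y" if "y \<in> W" for y and g :: "'p \<Rightarrow> R42"
    using in_chart_apply[OF c] W(2) that by blast
  have yc: "y \<in> fst c" if "y \<in> W" for y using W(2) that by blast
  have da: "in_chart c a differentiable (at (snd c y))" "in_chart c b differentiable (at (snd c y))" if "y \<in> W" for y
    using smooth_map_on_differentiable[OF _ W(1) c yc[OF that] that] ab by blast+
  have Da: "FD (in_chart c a) (snd c y) v = ddir (coord_field c v y) a y"
    "FD (in_chart c b) (snd c y) v = ddir (coord_field c v y) b y" if "y \<in> W" for y v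
    using ddir_coord_field_in_chart[OF c yc[OF that] da(1)[OF that], of v]
      ddir_coord_field_in_chart[OF c yc[OF that] da(2)[OF that], of v] by simp_all
  have ker: "\<exists>v. v \<noteq> 0 \<and> coord_field c v y = Z" if "y \<in> W" "Z \<noteq> 0" for y Z
  proof -
    have "coord_field c (ddir Z (snd c) y) y = Z" using coord_field_ddir[OF c yc[OF that(1)]] .
    moreover have "coord_field c 0 y = 0" using linear_0[OF coord_field_linear[OF c yc[OF that(1)]]] .
    ultimately show ?thesis using that(2) by metis
  qed
  show ?thesis
  proof
    show "open (snd c ` W)" using open_chart_image[OF c W(1)] unfolding int .
    show "smooth_on (snd c ` W) (in_chart c a)" "smooth_on (snd c ` W) (in_chart c b)"
      using smooth_map_on_chart[OF ab(1) c] smooth_map_on_chart[OF ab(2) c] unfolding int .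
  next
    fix u assume "u \<in> snd c ` W"
    then obtain y where y: "y \<in> W" "u = snd c y" by blast
    let ?A = "in_chart c a" and ?B = "in_chart c b"
    have sp: "span {?A u, ?B u} = f y" using fr[OF y(1)] y ap by simp
    show "isotropic_frame (?A u) (?B u)" using fr[OF y(1)] y ap by simp
    show "FD ?A u v \<in> perp (span {?A u, ?B u})" "FD ?B u v \<in> perp (span {?A u, ?B u})" for v
      unfolding sp unfolding y(2) Da[OF y(1)] using legendre_contact[OF L] sa[OF y(1)] by (auto simp: perp_def)
    obtain Z where Z: "Z \<in> curvature_space f y (s1 y)" "Z \<noteq> 0" using umbilic_free_sphere(6)[OF U] by blast
    obtain Z' where Z': "Z' \<in> curvature_space f y (s2 y)" "Z' \<noteq> 0" using umbilic_free_sphere2(6)[OF U] by blast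
    have ab_in: "a y \<in> s1 y" "b y \<in> s2 y" using fr[OF y(1)] by (simp_all add: span_base)
    obtain v where "v \<noteq> 0" "coord_field c v y = Z" using ker[OF y(1) Z(2)] by blast
    moreover have "ddir Z a y \<in> f y" using Z(1) sa(1)[OF y(1)] ab_in by (simp add: curvature_space_def)
    ultimately show "\<exists>X. X \<noteq> 0 \<and> FD ?A u X \<in> span {?A u, ?B u}"
      unfolding sp unfolding y(2) Da[OF y(1)] by blast
    obtain v' where "v' \<noteq> 0" "coord_field c v' y = Z'" using ker[OF y(1) Z'(2)] by blast
    moreover have "ddir Z' b y \<in> f y" using Z'(1) sa(2)[OF y(1)] ab_in by (simp add: curvature_space_def)
    ultimately show "\<exists>Y. Y \<noteq> 0 \<and> FD ?B u Y \<in> span {?A u, ?B u}"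
      unfolding sp unfolding y(2) Da[OF y(1)] by blast
    show "v = 0" if v: "FD ?A u v \<in> span {?A u, ?B u}" "FD ?B u v \<in> span {?A u, ?B u}" for v
    proof -
      have nz: "a y \<noteq> 0" "b y \<noteq> 0" using isotropic_frame_nonzero fr[OF y(1)] by blast+
      have "ddir (coord_field c v y) a y \<in> f y" "ddir (coord_field c v y) b y \<in> f y"
        using v unfolding sp unfolding y(2) Da[OF y(1)] .
      then have "coord_field c v y \<in> curvature_space f y (s1 y)" "coord_field c v y \<in> curvature_space f y (s2 y)"
        using curvature_sphereI(1)[OF U sa(1)[OF y(1)] nz(1)] curvature_sphereI(1)[OF U sa(2)[OF y(1)] nz(2)]
          fr[OF y(1)] by simp_all
      then have "coord_field c v y = 0" by (rule curvature_spaces_disjoint[OF U])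
      then have "v = ddir 0 (snd c) y" using ddir_coord_field[OF c yc[OF y(1)], of v] by simp
      also have "\<dots> = 0"
        using transition_differentiable[OF chart_at_atlas c mem_chart_at yc[OF y(1)]]
        by (intro linear_0 linear_ddir) (simp add: diff_at_def)
      finally show ?thesis .
    qed
  qed
qed

text \<open>The chart is the one in which tangent vectors at \<open>x\<close> are read. In it the directional derivatives at \<open>x\<close> are
  derivatives of coordinate expressions without any change of coordinates.\<close>

locale adapted_frame =
  fixes f s1 s2 :: "'p::smooth_surface \<Rightarrow> R42 set" and x :: 'p and W :: "'p set" and a b :: "'p \<Rightarrow> R42"
    and X Y :: "real^2 \<Rightarrow> real^2"
  assumes U: "umbilic_free f s1 s2"
    and W: "open W" "x \<in> W" "W \<subseteq> fst (chart_at x)"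
    and smooth_a: "smooth_map_on W a" and smooth_b: "smooth_map_on W b"
    and frame_W: "y \<in> W \<Longrightarrow> s1 y = span {a y} \<and> s2 y = span {b y} \<and> f y = span {a y, b y} \<and>
      isotropic_frame (a y) (b y)"
    and fields: "curvature_fields (snd (chart_at x) ` W) (in_chart (chart_at x) a) (in_chart (chart_at x) b) X Y"

lemma adapted_frame_exists:
  fixes x :: "'p::smooth_surface"
  assumes U: "umbilic_free f s1 s2"
  obtains W a b X Y where "adapted_frame f s1 s2 x W a b X Y"
proof -
  let ?c = "chart_at x"
  obtain W0 a b where W0: "open W0" "x \<in> W0" "smooth_map_on W0 a" "smooth_map_on W0 b"
    "\<And>y. y \<in> W0 \<Longrightarrow> s1 y = span {a y} \<and> s2 y = span {b y} \<and> f y = span {a y, b y} \<and> isotropic_frame (a y) (b y)"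
    using umbilic_free_frame_exists[OF U, of x] by blast
  define W1 where "W1 = W0 \<inter> fst ?c"
  have W1: "open W1" "x \<in> W1" "W1 \<subseteq> fst ?c" "W1 \<subseteq> W0"
    using W0 open_chart[OF chart_at_atlas] mem_chart_at by (auto simp: W1_def intro!: open_Int)
  let ?A = "in_chart ?c a" and ?B = "in_chart ?c b"
  have sm: "smooth_map_on V a" "smooth_map_on V b" if "V \<subseteq> W0" for V
    using W0(3,4) that by (auto intro: smooth_map_on_subset)
  interpret cf: contact_frame "snd ?c ` W1" ?A ?B
    using W0(5) W1 sm[OF W1(4)] by (intro contact_frame_in_chart[OF U chart_at_atlas]) auto
  have u0: "snd ?c x \<in> snd ?c ` W1" using W1 by blast
  obtain S X where SX: "open S" "snd ?c x \<in> S" "S \<subseteq> snd ?c ` W1" "smooth_on S X"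
    "\<And>u. u \<in> S \<Longrightarrow> X u \<noteq> 0 \<and> FD ?A u (X u) \<in> span {?A u, ?B u}"
    "\<And>u v. u \<in> S \<Longrightarrow> FD ?A u v \<in> span {?A u, ?B u} \<Longrightarrow> \<exists>r. v = r *\<^sub>R X u"
    using cf.kernel_field[OF u0] by blast
  obtain S' Y where SY: "open S'" "snd ?c x \<in> S'" "S' \<subseteq> snd ?c ` W1" "smooth_on S' Y"
    "\<And>u. u \<in> S' \<Longrightarrow> Y u \<noteq> 0 \<and> FD ?B u (Y u) \<in> span {?B u, ?A u}"
    "\<And>u v. u \<in> S' \<Longrightarrow> FD ?B u v \<in> span {?B u, ?A u} \<Longrightarrow> \<exists>r. v = r *\<^sub>R Y u"
    using contact_frame.kernel_field[OF cf.swap u0] by blast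
  have comm: "{?B u, ?A u} = {?A u, ?B u}" for u by auto
  define W where "W = {y \<in> W1. snd ?c y \<in> S \<inter> S'}"
  have imW: "snd ?c ` W = S \<inter> S'" using SX(3) SY(3) by (auto simp: W_def)
  have W: "W \<subseteq> W1" "x \<in> W" using W1(2) SX(2) SY(2) by (auto simp: W_def)
  have "open (snd ?c ` W)" unfolding imW using SX(1) SY(1) by blast
  moreover have "W \<subseteq> fst ?c" using W(1) W1(3) by blast
  ultimately have "open W"
    using atlas_homeomorphism[of "fst ?c" "snd ?c"] chart_at_atlas[of x] by simp
  have res: "contact_frame (S \<inter> S') ?A ?B" using cf.restrict SX(1,3) SY(1) by blast
  interpret cW: contact_frame "S \<inter> S'" ?A ?B by (rule res)
  have "curvature_fields (S \<inter> S') ?A ?B X Y"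
  proof
    show "smooth_on (S \<inter> S') X" "smooth_on (S \<inter> S') Y"
      using smooth_on_subset[OF SX(4)] smooth_on_subset[OF SY(4)] by blast+
    show "X u \<noteq> 0 \<and> FD ?A u (X u) \<in> span {?A u, ?B u}" if "u \<in> S \<inter> S'" for u using SX(5) that by blast
    show "Y u \<noteq> 0 \<and> FD ?B u (Y u) \<in> span {?A u, ?B u}" if "u \<in> S \<inter> S'" for u
      using SY(5)[unfolded comm] that by blast
    show "\<exists>r. v = r *\<^sub>R X u" if "u \<in> S \<inter> S'" "FD ?A u v \<in> span {?A u, ?B u}" for u v
      using SX(6) that by blast
    show "\<exists>r. v = r *\<^sub>R Y u" if "u \<in> S \<inter> S'" "FD ?B u v \<in> span {?A u, ?B u}" for u v
      using SY(6)[unfolded comm] that by blast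
  qed
  then have "curvature_fields (snd ?c ` W) ?A ?B X Y" unfolding imW .
  moreover have "W \<subseteq> W0" using W(1) W1(4) by blast
  ultimately have "adapted_frame f s1 s2 x W a b X Y"
    using U W(2) \<open>W \<subseteq> fst ?c\<close> \<open>open W\<close> sm[OF \<open>W \<subseteq> W0\<close>] W0(5)
    by (intro adapted_frame.intro) auto
  then show ?thesis by (rule that)
qed

context adapted_frame
begin

abbreviation "c \<equiv> chart_at x"
abbreviation "u0 \<equiv> snd (chart_at x) x"
abbreviation "A \<equiv> in_chart (chart_at x) a"
abbreviation "B \<equiv> in_chart (chart_at x) b"
abbreviation "X0 \<equiv> X (snd (chart_at x) x)"
abbreviation "Y0 \<equiv> Y (snd (chart_at x) x)"
abbreviation "wX \<equiv> ddir X0 b x"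
abbreviation "wY \<equiv> ddir Y0 a x"

sublocale curvature_fields "snd (chart_at x) ` W" A B X Y by (rule fields)

lemma u0: "u0 \<in> snd c ` W" using W by blast

lemma Int_W: "fst c \<inter> W = W" using W by blast

lemma in_chart_W: "y \<in> W \<Longrightarrow> in_chart c g (snd c y) = g y"
  using in_chart_apply[OF chart_at_atlas] W(3) by blast

lemma plane_W: "y \<in> W \<Longrightarrow> span {A (snd c y), B (snd c y)} = f y"
  using frame_W by (simp add: in_chart_W)

lemma frame_x: "s1 x = span {a x}" "s2 x = span {b x}" "f x = span {a x, b x}" "isotropic_frame (a x) (b x)"
  using frame_W[OF W(2)] by auto

lemma Legendre: "legendre f" using umbilic_free_legendre[OF U] .

lemma subspace_f: "subspace (f y)" using legendre_subspace[OF Legendre] .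

lemma section_a: "a \<in> sections_at f x" and section_b: "b \<in> sections_at f x"
  unfolding sections_at_def using W(1,2) smooth_a smooth_b frame_W by (auto intro!: exI[of _ W] span_base)

lemma perp_f: "v \<in> perp (f x) \<longleftrightarrow> inn v (a x) = 0 \<and> inn v (b x) = 0"
  unfolding frame_x(3) by (rule perp_pair)

lemma FD_eq_ddir: "FD (in_chart c g) u0 Z = ddir Z g x"
  by (simp add: ddir_eq)

lemma X0_curvature: "X0 \<in> curvature_space f x (s1 x)" "X0 \<noteq> 0"
  and Y0_curvature: "Y0 \<in> curvature_space f x (s2 x)" "Y0 \<noteq> 0"
proof -
  have nz: "a x \<noteq> 0" "b x \<noteq> 0" using isotropic_frame_nonzero[OF frame_x(4)] by auto
  have "ddir X0 a x \<in> f x" "ddir Y0 b x \<in> f x"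
    using X[OF u0] Y[OF u0] unfolding plane_W[OF W(2)] FD_eq_ddir by auto
  then show "X0 \<in> curvature_space f x (s1 x)" "Y0 \<in> curvature_space f x (s2 x)"
    using curvature_sphereI(1)[OF U section_a nz(1)] curvature_sphereI(1)[OF U section_b nz(2)] frame_x by simp_all
  show "X0 \<noteq> 0" "Y0 \<noteq> 0" using X[OF u0] Y[OF u0] by auto
qed

lemma tangent_basis: "\<exists>p q. Z = p *\<^sub>R X0 + q *\<^sub>R Y0"
  and tangent_independent: "p *\<^sub>R X0 + q *\<^sub>R Y0 = 0 \<Longrightarrow> p = 0 \<and> q = 0"
  using curvature_frame[OF U X0_curvature Y0_curvature] by blast+

lemma wX: "inn wX (a x) = 0" "inn wX (b x) = 0" "wX \<notin> f x" "inn wX wX \<noteq> 0"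
  and wY: "inn wY (a x) = 0" "inn wY (b x) = 0" "wY \<notin> f x" "inn wY wY \<noteq> 0"
  and wXY: "inn wX wY = 0"
proof -
  interpret s: curvature_fields "snd c ` W" B A Y X by (rule swap_fields)
  have comm: "{B u0, A u0} = {A u0, B u0}" by auto
  show 1: "inn wX (a x) = 0" "inn wX (b x) = 0" "inn wY (a x) = 0" "inn wY (b x) = 0"
    using contact_B[OF u0] contact_A[OF u0] unfolding perp_pair FD_eq_ddir by (simp_all add: in_chart_W W)
  show 2: "wX \<notin> f x" "wY \<notin> f x"
    using transverse_B[OF u0] s.transverse_B[OF u0] unfolding comm plane_W[OF W(2)] FD_eq_ddir by auto
  show "inn wX wX \<noteq> 0" "inn wY wY \<noteq> 0"
    using isotropic_plane_quotient_definite(2)[OF frame_x(4)] 1 2 unfolding frame_x(3) by blast+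
  show "inn wX wY = 0" using conjugate[OF u0] unfolding FD_eq_ddir by (simp add: inn_commute)
qed

lemma perp_expansion:
  assumes "v \<in> perp (f x)"
  obtains s p q where "s \<in> f x" "v = s + p *\<^sub>R wX + q *\<^sub>R wY"
proof -
  let ?p = "inn v wX / inn wX wX" and ?q = "inn v wY / inn wY wY"
  have "v - ?p *\<^sub>R wX - ?q *\<^sub>R wY \<in> f x"
    using assms[unfolded perp_f] unfolding frame_x(3)
    by (intro perp_plane_expansion[OF frame_x(4) _ _ wX(1,2,4) wY(1,2,4) wXY]) auto
  then show ?thesis by (rule that[of _ ?p ?q]) simp
qed

lemma ddir_section:
  assumes "\<sigma> \<in> sections_at f x" "\<sigma> x = \<alpha> *\<^sub>R a x + \<beta> *\<^sub>R b x"
  shows "ddir X0 \<sigma> x - \<beta> *\<^sub>R wX \<in> f x" "ddir Y0 \<sigma> x - \<alpha> *\<^sub>R wY \<in> f x"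
  using ddir_along_curvature[OF Legendre X0_curvature(1) assms(1) section_b, of \<beta>]
    ddir_along_curvature[OF Legendre Y0_curvature(1) assms(1) section_a, of \<alpha>] assms(2) frame_x(1,2)
  by (auto simp: span_scale span_base)

text \<open>The definition ranges over all sections and all fields; \<open>osculating_rescale\<close> reduces it to \<open>b\<close> and \<open>X\<close>.\<close>

lemma second_osculating_subset:
  "second_osculating s2 (\<lambda>y. curvature_space f y (s1 y)) x \<subseteq>
    span {b x, wX, FD (\<lambda>u. FD B u (X u)) u0 X0}"
  unfolding second_osculating_def
proof (intro span_minimal subspace_span UN_least)
  fix \<sigma> X' assume \<sigma>: "\<sigma> \<in> sections_at s2 x" and X': "X' \<in> vector_fields_at (\<lambda>y. curvature_space f y (s1 y)) x"
  obtain V where V: "open V" "x \<in> V" "smooth_map_on V \<sigma>" "\<And>y. y \<in> V \<Longrightarrow> \<sigma> y \<in> s2 y"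
    using \<sigma> unfolding sections_at_def by blast
  obtain V' where V': "open V'" "x \<in> V'" "smooth_vector_field_on V' X'"
    "\<And>y. y \<in> V' \<Longrightarrow> X' y \<in> curvature_space f y (s1 y)"
    using X' unfolding vector_fields_at_def by blast
  let ?\<xi> = "in_chart c (\<lambda>y. ddir (X' y) (snd c) y)"
  let ?s = "in_chart c \<sigma>"
  define N where "N = W \<inter> V \<inter> V'"
  have N: "open N" "x \<in> N" "N \<subseteq> W" "N \<subseteq> fst c" using V V' W by (auto simp: N_def)
  define S where "S = snd c ` N"
  have Nint: "fst c \<inter> N = N" using N(4) by blast
  have S: "open S" "S \<subseteq> snd c ` W" "u0 \<in> S"
    using open_chart_image[OF chart_at_atlas N(1), of x] N(2,3) unfolding Nint S_def by auto
  have ssm: "smooth_map_on N \<sigma>" by (rule smooth_map_on_subset[OF V(3)]) (auto simp: N_def)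
  have sS: "smooth_on S ?s" using smooth_map_on_chart[OF ssm chart_at_atlas[of x]] unfolding Nint S_def .
  have "smooth_map_on (fst c \<inter> V') (\<lambda>y. ddir (X' y) (snd c) y)"
    using V'(3) chart_at_atlas[of x] unfolding smooth_vector_field_on_def by (auto simp: split_beta)
  then have "smooth_on (snd c ` (fst c \<inter> (fst c \<inter> V'))) ?\<xi>" by (rule smooth_map_on_chart[OF _ chart_at_atlas])
  then have xS: "smooth_on S ?\<xi>" by (rule smooth_on_subset) (use N in \<open>auto simp: S_def N_def\<close>)
  have inS: "\<exists>y. y \<in> N \<and> u = snd c y" if "u \<in> S" for u using that by (auto simp: S_def)
  have ap: "in_chart c h (snd c y) = h y" if "y \<in> N" for h :: "'p \<Rightarrow> R42" and y
    using in_chart_apply[OF chart_at_atlas] that N(4) by blast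
  have \<xi>: "?\<xi> (snd c y) = ddir (X' y) (snd c) y" if "y \<in> N" for y
    using in_chart_apply[OF chart_at_atlas] that N(4) by blast
  have dd: "FD (in_chart c h) (snd c y) (?\<xi> (snd c y)) = ddir (X' y) h y"
    if "smooth_map_on N h" "y \<in> N" for h :: "'p \<Rightarrow> R42" and y
    using ddir_in_chart[OF chart_at_atlas, of y x h "X' y"] N(4) that
      smooth_map_on_differentiable[OF that(1) N(1) chart_at_atlas _ that(2), of x] \<xi>[OF that(2)] by auto
  have sB: "?s u \<in> span {B u}" if "u \<in> S" for u
  proof -
    obtain y where y: "y \<in> N" "u = snd c y" using inS[OF \<open>u \<in> S\<close>] by blast
    then have "\<sigma> y \<in> span {b y}" using V(4)[of y] frame_W[of y] by (simp add: N_def)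
    then show ?thesis using ap[OF y(1)] y(2) by simp
  qed
  have asm: "smooth_map_on N a" using smooth_map_on_subset[OF smooth_a N(3)] .
  have xA: "FD A u (?\<xi> u) \<in> span {A u, B u}" if "u \<in> S" for u
  proof -
    obtain y where y: "y \<in> N" "u = snd c y" using inS[OF \<open>u \<in> S\<close>] by blast
    have "y \<in> W" using y N by blast
    have "a \<in> sections_at f y" "a y \<in> s1 y"
      unfolding sections_at_def using W(1) smooth_a \<open>y \<in> W\<close> frame_W by (auto intro!: exI[of _ W] span_base)
    then have "ddir (X' y) a y \<in> f y"
      using V'(4)[of y] y(1) by (auto simp: curvature_space_def N_def)
    then show ?thesis using dd[OF asm y(1)] plane_W[OF \<open>y \<in> W\<close>] y(2) by simp
  qed
  have first: "FD ?s u0 (?\<xi> u0) = ddir (X' x) \<sigma> x" using dd[OF ssm N(2)] .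
  have "in_chart c (\<lambda>y. ddir (X' y) \<sigma> y) u = FD ?s u (?\<xi> u)" if "u \<in> S" for u
    using inS[OF that] ap dd[OF ssm] by auto
  then have "FD (in_chart c (\<lambda>y. ddir (X' y) \<sigma> y)) u0 v = FD (\<lambda>u. FD ?s u (?\<xi> u)) u0 v" for v
    using frechet_derivative_cong_open[OF S(1,3), of "in_chart c (\<lambda>y. ddir (X' y) \<sigma> y)" "\<lambda>u. FD ?s u (?\<xi> u)"]
    by simp
  then have second: "FD (\<lambda>u. FD ?s u (?\<xi> u)) u0 (?\<xi> u0) = ddir (?\<xi> u0) (\<lambda>y. ddir (X' y) \<sigma> y) x"
    by (simp add: ddir_eq)
  have "?\<xi> u0 = X' x"
    using \<xi>[OF N(2)] in_chart_self_derivative[OF chart_at_atlas mem_chart_at, of x "X' x"]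
    by (simp add: ddir_eq)
  then show "{\<sigma> x, ddir (X' x) \<sigma> x, ddir (X' x) (\<lambda>y. ddir (X' y) \<sigma> y) x} \<subseteq>
      span {b x, wX, FD (\<lambda>u. FD B u (X u)) u0 X0}"
    using osculating_rescale[OF S sS sB xS xA] first second ap[OF N(2), of \<sigma>] ap[OF N(2), of b] FD_eq_ddir[of b X0]
    by simp
qed

lemma swap_frame: "adapted_frame f s2 s1 x W b a Y X"
proof (rule adapted_frame.intro)
  have "{b y, a y} = {a y, b y}" for y by auto
  then show "s2 y = span {b y} \<and> s1 y = span {a y} \<and> f y = span {b y, a y} \<and> isotropic_frame (b y) (a y)"
    if "y \<in> W" for y
    using frame_W[OF that] isotropic_frame_commute by simp
qed (rule umbilic_free_commute[OF U] W smooth_a smooth_b swap_fields)+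

end

section \<open>The middle potential in an adapted frame\<close>

text \<open>What is used of a gauge potential at a point: it is a map \<open>f\<^sup>\<bottom>/f \<rightarrow> f\<close>, and closedness, evaluated on
  sections of \<open>f\<close>, is a symmetry.\<close>

definition potential_at ::
  "('p::smooth_surface \<Rightarrow> R42 set) \<Rightarrow> 'p \<Rightarrow> (real^2 \<Rightarrow> (R42 \<Rightarrow>\<^sub>L R42)) \<Rightarrow> bool" where
  "potential_at f x \<omega> \<longleftrightarrow> linear \<omega> \<and> (\<forall>Z u v. inn (\<omega> Z u) v = - inn u (\<omega> Z v)) \<and>
     (\<forall>Z. \<forall>v\<in>f x. \<omega> Z v = 0) \<and> (\<forall>Z. \<forall>v\<in>perp (f x). \<omega> Z v \<in> f x) \<and>
     (\<forall>Z Z'. \<forall>\<sigma>\<in>sections_at f x. \<omega> Z (ddir Z' \<sigma> x) = \<omega> Z' (ddir Z \<sigma> x))"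

lemma potential_atD:
  assumes "potential_at f x \<omega>"
  shows "inn (\<omega> Z u) v = - inn u (\<omega> Z v)" "v \<in> f x \<Longrightarrow> \<omega> Z v = 0" "v \<in> perp (f x) \<Longrightarrow> \<omega> Z v \<in> f x"
    "\<omega> (p *\<^sub>R Z + q *\<^sub>R Z') = p *\<^sub>R \<omega> Z + q *\<^sub>R \<omega> Z'"
proof -
  have lin: "linear \<omega>" using assms by (simp only: potential_at_def)
  show "inn (\<omega> Z u) v = - inn u (\<omega> Z v)" "v \<in> f x \<Longrightarrow> \<omega> Z v = 0" "v \<in> perp (f x) \<Longrightarrow> \<omega> Z v \<in> f x"
    using assms unfolding potential_at_def by blast+
  show "\<omega> (p *\<^sub>R Z + q *\<^sub>R Z') = p *\<^sub>R \<omega> Z + q *\<^sub>R \<omega> Z'"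
    by (simp only: linear_add[OF lin] linear_scale[OF lin])
qed

text \<open>\<open>\<eta>\<close> kills sections \<open>\<sigma>\<close> of \<open>f\<close>, so \<open>\<eta>(Z) d\<^sub>V \<sigma> = - (d\<^sub>V (\<eta>(Z))) \<sigma>\<close> for coordinate fields \<open>Z\<close> and \<open>V\<close>, which is
  symmetric in them by closedness.\<close>

lemma gauge_potential_at:
  fixes f :: "'p::smooth_surface \<Rightarrow> R42 set"
  assumes L: "legendre f" and \<eta>: "gauge_potential f \<eta>"
  shows "potential_at f x (\<eta> x)"
proof -
  note iso = legendre_isotropic[OF L]
  have w: "\<eta> y Z \<in> wedge_space (f y) (perp (f y))" for y Z
    using \<eta> by (simp add: gauge_potential_def)
  have kill: "\<eta> y Z v = 0" if "v \<in> f y" for y Z v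
    by (rule wedge_space_kernel[OF w]) (use that iso in \<open>auto simp: perp_def\<close>)
  have sym: "\<eta> x Z (ddir Z' \<sigma> x) = \<eta> x Z' (ddir Z \<sigma> x)" if \<sigma>: "\<sigma> \<in> sections_at f x" for Z Z' \<sigma>
  proof -
    define g where "g Z y = \<eta> y (coord_field (chart_at x) Z y)" for Z y
    have "smooth_map_on (fst (chart_at x)) (g Z)" for Z
      unfolding g_def using \<eta> smooth_vector_field_coord_field[OF chart_at_atlas] open_chart[OF chart_at_atlas]
      unfolding gauge_potential_def smooth_one_form_def by blast
    then have dg: "diff_at (g Z) x" for Z
      using diff_atI[OF _ open_chart[OF chart_at_atlas] mem_chart_at] by blast
    have gx: "g Z x = \<eta> x Z" for Z by (simp add: g_def coord_field_chart_at)
    obtain V where V: "open V" "x \<in> V" "\<forall>y\<in>V. \<sigma> y \<in> f y" using \<sigma> unfolding sections_at_def by blast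
    have prod: "\<eta> x Z (ddir Z' \<sigma> x) = - (ddir Z' (g Z) x) (\<sigma> x)" for Z Z'
    proof -
      have "ddir Z' (\<lambda>y. blinfun_apply (g Z y) (\<sigma> y)) x = ddir Z' (\<lambda>y. 0::R42) x"
        using V kill by (intro ddir_cong[OF V(1,2)]) (auto simp: g_def)
      then show ?thesis
        using ddir_bilinear[OF bounded_bilinear_blinfun_apply dg sections_atD(1)[OF \<sigma>], of Z' Z] gx
        by (simp add: add_eq_0_iff)
    qed
    have "ext_deriv \<eta> x Z' Z = 0" using \<eta> by (simp add: gauge_potential_def)
    then have "ddir Z' (g Z) x = ddir Z (g Z') x" unfolding ext_deriv_def g_def by simp
    then show ?thesis using prod by simp
  qed
  show ?thesis
    unfolding potential_at_def
    using \<eta> wedge_space_skew[OF w] kill wedge_space_perp_image[OF w legendre_subspace[OF L]] sym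
    by (auto simp: gauge_potential_def smooth_one_form_def)
qed

lemma potential_at_diff:
  assumes "legendre f" "potential_at f x \<omega>" "potential_at f x \<omega>'"
  shows "potential_at f x (\<lambda>Z. \<omega> Z - \<omega>' Z)"
  using assms legendre_subspace[OF assms(1), of x] unfolding potential_at_def
  by (auto simp: blinfun.diff_left linear_compose_sub intro: subspace_diff)

context adapted_frame
begin

text \<open>The gauge terms. Because \<open>\<tau>\<close> kills \<open>f\<^sup>\<bottom>\<close>, differentiating \<open>\<tau> w = 0\<close> for a section \<open>w\<close> of \<open>f\<^sup>\<bottom>\<close> gives
  \<open>(d\<tau>) w = - \<tau> (dw)\<close>, and for \<open>w = d\<sigma>\<close> the right-hand side is symmetric. The second claim says that the
  gauge terms do not affect the diagonal of \<open>\<eta>\<close>: it holds because \<open>\<tau>\<close> is skew on \<open>d\<^sub>X d\<^sub>X b\<close>, which is orthogonal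
  to \<open>a\<close> but not to \<open>b\<close>.\<close>

lemma exterior_square_derivative:
  assumes \<tau>: "smooth_map_on UNIV \<tau>" "\<And>y. \<tau> y \<in> wedge_space (f y) (f y)"
  shows "potential_at f x (\<lambda>Z. ddir Z \<tau> x)" "ddir X0 \<tau> x wX \<in> span {a x}"
proof -
  note iso = legendre_isotropic[OF Legendre]
  let ?T = "in_chart c \<tau>"
  have "smooth_map_on W \<tau>" using \<tau>(1) by (rule smooth_map_on_subset) simp
  then have T: "smooth_on (snd c ` W) ?T" using smooth_map_on_chart[OF _ chart_at_atlas[of x]] Int_W by metis
  have Tw: "?T u \<in> wedge_space (span {A u, B u}) (span {A u, B u})" if u: "u \<in> snd c ` W" for u
  proof -
    obtain y where y: "y \<in> W" "u = snd c y" using u by blast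
    have "?T (snd c y) = \<tau> y" using y in_chart_apply[OF chart_at_atlas] W(3) by blast
    then show ?thesis using \<tau>(2)[of y] plane_W[OF y(1)] y(2) by simp
  qed
  have kill: "?T u v = 0" if "u \<in> snd c ` W" "v \<in> perp (span {A u, B u})" for u v
    by (rule wedge_space_kernel[OF Tw[OF that(1)]]) (use that(2) in \<open>auto simp: perp_def inn_commute\<close>)
  have T0: "?T u0 = \<tau> x" by (simp add: in_chart_apply[OF chart_at_atlas mem_chart_at])
  have Trange: "\<tau> x v \<in> f x" for v
    by (rule wedge_space_range[OF \<tau>(2) subspace_f]) auto
  have dT: "ddir Z \<tau> x = FD ?T u0 Z" for Z by (simp add: ddir_eq)
  \<comment> \<open>\<open>\<tau>\<close> kills \<open>f\<^sup>\<bottom>\<close>, hence its derivative acts on a section of \<open>f\<^sup>\<bottom>\<close> through the derivative of the section.\<close>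
  have product: "ddir Z \<tau> x (h u0) = - \<tau> x (FD h u0 Z)"
    if "open S" "S \<subseteq> snd c ` W" "u0 \<in> S" "smooth_on S h" "\<And>u. u \<in> S \<Longrightarrow> h u \<in> perp (span {A u, B u})" for S h Z
    using FD_bilinear_zero[OF bounded_bilinear_blinfun_apply smooth_on_subset[OF T that(2)] that(4,1,3), of Z]
      kill that(2,5) unfolding dT T0 by blast
  have iso_perp: "A u \<in> perp (span {A u, B u})" "B u \<in> perp (span {A u, B u})" if "u \<in> snd c ` W" for u
    using frame[OF that] by (auto simp: perp_pair isotropic_frame_def inn_commute)
  have perp0: "ddir Z \<sigma> x \<in> perp (f x)" if "\<sigma> \<in> sections_at f x" for Z \<sigma>
    using legendre_contact[OF Legendre that] by (simp add: perp_def)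
  have killx: "\<tau> x v = 0" if "v \<in> perp (f x)" for v
    using kill[OF u0, of v] that unfolding T0 plane_W[OF W(2)] by blast
  have d1: "ddir Z \<tau> x (a x) = 0" "ddir Z \<tau> x (b x) = 0" for Z
    using product[OF open_dom subset_refl u0 smooth_A iso_perp(1), of Z]
      product[OF open_dom subset_refl u0 smooth_B iso_perp(2), of Z]
      killx[OF perp0[OF section_a]] killx[OF perp0[OF section_b]]
    by (simp_all add: FD_eq_ddir in_chart_W W(2))
  have d2: "ddir Z \<tau> x (ddir Z' a x) = - \<tau> x (FD (\<lambda>u. FD A u Z') u0 Z)"
    "ddir Z \<tau> x (ddir Z' b x) = - \<tau> x (FD (\<lambda>u. FD B u Z') u0 Z)" for Z Z'
    using product[OF open_dom subset_refl u0 smooth_on_frechet_derivative[OF smooth_A] contact_A, of Z Z']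
      product[OF open_dom subset_refl u0 smooth_on_frechet_derivative[OF smooth_B] contact_B, of Z Z']
    by (simp_all add: FD_eq_ddir)
  have lin: "linear (\<lambda>Z. ddir Z \<tau> x)" using linear_ddir[OF diff_atI[OF \<tau>(1)]] by simp
  have skew: "inn (ddir Z \<tau> x p) q = - inn p (ddir Z \<tau> x q)" for Z p q
  proof -
    let ?L = "\<lambda>t :: R42 \<Rightarrow>\<^sub>L R42. inn (t p) q + inn p (t q)"
    have L: "bounded_linear ?L"
      by (intro bounded_linear_add bounded_linear_compose[OF bounded_bilinear.bounded_linear_left[OF bounded_bilinear_inn]]
          bounded_linear_compose[OF bounded_bilinear.bounded_linear_right[OF bounded_bilinear_inn]]
          bounded_bilinear.bounded_linear_left[OF bounded_bilinear_blinfun_apply])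
    have "?L (?T u) = 0" if "u \<in> snd c ` W" for u using wedge_space_skew[OF Tw[OF that], of p q] by simp
    then have "FD (\<lambda>u. ?L (?T u)) u0 Z = FD (\<lambda>u. 0::real) u0 Z"
      using frechet_derivative_cong_open[OF open_dom u0, of "\<lambda>u. ?L (?T u)" "\<lambda>u. 0"] by simp
    moreover have "FD (\<lambda>u. ?L (?T u)) u0 Z = ?L (FD ?T u0 Z)"
      by (rule frechet_derivative_linear_image[OF L smooth_on_imp_differentiable[OF T open_dom u0]])
    ultimately show ?thesis unfolding dT by simp
  qed
  have kills: "ddir Z \<tau> x v = 0" if "v \<in> f x" for Z v
    using that unfolding frame_x(3) span_pair
    by (auto simp: blinfun.add_right blinfun.scaleR_right d1)
  have maps: "ddir Z \<tau> x v \<in> f x" if v: "v \<in> perp (f x)" for Z v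
  proof -
    obtain s p q where s: "s \<in> f x" "v = s + p *\<^sub>R wX + q *\<^sub>R wY" using perp_expansion[OF v] by blast
    have "ddir Z \<tau> x wX \<in> f x" "ddir Z \<tau> x wY \<in> f x"
      unfolding d2 by (rule subspace_neg[OF subspace_f Trange])+
    then show ?thesis
      using s kills[OF s(1)] subspace_f
      by (simp add: blinfun.add_right blinfun.scaleR_right subspace_add subspace_scale)
  qed
  have sym: "ddir Z \<tau> x (ddir Z' \<sigma> x) = ddir Z' \<tau> x (ddir Z \<sigma> x)" if \<sigma>: "\<sigma> \<in> sections_at f x" for Z Z' \<sigma>
  proof -
    obtain V where V: "open V" "x \<in> V" "smooth_map_on V \<sigma>" "\<And>y. y \<in> V \<Longrightarrow> \<sigma> y \<in> f y"
      using \<sigma> unfolding sections_at_def by blast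
    let ?s = "in_chart c \<sigma>"
    define N where "N = W \<inter> V"
    have N: "open N" "x \<in> N" "N \<subseteq> W" "N \<subseteq> V" using V W by (auto simp: N_def)
    have Nint: "fst c \<inter> N = N" using N(3) W(3) by blast
    have S: "open (snd c ` N)" "snd c ` N \<subseteq> snd c ` W" "u0 \<in> snd c ` N"
      using open_chart_image[OF chart_at_atlas N(1), of x] N(2,3) unfolding Nint by auto
    have ss: "smooth_on (snd c ` N) ?s"
      using smooth_map_on_chart[OF smooth_map_on_subset[OF V(3) N(4)] chart_at_atlas[of x]] unfolding Nint .
    have ins: "?s u \<in> span {A u, B u}" if u: "u \<in> snd c ` N" for u
    proof -
      obtain y where y: "y \<in> N" "u = snd c y" using u by blast
      have "y \<in> W" "\<sigma> y \<in> f y" using y N V(4) by auto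
      then show ?thesis using plane_W[of y] in_chart_W[of y \<sigma>] y(2) by simp
    qed
    have "ddir Z \<tau> x (ddir Z' \<sigma> x) = - \<tau> x (FD (\<lambda>u. FD ?s u Z') u0 Z)" for Z Z'
      using product[OF S smooth_on_frechet_derivative[OF ss] section_contact[OF S(1,2) ss ins], of Z Z']
      by (simp add: FD_eq_ddir)
    then show ?thesis using smooth_second_derivative_symmetric[OF ss S(1,3), of Z Z'] by simp
  qed
  show "potential_at f x (\<lambda>Z. ddir Z \<tau> x)"
    unfolding potential_at_def using lin skew kills maps sym by blast
  show "ddir X0 \<tau> x wX \<in> span {a x}"
  proof -
    let ?q = "FD (\<lambda>u. FD B u X0) u0 X0"
    have dB: "smooth_on (snd c ` W) (\<lambda>u. FD B u X0)" using smooth_on_frechet_derivative[OF smooth_B] .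
    have "inn ?q (a x) = - inn wX (ddir X0 a x)"
      using FD_bilinear_zero[OF bounded_bilinear_inn dB smooth_A open_dom u0, of X0] contact_B
      by (auto simp: perp_pair FD_eq_ddir in_chart_W W(2))
    also have "\<dots> = 0"
      using X0_curvature(1) section_a frame_x wX(1,2)
      by (auto simp: curvature_space_def span_base span_pair)
    finally have qa: "inn ?q (a x) = 0" .
    have "inn ?q (b x) = - inn wX wX"
      using FD_bilinear_zero[OF bounded_bilinear_inn dB smooth_B open_dom u0, of X0] contact_B
      by (auto simp: perp_pair FD_eq_ddir in_chart_W W(2))
    then have qb: "inn (b x) ?q \<noteq> 0" using wX(4) by (simp add: inn_commute)
    obtain \<alpha> \<beta> where ab: "\<tau> x ?q = \<alpha> *\<^sub>R a x + \<beta> *\<^sub>R b x"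
      using Trange[of ?q] unfolding frame_x(3) span_pair by blast
    have "inn (\<tau> x ?q) ?q = 0" using wedge_space_skew[OF \<tau>(2), of x ?q ?q] by (simp add: inn_commute)
    then have "\<beta> = 0" using qa qb by (simp add: ab inn_commute)
    then show ?thesis unfolding d2 ab by (simp add: span_scale span_base span_neg)
  qed
qed

text \<open>Symmetry on the section \<open>a\<close> moves \<open>X\<close> onto \<open>a\<close>, and \<open>d\<^sub>X a\<close> lies in \<open>f\<close>; likewise for \<open>b\<close>.\<close>

lemma potential_cross:
  assumes "potential_at f x \<omega>"
  shows "\<omega> X0 wY = 0" "\<omega> Y0 wX = 0"
proof -
  have "ddir X0 a x \<in> f x" "ddir Y0 b x \<in> f x"
    using X0_curvature(1) Y0_curvature(1) section_a section_b frame_x by (auto simp: curvature_space_def span_base)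
  moreover have "\<omega> Z v = 0" if "v \<in> f x" for Z v using assms that by (simp add: potential_at_def)
  moreover have "\<omega> X0 wY = \<omega> Y0 (ddir X0 a x)" "\<omega> Y0 wX = \<omega> X0 (ddir Y0 b x)"
    using assms section_a section_b by (simp_all add: potential_at_def)
  ultimately show "\<omega> X0 wY = 0" "\<omega> Y0 wX = 0" by simp_all
qed

text \<open>Pair \<open>\<omega>(X) e\<close> with \<open>wX\<close>, where \<open>e\<close> is orthogonal to the second osculating space of \<open>b\<close> but not to \<open>a\<close>. The
  part \<open>\<alpha>1\<close> contributes nothing because \<open>wX\<close> is orthogonal to the second osculating space of \<open>a\<close>, the part \<open>\<alpha>2\<close>
  kills \<open>e\<close>, and \<open>\<beta>\<close> maps into \<open>f\<close>. So \<open>e\<close> is orthogonal to \<open>\<omega>(X) wX\<close>, which excludes an \<open>a\<close>-component.\<close>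

lemma middle_component:
  assumes \<omega>: "potential_at f x \<omega>"
    and S1: "S1 \<subseteq> span {a x, wY, FD (\<lambda>u. FD A u (Y u)) u0 Y0}"
    and S2: "S2 \<subseteq> span {b x, wX, FD (\<lambda>u. FD B u (X u)) u0 X0}"
    and dec: "\<omega> X0 = \<alpha>1 + \<beta> + \<alpha>2" "\<alpha>1 \<in> wedge_space S1 S1" "\<alpha>2 \<in> wedge_space S2 S2"
      "\<beta> \<in> wedge_space (f x) (f x)"
  shows "\<omega> X0 wX \<in> span {b x}"
proof -
  let ?V1 = "span {a x, wY, FD (\<lambda>u. FD A u (Y u)) u0 Y0}"
  let ?V2 = "span {b x, wX, FD (\<lambda>u. FD B u (X u)) u0 X0}"
  have "a x \<notin> ?V2" using sphere_not_osculating[OF u0] unfolding FD_eq_ddir by (simp add: in_chart_W W(2))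
  then obtain e where e: "inn e (a x) \<noteq> 0" "\<And>s. s \<in> ?V2 \<Longrightarrow> inn e s = 0"
    by (rule separating_vector[OF subspace_span]) blast
  have V1: "inn wX s = 0" if "s \<in> ?V1" for s
  proof -
    have "?V1 \<subseteq> {s. inn wX s = 0}"
    proof (rule span_minimal[OF _ subspace_inn_zero])
      have "inn wX (FD (\<lambda>u. FD A u (Y u)) u0 Y0) = 0"
        using osculating_orthogonal[OF u0] unfolding FD_eq_ddir by (simp add: inn_commute)
      then show "{a x, wY, FD (\<lambda>u. FD A u (Y u)) u0 Y0} \<subseteq> {s. inn wX s = 0}"
        using wX wXY by simp
    qed
    then show ?thesis using that by blast
  qed
  have "\<alpha>1 e \<in> ?V1" by (rule wedge_space_range[OF dec(2) subspace_span S1 S1])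
  moreover have "\<alpha>2 e = 0"
    by (rule wedge_space_kernel[OF dec(3)]) (use e(2) S2 in \<open>auto simp: inn_commute\<close>)
  moreover have "\<beta> e \<in> f x" by (rule wedge_space_range[OF dec(4) subspace_f]) auto
  then have "inn wX (\<beta> e) = 0" using wX(1,2) unfolding frame_x(3) span_pair by auto
  ultimately have "inn wX (\<omega> X0 e) = 0"
    unfolding dec(1) using V1 by (simp add: blinfun.add_left)
  then have z: "inn (\<omega> X0 wX) e = 0" using potential_atD(1)[OF \<omega>, of X0 wX e] by simp
  have "wX \<in> perp (f x)" unfolding perp_f using wX by simp
  then have "\<omega> X0 wX \<in> f x" using \<omega> unfolding potential_at_def by blast
  then obtain p q where pq: "\<omega> X0 wX = p *\<^sub>R a x + q *\<^sub>R b x" unfolding frame_x(3) span_pair by blast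
  have "inn e (b x) = 0" by (rule e(2)) (simp add: span_base)
  then have "p = 0" using z e(1) by (simp add: pq inn_commute)
  then show ?thesis unfolding pq by (simp add: span_scale span_base)
qed

text \<open>Non-degeneracy is known for the quadratic differential of \<open>\<eta>\<close>; the last claim carries it over to \<open>\<eta>m\<close>.\<close>

lemma middle_potential_frame:
  assumes \<eta>: "gauge_potential f \<eta>" and mid: "middle_potential f s1 s2 \<eta> \<eta>m"
  shows "potential_at f x (\<eta>m x)" "\<eta>m x X0 wX \<in> span {b x}" "\<eta> x X0 wX - \<eta>m x X0 wX \<in> span {a x}"
proof -
  obtain \<tau> where \<tau>: "\<eta>m = (\<lambda>x X. \<eta> x X - ddir X \<tau> x)" "smooth_map_on UNIV \<tau>"
    "\<And>x. \<tau> x \<in> wedge_space (f x) (f x)"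
    using mid unfolding middle_potential_def gauge_orbit_def by blast
  note d\<tau> = exterior_square_derivative[OF \<tau>(2,3)]
  show pot: "potential_at f x (\<eta>m x)"
    unfolding \<tau>(1) using potential_at_diff[OF Legendre gauge_potential_at[OF Legendre \<eta>] d\<tau>(1)] .
  show "\<eta> x X0 wX - \<eta>m x X0 wX \<in> span {a x}"
    using d\<tau>(2) unfolding \<tau>(1) by (simp add: blinfun.diff_left)
  interpret s: adapted_frame f s2 s1 x W b a Y X by (rule swap_frame)
  obtain \<alpha>1 \<beta> \<alpha>2 where "\<eta>m x X0 = \<alpha>1 + \<beta> + \<alpha>2"
    "\<alpha>1 \<in> wedge_space (second_osculating s1 (\<lambda>y. curvature_space f y (s2 y)) x)
      (second_osculating s1 (\<lambda>y. curvature_space f y (s2 y)) x)"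
    "\<alpha>2 \<in> wedge_space (second_osculating s2 (\<lambda>y. curvature_space f y (s1 y)) x)
      (second_osculating s2 (\<lambda>y. curvature_space f y (s1 y)) x)"
    "\<beta> \<in> wedge_space (f x) (f x)"
    using mid unfolding middle_potential_def Let_def by meson
  then show "\<eta>m x X0 wX \<in> span {b x}"
    by (rule middle_component[OF pot s.second_osculating_subset second_osculating_subset])
qed

text \<open>By \<open>potential_cross\<close> the mixed terms vanish, so the endomorphism is a sum of two rank one maps, with the
  coordinates of \<open>f\<close> in the frame \<open>a\<close>, \<open>b\<close> as linear forms.\<close>

lemma quad_diff_frame:
  assumes \<omega>: "potential_at f x (\<eta> x)"
    and X0: "\<eta> x X0 wX = p *\<^sub>R a x + q *\<^sub>R b x" and Y0: "\<eta> x Y0 wY = r *\<^sub>R a x + t *\<^sub>R b x"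
  shows "quad_diff f \<eta> x (k *\<^sub>R X0 + l *\<^sub>R Y0) (k' *\<^sub>R X0 + l' *\<^sub>R Y0) = k * k' * q + l * l' * r"
proof -
  obtain ea where ea: "inn ea (a x) = 1" "inn ea (b x) = 0" using dual_frame[OF frame_x(4)] .
  have "isotropic_frame (b x) (a x)" using frame_x(4) isotropic_frame_commute by blast
  then obtain eb where eb: "inn eb (b x) = 1" "inn eb (a x) = 0" by (rule dual_frame)
  note D = potential_atD[OF \<omega>]
  have lin: "linear (inn e)" for e by (rule linearI) simp_all
  let ?T = "\<lambda>s. \<eta> x (k *\<^sub>R X0 + l *\<^sub>R Y0) (ddir (k' *\<^sub>R X0 + l' *\<^sub>R Y0) (SOME \<sigma>. \<sigma> \<in> sections_at f x \<and> \<sigma> x = s) x)"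
  have T: "?T s = inn eb s *\<^sub>R ((k * k') *\<^sub>R \<eta> x X0 wX) + inn ea s *\<^sub>R ((l * l') *\<^sub>R \<eta> x Y0 wY)"
    if s: "s \<in> f x" for s
  proof -
    define \<sigma> where "\<sigma> = (SOME \<sigma>. \<sigma> \<in> sections_at f x \<and> \<sigma> x = s)"
    have "\<exists>\<sigma>. \<sigma> \<in> sections_at f x \<and> \<sigma> x = s" using legendre_section[OF Legendre s] by blast
    then have \<sigma>: "\<sigma> \<in> sections_at f x" "\<sigma> x = s" unfolding \<sigma>_def by (rule someI2_ex, blast)+
    obtain \<alpha> \<beta> where s_eq: "s = \<alpha> *\<^sub>R a x + \<beta> *\<^sub>R b x" using s unfolding frame_x(3) span_pair by blast
    have e: "inn eb s = \<beta>" "inn ea s = \<alpha>" using ea eb by (simp_all add: s_eq)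
    have mod: "\<eta> x Z v = \<eta> x Z w" if "v - w \<in> f x" for Z v w
      using D(2)[OF that, of Z] by (simp add: blinfun.diff_right)
    note ds = ddir_section[OF \<sigma>(1), unfolded \<sigma>(2), OF s_eq]
    have "\<eta> x X0 (ddir X0 \<sigma> x) = \<beta> *\<^sub>R \<eta> x X0 wX" "\<eta> x Y0 (ddir X0 \<sigma> x) = 0"
      "\<eta> x X0 (ddir Y0 \<sigma> x) = 0" "\<eta> x Y0 (ddir Y0 \<sigma> x) = \<alpha> *\<^sub>R \<eta> x Y0 wY"
      using mod[OF ds(1)] mod[OF ds(2)] potential_cross[OF \<omega>] by (simp_all add: blinfun.scaleR_right)
    then show ?thesis
      unfolding \<sigma>_def[symmetric] e D(4) ddir_direction_combination[OF sections_atD(1)[OF \<sigma>(1)]]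
      by (simp add: blinfun.add_left blinfun.add_right blinfun.scaleR_left blinfun.scaleR_right algebra_simps)
  qed
  have mem: "(k * k') *\<^sub>R \<eta> x X0 wX \<in> f x" "(l * l') *\<^sub>R \<eta> x Y0 wY \<in> f x"
    by (rule subspace_scale[OF subspace_f D(3)], simp add: perp_f wX wY)+
  have "quad_diff f \<eta> x (k *\<^sub>R X0 + l *\<^sub>R Y0) (k' *\<^sub>R X0 + l' *\<^sub>R Y0) =
      inn eb ((k * k') *\<^sub>R \<eta> x X0 wX) + inn ea ((l * l') *\<^sub>R \<eta> x Y0 wY)"
    unfolding quad_diff_def by (rule trace_on_rank_one_sum[OF subspace_f lin lin mem T])
  then show ?thesis using ea eb by (simp add: X0 Y0)
qed

end

lemma quad_diff_diagonal:
  fixes x :: "'p::smooth_surface"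
  assumes U: "umbilic_free f s1 s2" and \<eta>: "gauge_potential f \<eta>"
  shows "\<exists>X Y q r. (\<forall>k l. k *\<^sub>R X + l *\<^sub>R Y = 0 \<longrightarrow> k = 0 \<and> l = 0) \<and> (\<forall>Z. \<exists>k l. Z = k *\<^sub>R X + l *\<^sub>R Y) \<and>
    (\<forall>k l k' l'. quad_diff f \<eta> x (k *\<^sub>R X + l *\<^sub>R Y) (k' *\<^sub>R X + l' *\<^sub>R Y) = k * k' * q + l * l' * r)"
proof -
  obtain W a b X Y where fr: "adapted_frame f s1 s2 x W a b X Y" using adapted_frame_exists[OF U] by blast
  interpret adapted_frame f s1 s2 x W a b X Y by (rule fr)
  note \<omega> = gauge_potential_at[OF Legendre \<eta>, of x]
  have "\<eta> x X0 wX \<in> f x" "\<eta> x Y0 wY \<in> f x"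
    using potential_atD(3)[OF \<omega>] wX wY by (auto simp: perp_f)
  then obtain p q r t where "\<eta> x X0 wX = p *\<^sub>R a x + q *\<^sub>R b x" "\<eta> x Y0 wY = r *\<^sub>R a x + t *\<^sub>R b x"
    unfolding frame_x(3) span_pair by blast
  from quad_diff_frame[where \<eta>=\<eta>, OF \<omega> this] tangent_basis tangent_independent
  show ?thesis by (intro exI[of _ X0] exI[of _ Y0] exI[of _ q] exI[of _ r]) blast
qed

text \<open>The number of non-zero diagonal entries is determined by the signature, so constant signature makes
  the quadratic differential non-degenerate everywhere and not just on a dense set.\<close>

lemma quad_diff_nondegenerate:
  fixes x :: "'p::smooth_surface"
  assumes U: "umbilic_free f s1 s2" and om: "omega_surface f \<eta>" and sig: "constant_signature f \<eta>"
    and Z: "\<And>Z'. quad_diff f \<eta> x Z Z' = 0"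
  shows "Z = 0"
proof -
  have \<eta>: "gauge_potential f \<eta>" using om by (simp add: omega_surface_def)
  define cnt where "cnt q r = (if q \<noteq> 0 then 1 else 0) + (if r \<noteq> (0::real) then 1 else (0::nat))" for q r :: real
  have sum_index: "fst (form_signature (quad_diff f \<eta> y)) + snd (form_signature (quad_diff f \<eta> y)) = cnt q r"
    if ind: "\<And>k l. k *\<^sub>R X + l *\<^sub>R Y = 0 \<Longrightarrow> k = 0 \<and> l = 0" and spn: "\<And>Z. \<exists>k l. Z = k *\<^sub>R X + l *\<^sub>R Y"
      and Q: "\<And>k l k' l'. quad_diff f \<eta> y (k *\<^sub>R X + l *\<^sub>R Y) (k' *\<^sub>R X + l' *\<^sub>R Y) = k * k' * q + l * l' * r"
    for y X Y q r
  proof -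
    have "pos_index (quad_diff f \<eta> y) = (if q > 0 then 1 else 0) + (if r > 0 then 1 else 0)"
      by (rule pos_index_diagonal[OF ind spn]) (simp_all add: Q power2_eq_square)
    moreover have "pos_index (\<lambda>X Y. - quad_diff f \<eta> y X Y) = (if - q > 0 then 1 else 0) + (if - r > 0 then 1 else 0)"
      by (rule pos_index_diagonal[OF ind spn]) (simp_all add: Q power2_eq_square)
    ultimately show ?thesis by (simp add: form_signature_def cnt_def)
  qed
  obtain D where D: "closure D = UNIV" "\<forall>y\<in>D. \<forall>X. (\<forall>Y. quad_diff f \<eta> y X Y = 0) \<longrightarrow> X = 0"
    using om unfolding omega_surface_def by blast
  then obtain y where y: "y \<in> D" using closure_empty by fastforce
  obtain X Y q r where XY: "\<And>k l. k *\<^sub>R X + l *\<^sub>R Y = 0 \<Longrightarrow> k = 0 \<and> l = 0" "\<And>Z. \<exists>k l. Z = k *\<^sub>R X + l *\<^sub>R Y"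
    "\<And>k l k' l'. quad_diff f \<eta> y (k *\<^sub>R X + l *\<^sub>R Y) (k' *\<^sub>R X + l' *\<^sub>R Y) = k * k' * q + l * l' * r"
    using quad_diff_diagonal[OF U \<eta>, of y] by blast
  have "q \<noteq> 0"
  proof
    assume q: "q = 0"
    have "quad_diff f \<eta> y X Z' = 0" for Z'
    proof -
      obtain k l where "Z' = k *\<^sub>R X + l *\<^sub>R Y" using XY(2) by blast
      then show ?thesis using XY(3)[of 1 0 k l] q by simp
    qed
    then have "X = 0" using D(2) y by blast
    then show False using XY(1)[of 1 0] by simp
  qed
  moreover have "r \<noteq> 0"
  proof
    assume r: "r = 0"
    have "quad_diff f \<eta> y Y Z' = 0" for Z'
    proof -
      obtain k l where "Z' = k *\<^sub>R X + l *\<^sub>R Y" using XY(2) by blast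
      then show ?thesis using XY(3)[of 0 1 k l] r by simp
    qed
    then have "Y = 0" using D(2) y by blast
    then show False using XY(1)[of 0 1] by simp
  qed
  ultimately have two: "cnt q r = 2" by (simp add: cnt_def)
  obtain X' Y' q' r' where XY': "\<And>k l. k *\<^sub>R X' + l *\<^sub>R Y' = 0 \<Longrightarrow> k = 0 \<and> l = 0" "\<And>Z. \<exists>k l. Z = k *\<^sub>R X' + l *\<^sub>R Y'"
    "\<And>k l k' l'. quad_diff f \<eta> x (k *\<^sub>R X' + l *\<^sub>R Y') (k' *\<^sub>R X' + l' *\<^sub>R Y') = k * k' * q' + l * l' * r'"
    using quad_diff_diagonal[OF U \<eta>, of x] by blast
  have "form_signature (quad_diff f \<eta> x) = form_signature (quad_diff f \<eta> y)"
    using sig unfolding constant_signature_def by blast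
  then have "cnt q' r' = 2" using sum_index[OF XY] sum_index[OF XY'] two by simp
  then have nz: "q' \<noteq> 0" "r' \<noteq> 0" by (auto simp: cnt_def split: if_splits)
  obtain k l where kl: "Z = k *\<^sub>R X' + l *\<^sub>R Y'" using XY'(2) by blast
  have "k * q' = 0" "l * r' = 0" using Z[of X'] Z[of Y'] XY'(3)[of k l 1 0] XY'(3)[of k l 0 1] kl by simp_all
  then show ?thesis using nz kl by simp
qed

section \<open>Principal frames\<close>

text \<open>The shape of the middle potential at a point: with \<open>wX\<close> and \<open>wY\<close> spanning \<open>f\<^sup>\<bottom>/f\<close>, it is
  \<open>C b \<and> wX\<close> in the direction \<open>X\<close> and \<open>B a \<and> wY\<close> in the direction \<open>Y\<close>, modulo the exterior square of \<open>f\<close>.\<close>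

locale principal_frame =
  fixes f s1 s2 :: "'p::smooth_surface \<Rightarrow> R42 set" and \<eta> :: "'p o_form" and x :: 'p
    and a b :: "'p \<Rightarrow> R42" and X Y :: "real^2" and wX wY :: R42 and B C :: real
  assumes U: "umbilic_free f s1 s2"
    and sections: "a \<in> sections_at f x" "b \<in> sections_at f x"
    and frame: "s1 x = span {a x}" "s2 x = span {b x}" "f x = span {a x, b x}" "isotropic_frame (a x) (b x)"
    and X: "X \<noteq> 0" and Y: "Y \<noteq> 0" and tangent: "\<exists>k l. Z = k *\<^sub>R X + l *\<^sub>R Y"
    and wX: "inn wX (a x) = 0" "inn wX (b x) = 0" "wX \<notin> f x" "inn wX wX \<noteq> 0"
    and wY: "inn wY (a x) = 0" "inn wY (b x) = 0" "wY \<notin> f x" "inn wY wY \<noteq> 0"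
    and wXY: "inn wX wY = 0"
    and ddir_X: "\<sigma> \<in> sections_at f x \<Longrightarrow> \<sigma> x = \<alpha> *\<^sub>R a x + \<beta> *\<^sub>R b x \<Longrightarrow> ddir X \<sigma> x - \<beta> *\<^sub>R wX \<in> f x"
    and ddir_Y: "\<sigma> \<in> sections_at f x \<Longrightarrow> \<sigma> x = \<alpha> *\<^sub>R a x + \<beta> *\<^sub>R b x \<Longrightarrow> ddir Y \<sigma> x - \<alpha> *\<^sub>R wY \<in> f x"
    and skew: "inn (\<eta> x Z u) v = - inn u (\<eta> x Z v)"
    and \<eta>_X: "\<eta> x X v - (C * inn (b x) v) *\<^sub>R wX \<in> f x"
    and \<eta>_Y: "\<eta> x Y v - (B * inn (a x) v) *\<^sub>R wY \<in> f x"
    and BC: "B \<noteq> 0" "C \<noteq> 0"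

context adapted_frame
begin

text \<open>By skewness the components of \<open>\<eta>m(X) v\<close> along \<open>wX\<close> and \<open>wY\<close> are products of \<open>v\<close> with \<open>\<eta>m(X) wX = q b\<close> and
  \<open>\<eta>m(X) wY = 0\<close>. If \<open>q\<close> vanished, \<open>X\<close> would be in the kernel of the quadratic differential.\<close>

lemma middle_potential_direction:
  assumes om: "omega_surface f \<eta>" and sig: "constant_signature f \<eta>"
    and mid: "middle_potential f s1 s2 \<eta> \<eta>m"
  shows "\<exists>C. C \<noteq> 0 \<and> (\<forall>v. \<eta>m x X0 v - (C * inn (b x) v) *\<^sub>R wX \<in> f x)"
proof -
  have \<eta>: "gauge_potential f \<eta>" using om by (simp add: omega_surface_def)
  note m = middle_potential_frame[OF \<eta> mid]
  note \<omega> = gauge_potential_at[OF Legendre \<eta>, of x]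
  obtain q where q: "\<eta>m x X0 wX = q *\<^sub>R b x" using m(2) unfolding span_single by blast
  obtain p where "\<eta> x X0 wX - \<eta>m x X0 wX = p *\<^sub>R a x" using m(3) unfolding span_single by blast
  then have pq: "\<eta> x X0 wX = p *\<^sub>R a x + q *\<^sub>R b x" using q by (simp add: algebra_simps)
  have "\<eta> x Y0 wY \<in> f x" using potential_atD(3)[OF \<omega>] wY by (auto simp: perp_f)
  then obtain r t where rt: "\<eta> x Y0 wY = r *\<^sub>R a x + t *\<^sub>R b x" unfolding frame_x(3) span_pair by blast
  have "q \<noteq> 0"
  proof
    assume q0: "q = 0"
    have "quad_diff f \<eta> x X0 Z' = 0" for Z'
    proof -
      obtain k l where "Z' = k *\<^sub>R X0 + l *\<^sub>R Y0" using tangent_basis by blast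
      then show ?thesis using quad_diff_frame[where \<eta>=\<eta> and k=1 and l=0 and k'=k and l'=l, OF \<omega> pq rt] q0 by simp
    qed
    then have "X0 = 0" by (rule quad_diff_nondegenerate[OF U om sig])
    then show False using X0_curvature(2) by simp
  qed
  have "\<eta>m x X0 v - ((- q / inn wX wX) * inn (b x) v) *\<^sub>R wX \<in> f x" for v
  proof -
    let ?u = "\<eta>m x X0 v"
    note D = potential_atD[OF m(1)]
    have "a x \<in> f x" "b x \<in> f x" unfolding frame_x(3) by (simp_all add: span_base)
    then have 1: "inn ?u (a x) = 0" "inn ?u (b x) = 0" using D(2) by (simp_all add: D(1))
    have 2: "inn ?u wX = - q * inn (b x) v" "inn ?u wY = 0"
      using potential_cross[OF m(1)] D(1)[of X0 v wX] D(1)[of X0 v wY] inn_commute[of v "b x"] by (simp_all add: q)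
    show ?thesis
      using perp_plane_expansion[OF frame_x(4) 1 wX(1,2,4) wY(1,2,4) wXY] unfolding 2 frame_x(3) by simp
  qed
  then show ?thesis using \<open>q \<noteq> 0\<close> wX(4) by (intro exI[of _ "- q / inn wX wX"]) simp
qed

end

text \<open>The middle condition is symmetric in the curvature spheres, so the previous lemma applies to both
  directions.\<close>

lemma principal_frame_exists:
  fixes x :: "'p::smooth_surface"
  assumes U: "umbilic_free f s1 s2" and om: "omega_surface f \<eta>" and sig: "constant_signature f \<eta>"
    and mid: "middle_potential f s1 s2 \<eta> \<eta>m"
  obtains a b X Y wX wY B C where "principal_frame f s1 s2 \<eta>m x a b X Y wX wY B C"
proof -
  obtain W a b X Y where fr: "adapted_frame f s1 s2 x W a b X Y" using adapted_frame_exists[OF U] by blast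
  interpret adapted_frame f s1 s2 x W a b X Y by (rule fr)
  interpret s: adapted_frame f s2 s1 x W b a Y X by (rule swap_frame)
  have mid': "middle_potential f s2 s1 \<eta> \<eta>m"
    unfolding middle_potential_def Let_def
  proof (intro conjI allI)
    show "\<eta>m \<in> gauge_orbit f \<eta>" using mid by (simp add: middle_potential_def)
    fix y Z
    let ?S1 = "second_osculating s1 (\<lambda>y. curvature_space f y (s2 y)) y"
    let ?S2 = "second_osculating s2 (\<lambda>y. curvature_space f y (s1 y)) y"
    obtain \<alpha>1 \<beta> \<alpha>2 where "\<eta>m y Z = \<alpha>1 + \<beta> + \<alpha>2" "\<alpha>1 \<in> wedge_space ?S1 ?S1" "\<beta> \<in> wedge_space ?S1 ?S2"
      "\<alpha>2 \<in> wedge_space ?S2 ?S2" "\<beta> \<in> wedge_space (f y) (f y)"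
      using mid unfolding middle_potential_def Let_def by meson
    then show "\<exists>\<alpha>1 \<beta> \<alpha>2. \<eta>m y Z = \<alpha>1 + \<beta> + \<alpha>2 \<and> \<alpha>1 \<in> wedge_space ?S2 ?S2 \<and> \<beta> \<in> wedge_space ?S2 ?S1 \<and>
        \<alpha>2 \<in> wedge_space ?S1 ?S1 \<and> \<beta> \<in> wedge_space (f y) (f y)"
      using wedge_space_commute[of ?S1 ?S2] by (intro exI[of _ \<alpha>2] exI[of _ \<beta>] exI[of _ \<alpha>1]) (simp add: algebra_simps)
  qed
  obtain C where C: "C \<noteq> 0" "\<And>v. \<eta>m x X0 v - (C * inn (b x) v) *\<^sub>R wX \<in> f x"
    using middle_potential_direction[OF om sig mid] by blast
  obtain B where B: "B \<noteq> 0" "\<And>v. \<eta>m x Y0 v - (B * inn (a x) v) *\<^sub>R wY \<in> f x"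
    using s.middle_potential_direction[OF om sig mid'] by blast
  have \<eta>: "gauge_potential f \<eta>" using om by (simp add: omega_surface_def)
  have "principal_frame f s1 s2 \<eta>m x a b X0 Y0 wX wY B C"
    by (rule principal_frame.intro)
      (use U section_a section_b frame_x X0_curvature(2) Y0_curvature(2) tangent_basis wX wY wXY ddir_section
        potential_atD(1)[OF middle_potential_frame(1)[OF \<eta> mid]] B C in blast)+
  then show ?thesis by (rule that)
qed

section \<open>Linear Weingarten surfaces in terms of curvature spheres\<close>

lemma inn_constant_derivative:
  assumes "diff_at g x" "\<And>y. inn (g y) v = r"
  shows "inn (ddir Z g x) v = 0"
proof -
  have "ddir Z (\<lambda>y. inn (g y) v) x = inn (g x) (ddir Z (\<lambda>y. v) x) + inn (ddir Z g x) v"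
    by (rule ddir_bilinear[OF bounded_bilinear_inn assms(1) diff_at_const])
  then show ?thesis using assms(2) by simp
qed

lemma smooth_map_on_inn:
  "open W \<Longrightarrow> smooth_map_on W g \<Longrightarrow> smooth_map_on W h \<Longrightarrow> smooth_map_on W (\<lambda>y. inn (g y) (h y))"
  using smooth_map_on_bilinear[OF _ bounded_bilinear_inn] .

lemma smooth_map_on_scaleR:
  "open W \<Longrightarrow> smooth_map_on W r \<Longrightarrow> smooth_map_on W h \<Longrightarrow> smooth_map_on W (\<lambda>y. r y *\<^sub>R h y)"
  using smooth_map_on_bilinear[OF _ bounded_bilinear_scaleR] .

lemma smooth_map_on_mult:
  fixes g h :: "'p::smooth_surface \<Rightarrow> real"
  shows "open W \<Longrightarrow> smooth_map_on W g \<Longrightarrow> smooth_map_on W h \<Longrightarrow> smooth_map_on W (\<lambda>y. g y * h y)"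
  using smooth_map_on_bilinear[OF _ bounded_bilinear_mult] .

lemma smooth_map_on_diff:
  fixes g h :: "'p::smooth_surface \<Rightarrow> 'b::real_normed_vector"
  assumes "open W" "smooth_map_on W g" "smooth_map_on W h"
  shows "smooth_map_on W (\<lambda>y. g y - h y)"
  using smooth_map_on_add[OF assms(1,2) smooth_map_on_scaleR[OF assms(1) smooth_map_on_const[of W "-1"] assms(3)]]
  by simp

text \<open>If \<open>qq\<close> and \<open>pp\<close> separate the points of every plane of \<open>f\<close>, then a section of \<open>f\<close> may be prescribed
  by its products with them; smoothness is Cramer's rule in a local frame.\<close>

lemma dual_section:
  fixes f :: "'p::smooth_surface \<Rightarrow> R42 set"
  assumes U: "umbilic_free f s1 s2"
    and N: "\<And>x v. v \<in> f x \<Longrightarrow> inn v qq = 0 \<Longrightarrow> inn v pp = 0 \<Longrightarrow> v = 0"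
  shows "\<exists>\<sigma>. smooth_map_on UNIV \<sigma> \<and> (\<forall>x. \<sigma> x \<in> f x \<and> inn (\<sigma> x) qq = r \<and> inn (\<sigma> x) pp = t)"
proof -
  let ?P = "\<lambda>x v. v \<in> f x \<and> inn v qq = r \<and> inn v pp = t"
  note sub = legendre_subspace[OF umbilic_free_legendre[OF U]]
  have unique: "v = w" if "?P x v" "?P x w" for x v w
    using N[of "v - w" x] that subspace_diff[OF sub] by auto
  have local: "\<exists>V h. open V \<and> x \<in> V \<and> smooth_map_on V h \<and> (\<forall>y\<in>V. ?P y (h y))" for x
  proof -
    obtain V a b where V: "open V" "x \<in> V" "smooth_map_on V a" "smooth_map_on V b"
      "\<And>y. y \<in> V \<Longrightarrow> s1 y = span {a y} \<and> s2 y = span {b y} \<and> f y = span {a y, b y} \<and> isotropic_frame (a y) (b y)"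
      using umbilic_free_frame_exists[OF U, of x] by blast
    define D where "D y = inn (a y) qq * inn (b y) pp - inn (b y) qq * inn (a y) pp" for y
    have D: "D y \<noteq> 0" if y: "y \<in> V" for y
    proof
      assume D0: "D y = 0"
      note fr = V(5)[OF y]
      have f: "p *\<^sub>R a y + q *\<^sub>R b y \<in> f y" for p q using fr by (auto simp: span_pair)
      have "inn (b y) pp *\<^sub>R a y + (- inn (a y) pp) *\<^sub>R b y = 0"
        by (rule N[OF f]) (use D0 in \<open>simp_all add: D_def algebra_simps\<close>)
      then have "inn (a y) pp = 0" using fr unfolding isotropic_frame_def by fastforce
      moreover have "inn (b y) qq *\<^sub>R a y + (- inn (a y) qq) *\<^sub>R b y = 0"
        by (rule N[OF f]) (use D0 in \<open>simp_all add: D_def algebra_simps\<close>)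
      then have "inn (a y) qq = 0" using fr unfolding isotropic_frame_def by fastforce
      ultimately have "a y = 0" using f[of 1 0] by (intro N) simp_all
      then show False using isotropic_frame_nonzero fr by blast
    qed
    define h where "h y = ((r * inn (b y) pp - t * inn (b y) qq) * inverse (D y)) *\<^sub>R a y +
      ((t * inn (a y) qq - r * inn (a y) pp) * inverse (D y)) *\<^sub>R b y" for y
    note i = smooth_map_on_inn[OF V(1) V(3) smooth_map_on_const] smooth_map_on_inn[OF V(1) V(4) smooth_map_on_const]
    have Ds: "smooth_map_on V D"
      unfolding D_def by (intro smooth_map_on_diff smooth_map_on_mult i V(1))
    have "smooth_map_on V h"
      unfolding h_def
      by (intro smooth_map_on_add smooth_map_on_scaleR smooth_map_on_mult smooth_map_on_diff i V(1,3,4)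
          smooth_map_on_inverse Ds smooth_map_on_const D)
    moreover have "?P y (h y)" if y: "y \<in> V" for y
    proof (intro conjI)
      show "h y \<in> f y" using V(5)[OF y] unfolding h_def by (auto simp: span_pair)
      have e: "D y * inverse (D y) = 1" using D[OF y] by simp
      have "inn (h y) qq = r * (D y * inverse (D y))" "inn (h y) pp = t * (D y * inverse (D y))"
        unfolding h_def by (simp_all add: D_def[of y] algebra_simps)
      then show "inn (h y) qq = r" "inn (h y) pp = t" unfolding e by simp_all
    qed
    ultimately show ?thesis using V(1,2) by blast
  qed
  define \<sigma> where "\<sigma> x = (THE v. ?P x v)" for x
  have \<sigma>: "\<sigma> x = v" if "?P x v" for x v
    unfolding \<sigma>_def using that unique by (intro the_equality) blast+
  have "smooth_map_on UNIV \<sigma>"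
  proof (rule smooth_map_on_local[OF open_UNIV])
    fix x
    obtain V h where Vh: "open V" "x \<in> V" "smooth_map_on V h" "\<forall>y\<in>V. ?P y (h y)" using local by meson
    then show "\<exists>V h. open V \<and> x \<in> V \<and> smooth_map_on V h \<and> (\<forall>y\<in>V. \<sigma> y = h y)" using \<sigma> by blast
  qed
  moreover have "?P x (\<sigma> x)" for x
  proof -
    obtain V h where Vh: "open V" "x \<in> V" "smooth_map_on V h" "\<forall>y\<in>V. ?P y (h y)" using local by meson
    then have "?P x (h x)" by blast
    with \<sigma>[OF this] show ?thesis by simp
  qed
  ultimately show ?thesis by blast
qed

text \<open>Where the projection immerses, the principal curvature is the inhomogeneous coordinate of the curvature
  sphere in the frame given by the tangent plane congruence and the projection.\<close>

lemma principal_curvature_sphere: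
  assumes U: "umbilic_free f s1 s2"
    and N: "\<And>v. v \<in> f x \<Longrightarrow> inn v qq = 0 \<Longrightarrow> inn v pp = 0 \<Longrightarrow> v = 0"
    and P: "space_form_projection f qq pp ff tt" and imm: "immersed_at ff x"
  shows "tt x + principal_curvature ff tt x (curvature_space f x (s1 x)) *\<^sub>R ff x \<in> s1 x"
proof -
  let ?T = "curvature_space f x (s1 x)"
  note L = umbilic_free_legendre[OF U]
  note sub = legendre_subspace[OF L]
  have sec: "ff \<in> sections_at f x" "tt \<in> sections_at f x"
    using P unfolding space_form_projection_def sections_at_def by (auto intro!: exI[of _ UNIV])
  have val: "inn (ff y) qq = - 1" "inn (ff y) pp = 0" "inn (tt y) qq = 0" "inn (tt y) pp = - 1"
    "ff y \<in> f y" "tt y \<in> f y" for y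
    using P unfolding space_form_projection_def by blast+
  have dd: "inn (ddir Z ff x) qq = 0" "inn (ddir Z ff x) pp = 0" "inn (ddir Z tt x) qq = 0" "inn (ddir Z tt x) pp = 0"
    for Z
    using inn_constant_derivative[OF sections_atD(1)[OF sec(1)] val(1)] inn_constant_derivative[OF sections_atD(1)[OF sec(1)] val(2)]
      inn_constant_derivative[OF sections_atD(1)[OF sec(2)] val(3)] inn_constant_derivative[OF sections_atD(1)[OF sec(2)] val(4)]
    by auto
  obtain v where v: "v \<in> s1 x" "v \<noteq> 0" using line_generator[OF umbilic_free_sphere(5)[OF U]] .
  have vf: "v \<in> f x" using v(1) umbilic_free_sphere(3)[OF U] by blast
  define \<alpha> \<beta> where "\<alpha> = - inn v pp" and "\<beta> = - inn v qq"
  have "v - (\<alpha> *\<^sub>R tt x + \<beta> *\<^sub>R ff x) = 0"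
    using val by (intro N subspace_diff[OF sub vf] subspace_add[OF sub] subspace_scale[OF sub])
      (simp_all add: \<alpha>_def \<beta>_def)
  then have v_eq: "v = \<alpha> *\<^sub>R tt x + \<beta> *\<^sub>R ff x" by simp
  obtain X where X: "X \<in> ?T" "X \<noteq> 0" using umbilic_free_sphere(6)[OF U] by blast
  have dff: "ddir X ff x \<noteq> 0" using imm X(2) unfolding immersed_at_def by blast
  note sp = umbilic_free_sphere(4)[OF U, of x]
  have "\<alpha> \<noteq> 0"
  proof
    assume "\<alpha> = 0"
    then have "\<beta> \<noteq> 0" "ff x = (1 / \<beta>) *\<^sub>R v" using v(2) v_eq by auto
    then have "ff x \<in> s1 x" using v(1) sp by (simp add: subspace_scale)
    then have "ddir X ff x \<in> f x" using X(1) sec(1) by (simp add: curvature_space_def)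
    then have "ddir X ff x = 0" using dd by (intro N) auto
    then show False using dff by simp
  qed
  define \<kappa> where "\<kappa> = \<beta> / \<alpha>"
  have "tt x + \<kappa> *\<^sub>R ff x = (1 / \<alpha>) *\<^sub>R v"
    using \<open>\<alpha> \<noteq> 0\<close> by (simp add: v_eq \<kappa>_def scaleR_add_right)
  then have mem: "tt x + \<kappa> *\<^sub>R ff x \<in> s1 x" using v(1) sp by (simp add: subspace_scale)
  have zero: "ddir Z tt x + \<kappa> *\<^sub>R ddir Z ff x = 0" if Z: "Z \<in> ?T" for Z
  proof -
    have "ddir Z tt x - (- \<kappa>) *\<^sub>R ddir Z ff x \<in> f x"
      using ddir_along_curvature[OF L Z sec(2,1), of "- \<kappa>"] mem by simp
    then show ?thesis using dd by (intro N) simp_all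
  qed
  have "principal_curvature ff tt x ?T = \<kappa>"
    unfolding principal_curvature_def
  proof (rule the_equality)
    fix \<kappa>' assume "\<forall>X\<in>?T. ddir X tt x + \<kappa>' *\<^sub>R ddir X ff x = 0"
    then have "ddir X tt x + \<kappa>' *\<^sub>R ddir X ff x = 0" using X(1) by blast
    then have "\<kappa>' *\<^sub>R ddir X ff x = \<kappa> *\<^sub>R ddir X ff x" using zero[OF X(1)] by (metis add_left_cancel)
    then show "\<kappa>' = \<kappa>" using dff by simp
  qed (use zero in blast)
  then show ?thesis using mem by simp
qed

text \<open>Consequently the linear Weingarten condition says that the two curvature spheres are conjugate with
  respect to the tensor \<open>W\<close>.\<close>

lemma satisfies_weingartenI:
  assumes U: "umbilic_free f s1 s2"
    and W: "\<And>x u v. u \<in> s1 x \<Longrightarrow> v \<in> s2 x \<Longrightarrow> weingarten_tensor qq pp a b c u v = 0"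
    and N: "\<And>x v. v \<in> f x \<Longrightarrow> inn v qq = 0 \<Longrightarrow> inn v pp = 0 \<Longrightarrow> v = 0"
  shows "satisfies_weingarten f s1 s2 qq pp a b c"
proof -
  have "\<exists>\<sigma>. smooth_map_on UNIV \<sigma> \<and> (\<forall>x. \<sigma> x \<in> f x \<and> inn (\<sigma> x) qq = r \<and> inn (\<sigma> x) pp = t)" for r t
    by (rule dual_section[OF U]) (rule N)
  then obtain ff tt where ff: "smooth_map_on UNIV ff" "\<And>x. ff x \<in> f x \<and> inn (ff x) qq = - 1 \<and> inn (ff x) pp = 0"
    and tt: "smooth_map_on UNIV tt" "\<And>x. tt x \<in> f x \<and> inn (tt x) qq = 0 \<and> inn (tt x) pp = - 1"
    by meson
  have P: "space_form_projection f qq pp ff tt"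
    unfolding space_form_projection_def using ff tt by blast
  have "a * (\<kappa>1 * \<kappa>2) + 2 * b * ((\<kappa>1 + \<kappa>2) / 2) + c = 0"
    if "immersed_at ff x" "\<kappa>1 = principal_curvature ff tt x (curvature_space f x (s1 x))"
      "\<kappa>2 = principal_curvature ff tt x (curvature_space f x (s2 x))" for x \<kappa>1 \<kappa>2
  proof -
    have "tt x + \<kappa>1 *\<^sub>R ff x \<in> s1 x"
      unfolding that(2) by (rule principal_curvature_sphere[OF U _ P that(1)]) (rule N)
    moreover have "tt x + \<kappa>2 *\<^sub>R ff x \<in> s2 x"
      unfolding that(3) by (rule principal_curvature_sphere[OF umbilic_free_commute[OF U] _ P that(1)]) (rule N)
    ultimately have "weingarten_tensor qq pp a b c (tt x + \<kappa>1 *\<^sub>R ff x) (tt x + \<kappa>2 *\<^sub>R ff x) = 0" by (rule W)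
    moreover have "inn qq (ff x) = - 1" "inn pp (ff x) = 0" "inn qq (tt x) = 0" "inn pp (tt x) = - 1"
      using ff(2)[of x] tt(2)[of x] by (simp_all add: inn_commute)
    ultimately show ?thesis by (simp add: weingarten_tensor_def symprod_def)
  qed
  then show ?thesis
    unfolding satisfies_weingarten_def Let_def using P by blast
qed


section \<open>Conserved quantities and Darboux transforms in a principal frame\<close>

text \<open>The coefficients of a quadratic polynomial in \<open>t\<close>, isolated by the values \<open>0\<close>, \<open>1\<close> and \<open>-1\<close>.\<close>

lemma conserved_quantity_equations:
  assumes "linear_conserved_quantity \<eta> \<alpha>"
  shows "ddir Z (fst \<alpha>) x = 0" "ddir Z (snd \<alpha>) x = - \<eta> x Z (fst \<alpha> x)" "\<eta> x Z (snd \<alpha> x) = 0"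
proof -
  have sm: "smooth_map_on UNIV (fst \<alpha>)" "smooth_map_on UNIV (snd \<alpha>)"
    and con: "conn t \<eta> (lp_eval \<alpha> t) x Z = 0" for t
    using assms by (auto simp: linear_conserved_quantity_def)
  have d: "diff_at (fst \<alpha>) x" "diff_at (snd \<alpha>) x" using sm diff_atI open_UNIV UNIV_I by blast+
  have "ddir Z (lp_eval \<alpha> t) x = ddir Z (fst \<alpha>) x + t *\<^sub>R ddir Z (snd \<alpha>) x" for t
    unfolding lp_eval_def using ddir_add[OF d(1) diff_at_scale[OF d(2)]] ddir_scale[OF d(2)] by simp
  then have e: "ddir Z (fst \<alpha>) x + t *\<^sub>R (ddir Z (snd \<alpha>) x + \<eta> x Z (fst \<alpha> x)) + (t * t) *\<^sub>R \<eta> x Z (snd \<alpha> x) = 0" for t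
    using con[of t] by (simp add: conn_def lp_eval_def blinfun.add_right blinfun.scaleR_right algebra_simps)
  show 0: "ddir Z (fst \<alpha>) x = 0" using e[of 0] by simp
  have p: "(ddir Z (snd \<alpha>) x + \<eta> x Z (fst \<alpha> x)) + \<eta> x Z (snd \<alpha> x) = 0"
    and n: "- (ddir Z (snd \<alpha>) x + \<eta> x Z (fst \<alpha> x)) + \<eta> x Z (snd \<alpha> x) = 0"
    using e[of 1] e[of "-1"] 0 by simp_all
  have "2 *\<^sub>R \<eta> x Z (snd \<alpha> x) = 0" using p n by (simp add: scaleR_2 algebra_simps)
  then show "\<eta> x Z (snd \<alpha> x) = 0" by simp
  then show "ddir Z (snd \<alpha>) x = - \<eta> x Z (fst \<alpha> x)" using p by (simp add: add_eq_0_iff2)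
qed

context principal_frame
begin

lemma Legendre: "legendre f" using umbilic_free_legendre[OF U] .

lemma subspace_f: "subspace (f x)" using legendre_subspace[OF Legendre] .

lemma inn_frame: "inn (a x) (a x) = 0" "inn (a x) (b x) = 0" "inn (b x) (a x) = 0" "inn (b x) (b x) = 0"
  using frame(4) by (auto simp: isotropic_frame_def inn_commute)

lemma wX_perp: "s \<in> f x \<Longrightarrow> inn s wX = 0" and wY_perp: "s \<in> f x \<Longrightarrow> inn s wY = 0"
  unfolding frame(3) span_pair using wX(1,2) wY(1,2) by (auto simp: inn_commute)

lemma multiple_wX: "r *\<^sub>R wX \<in> f x \<Longrightarrow> r = 0" and multiple_wY: "r *\<^sub>R wY \<in> f x \<Longrightarrow> r = 0"
  using wX_perp[of "r *\<^sub>R wX"] wY_perp[of "r *\<^sub>R wY"] wX(4) wY(4) by auto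

text \<open>The normal form of \<open>\<eta>\<close> gives \<open>(a,v) = (b,v) = 0\<close>. By skewness \<open>v\<close> is also orthogonal to the image of \<open>\<eta>\<close>, which
  contains \<open>wX\<close> and \<open>wY\<close> modulo \<open>f\<close>.\<close>

lemma conserved_in_plane:
  assumes v: "\<And>Z. \<eta> x Z v = 0"
  shows "v \<in> f x"
proof -
  have "(- (C * inn (b x) v)) *\<^sub>R wX \<in> f x" "(- (B * inn (a x) v)) *\<^sub>R wY \<in> f x"
    using \<eta>_X[of v] \<eta>_Y[of v] v by simp_all
  then have ab: "inn v (a x) = 0" "inn v (b x) = 0"
    using multiple_wX multiple_wY BC by (fastforce simp: inn_commute)+
  have fv: "inn s v = 0" if "s \<in> f x" for s
    using that ab unfolding frame(3) span_pair by (auto simp: inn_commute)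
  obtain e where e: "inn e (a x) = 1" using dual_frame[OF frame(4)] by blast
  have "isotropic_frame (b x) (a x)" using frame(4) isotropic_frame_commute by blast
  then obtain e' where e': "inn e' (b x) = 1" using dual_frame by blast
  have "inn (\<eta> x X e') v = 0" "inn (\<eta> x Y e) v = 0" using v by (simp_all add: skew)
  then have "C * inn wX v = 0" "B * inn wY v = 0"
    using fv[OF \<eta>_X[of e']] fv[OF \<eta>_Y[of e]] e e' by (simp_all add: inn_commute)
  then have "inn v wX = 0" "inn v wY = 0" using BC by (simp_all add: inn_commute)
  then show ?thesis
    using perp_plane_expansion[OF frame(4) ab wX(1,2,4) wY(1,2,4) wXY] unfolding frame(3) by simp
qed

text \<open>Compare the \<open>wX\<close>- and \<open>wY\<close>-components of \<open>dp\<close> and \<open>- \<eta> v\<close>.\<close>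

lemma conserved_expansion:
  assumes p: "p \<in> sections_at f x" and d: "\<And>Z. ddir Z p x = - \<eta> x Z v"
  shows "p x = - ((B * inn (a x) v) *\<^sub>R a x) - (C * inn (b x) v) *\<^sub>R b x"
proof -
  obtain \<alpha> \<beta> where ab: "p x = \<alpha> *\<^sub>R a x + \<beta> *\<^sub>R b x"
    using sections_atD(2)[OF p] unfolding frame(3) span_pair by blast
  have "(ddir X p x - \<beta> *\<^sub>R wX) + (\<eta> x X v - (C * inn (b x) v) *\<^sub>R wX) \<in> f x"
    by (rule subspace_add[OF subspace_f ddir_X[OF p ab] \<eta>_X])
  then have "(- (\<beta> + C * inn (b x) v)) *\<^sub>R wX \<in> f x" unfolding d by (simp add: algebra_simps)
  then have "\<beta> = - (C * inn (b x) v)" using multiple_wX by fastforce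
  moreover have "(ddir Y p x - \<alpha> *\<^sub>R wY) + (\<eta> x Y v - (B * inn (a x) v) *\<^sub>R wY) \<in> f x"
    by (rule subspace_add[OF subspace_f ddir_Y[OF p ab] \<eta>_Y])
  then have "(- (\<alpha> + B * inn (a x) v)) *\<^sub>R wY \<in> f x" unfolding d by (simp add: algebra_simps)
  then have "\<alpha> = - (B * inn (a x) v)" using multiple_wY by fastforce
  ultimately show ?thesis by (simp add: ab)
qed

text \<open>The curvature spheres of a Darboux transform. Modulo \<open>f + sh\<close> the derivatives of a section \<open>\<sigma>\<close> of \<open>sh\<close>
  and of the section \<open>\<rho> = (b,\<sigma>) a - (a,\<sigma>) b\<close> of \<open>f \<inter> sh\<^sup>\<bottom>\<close> are multiples of \<open>wX\<close> along \<open>X\<close> and of \<open>wY\<close> along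
  \<open>Y\<close>, so in each of the two directions one combination is killed. The two combinations cannot agree, for then
  both directions would belong to one curvature sphere.\<close>

lemma darboux_spheres:
  assumes dt: "darboux_transform f \<eta> m sh fh" and Uh: "umbilic_free fh t1 t2"
  obtains \<sigma> where "\<sigma> \<in> sh x" "fh x = span {\<sigma>, inn (b x) \<sigma> *\<^sub>R a x - inn (a x) \<sigma> *\<^sub>R b x}"
    "inn (a x) \<sigma> \<noteq> 0" "inn (b x) \<sigma> \<noteq> 0" "B * (inn (a x) \<sigma>)^2 + C * (inn (b x) \<sigma>)^2 \<noteq> 0"
    "{t1 x, t2 x} =
      {span {inn (a x) \<sigma> *\<^sub>R \<sigma> - (m * C * inn (b x) \<sigma>) *\<^sub>R (inn (b x) \<sigma> *\<^sub>R a x - inn (a x) \<sigma> *\<^sub>R b x)},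
       span {inn (b x) \<sigma> *\<^sub>R \<sigma> + (m * B * inn (a x) \<sigma>) *\<^sub>R (inn (b x) \<sigma> *\<^sub>R a x - inn (a x) \<sigma> *\<^sub>R b x)}}"
proof -
  have sh: "subbundle 1 sh" and iso: "\<And>u v. u \<in> sh x \<Longrightarrow> v \<in> sh x \<Longrightarrow> inn u v = 0"
    and par: "\<And>\<sigma> Z. \<sigma> \<in> sections_at sh x \<Longrightarrow> conn m \<eta> \<sigma> x Z \<in> sh x"
    and no: "\<And>s. curvature_sphere f x s \<Longrightarrow> \<not> s \<subseteq> perp (sh x)"
    and fh: "\<And>y. fh y = {u + v | u v. u \<in> f y \<inter> perp (sh y) \<and> v \<in> sh y}"
    using dt unfolding darboux_transform_def isotropic_bundle_def by blast+
  obtain V \<sigma> where V: "open V" "x \<in> V" "smooth_map_on V \<sigma>" "\<And>y. y \<in> V \<Longrightarrow> sh y = span {\<sigma> y} \<and> \<sigma> y \<noteq> 0"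
    using subbundle_line_frame[OF sh] by blast
  have shx: "sh x = span {\<sigma> x}" using V(2,4) by blast
  have \<sigma>: "\<sigma> \<in> sections_at sh x" "\<sigma> x \<in> sh x"
    unfolding sections_at_def using V by (auto intro!: exI[of _ V] span_base)
  define h1 h2 where "h1 y = inn (a y) (\<sigma> y)" and "h2 y = inn (b y) (\<sigma> y)" for y
  have psh: "v \<in> perp (sh y)" if "y \<in> V" "inn v (\<sigma> y) = 0" for v y
    using V(4)[OF that(1)] that(2) by (auto simp: perp_def span_single)
  have h: "h1 x \<noteq> 0" "h2 x \<noteq> 0"
    using no[OF umbilic_free_sphere(2)[OF U]] no[OF umbilic_free_sphere2(2)[OF U]]
    unfolding frame(1,2) h1_def h2_def by (auto simp: span_single intro!: psh[OF V(2)])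
  define \<rho> where "\<rho> y = h2 y *\<^sub>R a y - h1 y *\<^sub>R b y" for y
  obtain Va where Va: "open Va" "x \<in> Va" "smooth_map_on Va a" "\<And>y. y \<in> Va \<Longrightarrow> a y \<in> f y"
    using sections(1) unfolding sections_at_def by blast
  obtain Vb where Vb: "open Vb" "x \<in> Vb" "smooth_map_on Vb b" "\<And>y. y \<in> Vb \<Longrightarrow> b y \<in> f y"
    using sections(2) unfolding sections_at_def by blast
  define N where "N = V \<inter> Va \<inter> Vb"
  have N: "open N" "x \<in> N" using V Va Vb by (auto simp: N_def intro!: open_Int)
  have sm: "smooth_map_on N a" "smooth_map_on N b" "smooth_map_on N \<sigma>"
    using V(3) Va(3) Vb(3) by (auto simp: N_def intro: smooth_map_on_subset)
  have hs: "smooth_map_on N h1" "smooth_map_on N h2"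
    unfolding h1_def h2_def by (intro smooth_map_on_inn N(1) sm)+
  have \<rho>s: "smooth_map_on N \<rho>"
    unfolding \<rho>_def by (intro smooth_map_on_diff smooth_map_on_scaleR N(1) sm hs)
  have subf: "subspace (f y)" for y using legendre_subspace[OF Legendre] .
  have zero_fh: "0 \<in> f y \<inter> perp (sh y)" "0 \<in> sh y" for y
    using subf subbundle_subspace[OF sh] by (auto intro: subspace_0 simp: perp_def)
  have fhI: "u + v \<in> fh y" if "u \<in> f y" "u \<in> perp (sh y)" "v \<in> sh y" for u v y
    unfolding fh using that by blast
  have \<rho>f: "\<rho> y \<in> f y" "\<rho> y \<in> fh y" "\<sigma> y \<in> fh y" if y: "y \<in> N" for y
  proof -
    show 1: "\<rho> y \<in> f y"
      unfolding \<rho>_def using Va(4) Vb(4) y by (intro subspace_diff[OF subf] subspace_scale[OF subf]) (auto simp: N_def)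
    have "\<rho> y \<in> perp (sh y)"
      using y by (intro psh) (auto simp: N_def \<rho>_def h1_def h2_def)
    then show "\<rho> y \<in> fh y" using fhI[OF 1 _ zero_fh(2)] by simp
    have "\<sigma> y \<in> sh y" using V(4)[of y] y by (auto simp: N_def span_base)
    then show "\<sigma> y \<in> fh y" using fhI[of 0 y "\<sigma> y"] zero_fh(1) by simp
  qed
  have sec: "\<sigma> \<in> sections_at fh x" "\<rho> \<in> sections_at fh x" "\<rho> \<in> sections_at f x"
    unfolding sections_at_def using N sm \<rho>s \<rho>f by (auto intro!: exI[of _ N])
  note subh = legendre_subspace[OF umbilic_free_legendre[OF Uh]]
  \<comment> \<open>Derivatives modulo the three-dimensional space \<open>f + sh\<close>.\<close>
  define E where "E = {u + v | u v. u \<in> f x \<and> v \<in> sh x}"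
  have subE: "subspace E"
    unfolding E_def by (rule subspace_sums[OF subspace_f subbundle_subspace[OF sh]])
  have EI: "u + v \<in> E" if "u \<in> f x" "v \<in> sh x" for u v
    unfolding E_def using that by blast
  have fE: "u \<in> f x \<Longrightarrow> u \<in> E" "v \<in> sh x \<Longrightarrow> v \<in> E" for u v
    using EI[of u 0] EI[of 0 v] zero_fh[of x] by simp_all
  have d\<sigma>: "ddir Z \<sigma> x + m *\<^sub>R \<eta> x Z (\<sigma> x) \<in> E" for Z
    using fE(2)[OF par[OF \<sigma>(1), of Z]] by (simp add: conn_def)
  have \<rho>x: "\<rho> x = h2 x *\<^sub>R a x + (- h1 x) *\<^sub>R b x" by (simp add: \<rho>_def)
  have X\<sigma>: "ddir X \<sigma> x + (m * C * h2 x) *\<^sub>R wX \<in> E"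
  proof -
    have "(ddir X \<sigma> x + m *\<^sub>R \<eta> x X (\<sigma> x)) - m *\<^sub>R (\<eta> x X (\<sigma> x) - (C * inn (b x) (\<sigma> x)) *\<^sub>R wX) \<in> E"
      by (intro subspace_diff[OF subE] subspace_scale[OF subE] d\<sigma> fE(1) \<eta>_X)
    then show ?thesis by (simp add: h2_def algebra_simps)
  qed
  have Y\<sigma>: "ddir Y \<sigma> x + (m * B * h1 x) *\<^sub>R wY \<in> E"
  proof -
    have "(ddir Y \<sigma> x + m *\<^sub>R \<eta> x Y (\<sigma> x)) - m *\<^sub>R (\<eta> x Y (\<sigma> x) - (B * inn (a x) (\<sigma> x)) *\<^sub>R wY) \<in> E"
      by (intro subspace_diff[OF subE] subspace_scale[OF subE] d\<sigma> fE(1) \<eta>_Y)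
    then show ?thesis by (simp add: h1_def algebra_simps)
  qed
  have X\<rho>: "ddir X \<rho> x + h1 x *\<^sub>R wX \<in> E" and Y\<rho>: "ddir Y \<rho> x - h2 x *\<^sub>R wY \<in> E"
    using fE(1)[OF ddir_X[OF sec(3) \<rho>x]] fE(1)[OF ddir_Y[OF sec(3) \<rho>x]] by simp_all
  have E_fh: "v \<in> fh x" if v: "v \<in> E" "v \<in> perp (fh x)" for v
  proof -
    obtain u w where uw: "v = u + w" "u \<in> f x" "w \<in> sh x" using v(1) unfolding E_def by blast
    have "inn v (\<sigma> x) = 0" using v(2) \<rho>f(3)[OF N(2)] by (simp add: perp_def)
    then have "inn u (\<sigma> x) = 0" using iso[OF uw(3) \<sigma>(2)] uw(1) by simp
    then have "u \<in> perp (sh x)" by (rule psh[OF V(2)])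
    then show ?thesis unfolding fh using uw by blast
  qed
  have in_fh: "ddir Z \<tau> x \<in> fh x" if "\<tau> \<in> sections_at fh x" "ddir Z \<tau> x \<in> E" for Z \<tau>
    using E_fh[OF that(2)] legendre_contact[OF umbilic_free_legendre[OF Uh] that(1)] by (simp add: perp_def)
  \<comment> \<open>The coefficients are frozen at \<open>x\<close>, so that no derivatives of them appear.\<close>
  define \<tau>1 where "\<tau>1 y = h1 x *\<^sub>R \<sigma> y - (m * C * h2 x) *\<^sub>R \<rho> y" for y
  define \<tau>2 where "\<tau>2 y = h2 x *\<^sub>R \<sigma> y - (- (m * B * h1 x)) *\<^sub>R \<rho> y" for y
  have \<tau>: "\<tau>1 \<in> sections_at fh x" "\<tau>2 \<in> sections_at fh x"
    unfolding \<tau>1_def[abs_def] \<tau>2_def[abs_def]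
    by (rule section_difference(1)[OF subh sections_at_scale[OF subh sec(1)] sec(2)])+
  have d\<tau>1: "ddir Z \<tau>1 x = h1 x *\<^sub>R ddir Z \<sigma> x - (m * C * h2 x) *\<^sub>R ddir Z \<rho> x"
    and d\<tau>2: "ddir Z \<tau>2 x = h2 x *\<^sub>R ddir Z \<sigma> x - (- (m * B * h1 x)) *\<^sub>R ddir Z \<rho> x" for Z
    unfolding \<tau>1_def[abs_def] \<tau>2_def[abs_def]
      section_difference(2)[OF subh sections_at_scale[OF subh sec(1)] sec(2)]
      ddir_scale[OF sections_atD(1)[OF sec(1)]] by simp_all
  have "h1 x *\<^sub>R (ddir X \<sigma> x + (m * C * h2 x) *\<^sub>R wX) - (m * C * h2 x) *\<^sub>R (ddir X \<rho> x + h1 x *\<^sub>R wX) \<in> E"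
    by (intro subspace_diff[OF subE] subspace_scale[OF subE] X\<sigma> X\<rho>)
  then have "ddir X \<tau>1 x \<in> E" unfolding d\<tau>1 by (simp add: algebra_simps)
  then have X1: "ddir X \<tau>1 x \<in> fh x" by (rule in_fh[OF \<tau>(1)])
  have "h2 x *\<^sub>R (ddir Y \<sigma> x + (m * B * h1 x) *\<^sub>R wY) - (- (m * B * h1 x)) *\<^sub>R (ddir Y \<rho> x - h2 x *\<^sub>R wY) \<in> E"
    by (intro subspace_diff[OF subE] subspace_scale[OF subE] Y\<sigma> Y\<rho>)
  then have "ddir Y \<tau>2 x \<in> E" unfolding d\<tau>2 by (simp add: algebra_simps)
  then have Y2: "ddir Y \<tau>2 x \<in> fh x" by (rule in_fh[OF \<tau>(2)])
  have nz: "\<tau>1 x \<noteq> 0" "\<tau>2 x \<noteq> 0"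
  proof -
    have "inn (a x) (\<tau>1 x) = h1 x * h1 x" "inn (b x) (\<tau>2 x) = h2 x * h2 x"
      by (simp_all add: \<tau>1_def \<tau>2_def \<rho>_def inn_frame h1_def[of x] h2_def[of x])
    then show "\<tau>1 x \<noteq> 0" "\<tau>2 x \<noteq> 0" using h by auto
  qed
  note cs1 = curvature_sphereI[OF Uh \<tau>(1) nz(1) X1] and cs2 = curvature_sphereI[OF Uh \<tau>(2) nz(2) Y2]
  have all: "{s. curvature_sphere fh x s} = {t1 x, t2 x}" and ne: "t1 x \<noteq> t2 x"
    using Uh by (simp_all add: umbilic_free_def)
  have mem: "span {\<tau>1 x} \<in> {t1 x, t2 x}" "span {\<tau>2 x} \<in> {t1 x, t2 x}"
    using cs1(2)[OF X] cs2(2)[OF Y] all by blast+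
  have distinct: "span {\<tau>1 x} \<noteq> span {\<tau>2 x}"
  proof
    assume eq: "span {\<tau>1 x} = span {\<tau>2 x}"
    have full: "Z \<in> curvature_space fh x (span {\<tau>1 x})" for Z
      unfolding curvature_space_def
    proof (intro CollectI ballI impI)
      fix \<sigma>' assume s: "\<sigma>' \<in> sections_at fh x" "\<sigma>' x \<in> span {\<tau>1 x}"
      obtain k l where Z: "Z = k *\<^sub>R X + l *\<^sub>R Y" using tangent by blast
      have "ddir X \<sigma>' x \<in> fh x" "ddir Y \<sigma>' x \<in> fh x"
        using cs1(1) cs2(1) s unfolding eq[symmetric] by (simp_all add: curvature_space_def)
      then show "ddir Z \<sigma>' x \<in> fh x"
        unfolding Z ddir_direction_combination[OF sections_atD(1)[OF s(1)]]
        by (intro subspace_add[OF subh] subspace_scale[OF subh])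
    qed
    obtain Z where Z: "Z \<in> curvature_space fh x (t1 x)" "Z \<noteq> 0" using umbilic_free_sphere(6)[OF Uh] by blast
    obtain Z' where Z': "Z' \<in> curvature_space fh x (t2 x)" "Z' \<noteq> 0" using umbilic_free_sphere2(6)[OF Uh] by blast
    from mem(1) have "span {\<tau>1 x} = t1 x \<or> span {\<tau>1 x} = t2 x" by blast
    then show False
    proof
      assume "span {\<tau>1 x} = t1 x"
      then show False using curvature_spaces_disjoint[OF Uh _ Z'(1)] full Z'(2) by simp
    next
      assume "span {\<tau>1 x} = t2 x"
      then show False using curvature_spaces_disjoint[OF Uh Z(1)] full Z(2) by simp
    qed
  qed
  have det: "B * (h1 x)^2 + C * (h2 x)^2 \<noteq> 0"
  proof
    assume z: "B * (h1 x)^2 + C * (h2 x)^2 = 0"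
    have "h1 x *\<^sub>R \<tau>2 x - h2 x *\<^sub>R \<tau>1 x = (m * (B * (h1 x)^2 + C * (h2 x)^2)) *\<^sub>R \<rho> x"
      by (simp add: \<tau>1_def \<tau>2_def algebra_simps power2_eq_square)
    then have "h1 x *\<^sub>R \<tau>2 x = h2 x *\<^sub>R \<tau>1 x" using z by simp
    then have "\<tau>2 x = (h2 x / h1 x) *\<^sub>R \<tau>1 x"
      using h(1) by (metis divide_inverse_commute inverse_eq_divide scaleR_scaleR left_inverse scaleR_one)
    then have "\<tau>2 x \<in> span {\<tau>1 x}" by (simp add: span_scale span_base)
    then have "span {\<tau>1 x} = span {\<tau>2 x}"
      using line_eq_span[OF subspace_span dim_span_line[OF nz(1)]] nz(2) by blast
    then show False using distinct by simp
  qed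
  have pair: "{t1 x, t2 x} = {span {\<tau>1 x}, span {\<tau>2 x}}" using mem distinct ne by auto
  have plane: "fh x = span {\<sigma> x, \<rho> x}"
  proof
    show "span {\<sigma> x, \<rho> x} \<subseteq> fh x" using \<rho>f[OF N(2)] by (intro span_minimal subh) auto
    show "fh x \<subseteq> span {\<sigma> x, \<rho> x}"
    proof
      fix v assume "v \<in> fh x"
      then obtain u w where uw: "v = u + w" "u \<in> f x" "u \<in> perp (sh x)" "w \<in> sh x" unfolding fh by blast
      obtain k where k: "w = k *\<^sub>R \<sigma> x" using uw(4) unfolding shx span_single by blast
      obtain p q where pq: "u = p *\<^sub>R a x + q *\<^sub>R b x" using uw(2) unfolding frame(3) span_pair by blast
      have "inn u (\<sigma> x) = 0" using uw(3) \<sigma>(2) by (simp add: perp_def)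
      then have "p * h1 x + q * h2 x = 0" by (simp add: pq h1_def h2_def)
      then have "q = - (p / h2 x) * h1 x" using h(2) by (simp add: field_simps)
      then have "u = (p / h2 x) *\<^sub>R \<rho> x" using h(2) by (simp add: pq \<rho>_def scaleR_diff_right)
      then show "v \<in> span {\<sigma> x, \<rho> x}" unfolding span_pair using uw(1) k by (metis add.commute)
    qed
  qed
  show ?thesis
    using that[of "\<sigma> x"] \<sigma>(2) plane h det pair
    by (simp add: \<tau>1_def \<tau>2_def \<rho>_def h1_def h2_def)
qed

end

section \<open>Conjugacy with respect to the tensor of the conserved quantities\<close>

text \<open>With the entries of a Gram matrix in this arrangement the tensor is its adjugate, the inverse up to
  scale, and a change of basis multiplies it by the square of the determinant.\<close>

lemma weingarten_tensor_change_basis: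
  assumes "qq = k *\<^sub>R p + l *\<^sub>R q" "pp = k' *\<^sub>R p + l' *\<^sub>R q"
  shows "weingarten_tensor qq pp (k'^2 * g11 + 2 * k' * l' * g12 + l'^2 * g22)
      (- (k * k' * g11 + (k * l' + l * k') * g12 + l * l' * g22)) (k^2 * g11 + 2 * k * l * g12 + l^2 * g22) u v =
    (k * l' - l * k')^2 * weingarten_tensor p q g22 (- g12) g11 u v"
proof -
  define pu qu pv qv where "pu = inn p u" and "qu = inn q u" and "pv = inn p v" and "qv = inn q v"
  show ?thesis
    unfolding weingarten_tensor_def symprod_def assms inn_simps
      pu_def[symmetric] qu_def[symmetric] pv_def[symmetric] qv_def[symmetric]
    by (simp add: field_simps power2_eq_square)
qed

lemma proj_class_scale:
  assumes "r \<noteq> 0"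
  shows "proj_class (\<lambda>u v. r * W u v) = proj_class W"
proof -
  have "proj_class (\<lambda>u v. r * W u v) \<subseteq> proj_class W"
  proof
    fix V assume "V \<in> proj_class (\<lambda>u v. r * W u v)"
    then obtain t where "t \<noteq> 0" "V = (\<lambda>u v. (t * r) * W u v)" by (auto simp: proj_class_def mult.assoc)
    then show "V \<in> proj_class W" using assms unfolding proj_class_def by (intro CollectI exI[of _ "t * r"]) simp
  qed
  moreover have "proj_class W \<subseteq> proj_class (\<lambda>u v. r * W u v)"
  proof
    fix V assume "V \<in> proj_class W"
    then obtain t where t: "t \<noteq> 0" "V = (\<lambda>u v. t * W u v)" by (auto simp: proj_class_def)
    have "V = (\<lambda>u v. (t / r) * (r * W u v))" using assms by (simp add: t)
    then show "V \<in> proj_class (\<lambda>u v. r * W u v)"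
      using assms t(1) unfolding proj_class_def by (intro CollectI exI[of _ "t / r"]) simp
  qed
  ultimately show ?thesis by blast
qed

text \<open>The diagonal of \<open>G\<close> in the covectors of \<open>a\<close> and \<open>b\<close> inverts to a diagonal in the dual basis.\<close>

lemma conjugate_diagonal:
  fixes p q a b :: R42
  assumes G: "g11 = - 2 * (B * inn a p * inn a p + C * inn b p * inn b p)"
    "g12 = - 2 * (B * inn a p * inn a q + C * inn b p * inn b q)"
    "g22 = - 2 * (B * inn a q * inn a q + C * inn b q * inn b q)"
  shows "weingarten_tensor p q g22 (- g12) g11 a b = 0"
proof -
  define ap aq bp bq where "ap = inn a p" and "aq = inn a q" and "bp = inn b p" and "bq = inn b q"
  have c: "inn p a = ap" "inn q a = aq" "inn p b = bp" "inn q b = bq"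
    by (simp_all add: ap_def aq_def bp_def bq_def inn_commute)
  show ?thesis
    unfolding weingarten_tensor_def symprod_def G c
      ap_def[symmetric] aq_def[symmetric] bp_def[symmetric] bq_def[symmetric]
    by (simp add: field_simps)
qed

text \<open>The same for the curvature spheres of the Darboux transform. On \<open>P(0)\<close> the vector \<open>\<sigma>\<close> acts as
  \<open>m (B h1 (a,\<cdot>) + C h2 (b,\<cdot>))\<close>, because \<open>P(m)\<close> is orthogonal to \<open>\<sigma>\<close>.\<close>

lemma conjugate_darboux:
  fixes p q a b \<sigma> :: R42
  assumes G: "g11 = - 2 * (B * inn a p * inn a p + C * inn b p * inn b p)"
    "g12 = - 2 * (B * inn a p * inn a q + C * inn b p * inn b q)"
    "g22 = - 2 * (B * inn a q * inn a q + C * inn b q * inn b q)"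
    and \<sigma>: "inn \<sigma> p = m * (B * h1 * inn a p + C * h2 * inn b p)" "inn \<sigma> q = m * (B * h1 * inn a q + C * h2 * inn b q)"
  shows "weingarten_tensor p q g22 (- g12) g11
    (h1 *\<^sub>R \<sigma> - (m * C * h2) *\<^sub>R (h2 *\<^sub>R a - h1 *\<^sub>R b)) (h2 *\<^sub>R \<sigma> + (m * B * h1) *\<^sub>R (h2 *\<^sub>R a - h1 *\<^sub>R b)) = 0"
proof -
  define ap aq bp bq where "ap = inn a p" and "aq = inn a q" and "bp = inn b p" and "bq = inn b q"
  have c: "inn p a = ap" "inn q a = aq" "inn p b = bp" "inn q b = bq"
    "inn p \<sigma> = m * (B * h1 * ap + C * h2 * bp)" "inn q \<sigma> = m * (B * h1 * aq + C * h2 * bq)"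
    using \<sigma> by (simp_all add: ap_def aq_def bp_def bq_def inn_commute)
  have u: "h1 * (m * (B * h1 * x + C * h2 * y)) - m * C * h2 * (h2 * x - h1 * y) =
      m * ((B * h1^2 - C * h2^2) * x + 2 * C * h1 * h2 * y)"
    and v: "h2 * (m * (B * h1 * x + C * h2 * y)) + m * B * h1 * (h2 * x - h1 * y) =
      m * (2 * B * h1 * h2 * x + (C * h2^2 - B * h1^2) * y)" for x y
    by (simp_all add: algebra_simps power2_eq_square)
  define k1 k2 where "k1 = B * h1^2 - C * h2^2" and "k2 = h1 * h2"
  have k: "C * h2^2 - B * h1^2 = - k1" "2 * C * h1 * h2 = 2 * C * k2" "2 * B * h1 * h2 = 2 * B * k2"
    by (simp_all add: k1_def k2_def)
  show ?thesis
    unfolding weingarten_tensor_def symprod_def inn_simps G c u v k1_def[symmetric] k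
      ap_def[symmetric] aq_def[symmetric] bp_def[symmetric] bq_def[symmetric]
    by (simp add: field_simps)
qed

lemma weingarten_tensor_pair:
  assumes W: "weingarten_tensor qq pp k l r a b = 0" and e: "{s, t} = {span {a}, span {b}}"
    and uv: "u \<in> s" "v \<in> t" and ne: "span {a} \<noteq> span {b}"
  shows "weingarten_tensor qq pp k l r u v = 0"
proof -
  have sym: "weingarten_tensor qq pp k l r v' u' = weingarten_tensor qq pp k l r u' v'" for u' v'
    by (simp add: weingarten_tensor_def symprod_def algebra_simps)
  have sc: "weingarten_tensor qq pp k l r (x *\<^sub>R a) (y *\<^sub>R b) = x * y * weingarten_tensor qq pp k l r a b" for x y
    by (simp add: weingarten_tensor_def symprod_def field_simps)
  have "s = span {a} \<and> t = span {b} \<or> s = span {b} \<and> t = span {a}"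
    using e ne by (metis doubleton_eq_iff)
  then show ?thesis
  proof
    assume "s = span {a} \<and> t = span {b}"
    then have "u \<in> span {a}" "v \<in> span {b}" using uv by simp_all
    then obtain x y where "u = x *\<^sub>R a" "v = y *\<^sub>R b" unfolding span_single by blast
    then show ?thesis using sc W by simp
  next
    assume "s = span {b} \<and> t = span {a}"
    then have "u \<in> span {b}" "v \<in> span {a}" using uv by simp_all
    then obtain x y where "u = y *\<^sub>R b" "v = x *\<^sub>R a" unfolding span_single by blast
    then show ?thesis using sc W sym[of "y *\<^sub>R b" "x *\<^sub>R a"] by simp
  qed
qed

context principal_frame
begin

lemma gram_formula:
  assumes "p1 = - ((B * inn (a x) p) *\<^sub>R a x) - (C * inn (b x) p) *\<^sub>R b x"
    "q1 = - ((B * inn (a x) q) *\<^sub>R a x) - (C * inn (b x) q) *\<^sub>R b x"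
  shows "inn p q1 + inn q p1 = - 2 * (B * inn (a x) p * inn (a x) q + C * inn (b x) p * inn (b x) q)"
  by (simp add: assms inn_commute[of p] inn_commute[of q])

text \<open>Cramer's rule for the coefficients of \<open>v\<close> in the frame.\<close>

lemma separates_plane:
  assumes det: "inn (a x) p * inn (b x) q - inn (a x) q * inn (b x) p \<noteq> 0"
    and v: "v \<in> f x" "inn v p = 0" "inn v q = 0"
  shows "v = 0"
proof -
  obtain k l where kl: "v = k *\<^sub>R a x + l *\<^sub>R b x" using v(1) unfolding frame(3) span_pair by blast
  have 1: "k * inn (a x) p + l * inn (b x) p = 0" and 2: "k * inn (a x) q + l * inn (b x) q = 0"
    using v(2,3) by (simp_all add: kl)
  have "k * (inn (a x) p * inn (b x) q - inn (a x) q * inn (b x) p) = 0"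
    "l * (inn (a x) p * inn (b x) q - inn (a x) q * inn (b x) p) = 0"
    using 1 2 by algebra+
  then show ?thesis using det kl by simp
qed

lemma darboux_separates_plane:
  assumes det: "inn (a x) p * inn (b x) q - inn (a x) q * inn (b x) p \<noteq> 0"
    and h: "B * h1^2 + C * h2^2 \<noteq> 0" "m \<noteq> 0" "h1 \<noteq> 0"
    and \<sigma>: "inn \<sigma> p = m * (B * h1 * inn (a x) p + C * h2 * inn (b x) p)"
      "inn \<sigma> q = m * (B * h1 * inn (a x) q + C * h2 * inn (b x) q)"
    and v: "v \<in> span {\<sigma>, h2 *\<^sub>R a x - h1 *\<^sub>R b x}" "inn v p = 0" "inn v q = 0"
  shows "v = 0"
proof -
  obtain k l where kl: "v = k *\<^sub>R \<sigma> + l *\<^sub>R (h2 *\<^sub>R a x - h1 *\<^sub>R b x)" using v(1) unfolding span_pair by blast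
  \<comment> \<open>On \<open>p\<close> and \<open>q\<close> the vector \<open>v\<close> agrees with the following vector of \<open>f\<close>.\<close>
  let ?w = "(k * m * B * h1 + l * h2) *\<^sub>R a x + (k * m * C * h2 - l * h1) *\<^sub>R b x"
  have "inn ?w p = inn v p" "inn ?w q = inn v q"
    by (simp_all add: kl \<sigma> algebra_simps)
  moreover have "?w \<in> f x" unfolding frame(3) span_pair by blast
  ultimately have "?w = 0" using v(2,3) by (intro separates_plane[OF det]) simp_all
  then have z: "k * m * B * h1 + l * h2 = 0" "k * m * C * h2 - l * h1 = 0"
    using frame(4) unfolding isotropic_frame_def by blast+
  then have "k * m * (B * h1^2 + C * h2^2) = 0" by algebra
  then have "k = 0" using h by simp
  then have "l = 0" using z(2) h(3) by simp
  with \<open>k = 0\<close> show ?thesis by (simp add: kl)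
qed

end

lemma lp_comb_simps [simp]:
  "fst (lp_comb r \<alpha> t \<beta>) x = r *\<^sub>R fst \<alpha> x + t *\<^sub>R fst \<beta> x"
  "snd (lp_comb r \<alpha> t \<beta>) x = r *\<^sub>R snd \<alpha> x + t *\<^sub>R snd \<beta> x"
  by (simp_all add: lp_comb_def)

text \<open>The vector \<open>p\<^sub>1\<close> is determined by the products of \<open>p\<^sub>0\<close> with \<open>a\<close> and \<open>b\<close>. A quantity for which both vanish at \<open>x\<close>
  is therefore orthogonal to \<open>P\<close> under \<open>g_infty\<close>, hence zero, and so the two products are coordinates on \<open>P\<close>.\<close>

lemma conserved_space_frame:
  fixes x :: "'p::smooth_surface" and \<alpha> \<beta> :: "'p lin_poly"
  assumes pf: "principal_frame f s1 s2 \<eta> x a b X Y wX wY B C"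
    and P: "P = {lp_comb r \<alpha> t \<beta> | r t. True}" and ind: "\<forall>r t. lp_comb r \<alpha> t \<beta> = lp_zero \<longrightarrow> r = 0 \<and> t = 0"
    and p1: "\<forall>\<gamma>\<in>P. snd \<gamma> x = - ((B * inn (a x) (fst \<gamma> x)) *\<^sub>R a x) - (C * inn (b x) (fst \<gamma> x)) *\<^sub>R b x"
    and g: "\<forall>\<gamma>\<in>P. \<forall>\<delta>\<in>P. g_infty \<gamma> \<delta> = inn (fst \<gamma> x) (snd \<delta> x) + inn (fst \<delta> x) (snd \<gamma> x)"
    and nd: "\<forall>\<gamma>\<in>P. (\<forall>\<delta>\<in>P. g_infty \<gamma> \<delta> = 0) \<longrightarrow> \<gamma> = lp_zero"
  shows "\<And>\<gamma> \<delta>. \<gamma> \<in> P \<Longrightarrow> \<delta> \<in> P \<Longrightarrow> g_infty \<gamma> \<delta> =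
      - 2 * (B * inn (a x) (fst \<gamma> x) * inn (a x) (fst \<delta> x) + C * inn (b x) (fst \<gamma> x) * inn (b x) (fst \<delta> x))"
    and "inn (a x) (fst \<alpha> x) * inn (b x) (fst \<beta> x) - inn (a x) (fst \<beta> x) * inn (b x) (fst \<alpha> x) \<noteq> 0"
proof -
  interpret principal_frame f s1 s2 \<eta> x a b X Y wX wY B C by (rule pf)
  show gram: "g_infty \<gamma> \<delta> =
      - 2 * (B * inn (a x) (fst \<gamma> x) * inn (a x) (fst \<delta> x) + C * inn (b x) (fst \<gamma> x) * inn (b x) (fst \<delta> x))"
    if "\<gamma> \<in> P" "\<delta> \<in> P" for \<gamma> \<delta>
    unfolding g[rule_format, OF that] by (rule gram_formula[OF p1[rule_format, OF that(1)] p1[rule_format, OF that(2)]])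
  let ?a1 = "inn (a x) (fst \<alpha> x)" and ?a2 = "inn (b x) (fst \<alpha> x)"
    and ?b1 = "inn (a x) (fst \<beta> x)" and ?b2 = "inn (b x) (fst \<beta> x)"
  show "?a1 * ?b2 - ?b1 * ?a2 \<noteq> 0"
  proof
    assume z: "?a1 * ?b2 - ?b1 * ?a2 = 0"
    have kill: "r = 0 \<and> t = 0" if "r * ?a1 + t * ?b1 = 0" "r * ?a2 + t * ?b2 = 0" for r t
    proof (rule ind[rule_format])
      have \<gamma>: "lp_comb r \<alpha> t \<beta> \<in> P" unfolding P by blast
      have "g_infty (lp_comb r \<alpha> t \<beta>) \<delta> = 0" if "\<delta> \<in> P" for \<delta>
        using gram[OF \<gamma> that] \<open>r * ?a1 + t * ?b1 = 0\<close> \<open>r * ?a2 + t * ?b2 = 0\<close> by simp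
      then show "lp_comb r \<alpha> t \<beta> = lp_zero" using nd \<gamma> by blast
    qed
    have "?b1 = 0 \<and> - ?a1 = 0" by (rule kill) (use z in \<open>simp_all add: algebra_simps\<close>)
    moreover have "?b2 = 0 \<and> - ?a2 = 0" by (rule kill) (use z in \<open>simp_all add: algebra_simps\<close>)
    ultimately show False using kill[of 1 1] by simp
  qed
qed

lemma conserved_space_equations:
  assumes P: "two_dim_lcq_space \<eta> P" and \<gamma>: "\<gamma> \<in> P"
  shows "smooth_map_on UNIV (fst \<gamma>)" "smooth_map_on UNIV (snd \<gamma>)" "ddir Z (fst \<gamma>) x = 0"
    "ddir Z (snd \<gamma>) x = - \<eta> x Z (fst \<gamma> x)" "\<eta> x Z (snd \<gamma> x) = 0"
proof -
  have "\<gamma> = lp_zero \<or> linear_conserved_quantity \<eta> \<gamma>"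
    using P \<gamma> unfolding two_dim_lcq_space_def by blast
  then show "smooth_map_on UNIV (fst \<gamma>)" "smooth_map_on UNIV (snd \<gamma>)" "ddir Z (fst \<gamma>) x = 0"
    "ddir Z (snd \<gamma>) x = - \<eta> x Z (fst \<gamma> x)" "\<eta> x Z (snd \<gamma> x) = 0"
    using conserved_quantity_equations[of \<eta> \<gamma>]
    by (auto simp: lp_zero_def linear_conserved_quantity_def blinfun.zero_right)
qed

text \<open>The two terms of the derivative cancel because \<open>\<eta>\<close> is skew.\<close>

lemma g_infty_eq:
  fixes x :: "'p::smooth_surface"
  assumes con: "connected (UNIV :: 'p set)" and P: "two_dim_lcq_space \<eta> P"
    and skew: "\<And>x Z u v. inn (\<eta> x Z u) v = - inn u (\<eta> x Z v)" and \<gamma>: "\<gamma> \<in> P" "\<delta> \<in> P"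
  shows "g_infty \<gamma> \<delta> = inn (fst \<gamma> x) (snd \<delta> x) + inn (fst \<delta> x) (snd \<gamma> x)"
proof -
  let ?h = "\<lambda>y. inn (fst \<gamma> y) (snd \<delta> y) + inn (fst \<delta> y) (snd \<gamma> y)"
  note e = conserved_space_equations[OF P \<gamma>(1)] and e' = conserved_space_equations[OF P \<gamma>(2)]
  have sm: "smooth_map_on UNIV (\<lambda>y. inn (fst \<gamma> y) (snd \<delta> y))" "smooth_map_on UNIV (\<lambda>y. inn (fst \<delta> y) (snd \<gamma> y))"
    by (intro smooth_map_on_inn open_UNIV e(1,2) e'(1,2))+
  have d: "diff_at (fst \<gamma>) y" "diff_at (snd \<gamma>) y" "diff_at (fst \<delta>) y" "diff_at (snd \<delta>) y" for y
    using e(1,2) e'(1,2) diff_atI open_UNIV UNIV_I by blast+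
  have "ddir Z ?h y = 0" for y Z
  proof -
    have "ddir Z ?h y = ddir Z (\<lambda>y. inn (fst \<gamma> y) (snd \<delta> y)) y + ddir Z (\<lambda>y. inn (fst \<delta> y) (snd \<gamma> y)) y"
      using sm by (intro ddir_add diff_atI[OF _ open_UNIV UNIV_I])
    also have "\<dots> = inn (fst \<gamma> y) (- \<eta> y Z (fst \<delta> y)) + inn (fst \<delta> y) (- \<eta> y Z (fst \<gamma> y))"
      unfolding ddir_bilinear[OF bounded_bilinear_inn d(1,4)] ddir_bilinear[OF bounded_bilinear_inn d(3,2)]
      by (simp add: e(3,4) e'(3,4))
    also have "\<dots> = 0"
      using skew[of y Z "fst \<delta> y" "fst \<gamma> y"] by (simp add: inn_commute)
    finally show ?thesis .
  qed
  then have const: "?h y = ?h x" for y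
    by (intro ddir_zero_imp_constant[OF con smooth_map_on_add[OF open_UNIV sm]])
  show ?thesis unfolding g_infty_def
  proof (rule the_equality)
    show "\<forall>y. ?h y = ?h x" using const by blast
    show "r = ?h x" if "\<forall>y. ?h y = r" for r using that by simp
  qed
qed

theorem proposition6p19:
  fixes f s1 s2 fh sh1 sh2 sh :: "'p::smooth_surface \<Rightarrow> R42 set"
    and \<eta> \<eta>mid :: "'p o_form"
    and P :: "'p lin_poly set"
    and m :: real
  assumes "connected (UNIV :: 'p set)"
    and "umbilic_free f s1 s2"
    and "omega_surface f \<eta>"
    and "constant_signature f \<eta>"
    and "middle_potential f s1 s2 \<eta> \<eta>mid"
    and "two_dim_lcq_space \<eta>mid P"
    and "\<exists>\<alpha>\<in>P. \<exists>\<beta>\<in>P. g_form 0 \<alpha> \<beta> \<noteq> 0"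
    and "\<forall>\<alpha>\<in>P. (\<forall>\<beta>\<in>P. g_infty \<alpha> \<beta> = 0) \<longrightarrow> \<alpha> = lp_zero"
    and "m \<noteq> 0"
    and "darboux_transform f \<eta>mid m sh fh"
    and "umbilic_free fh sh1 sh2"
    and "\<forall>\<sigma>\<in>lp_eval_space P m. \<forall>x. \<sigma> x \<in> perp (sh x)"
  shows "\<exists>C. \<forall>qq pp. (\<lambda>_. qq) \<in> lp_eval_space P 0 \<and> (\<lambda>_. pp) \<in> lp_eval_space P 0 \<and>
           space_form_vectors qq pp \<longrightarrow>
           projects_to_linear_weingarten f s1 s2 qq pp C \<and>
           projects_to_linear_weingarten fh sh1 sh2 qq pp C"
proof -
  note con = assms(1) and U = assms(2) and lcq = assms(6) and nd = assms(8) and m0 = assms(9)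
    and dt = assms(10) and Uh = assms(11) and Pm = assms(12)
  have pf: "\<exists>a b X Y wX wY B C. principal_frame f s1 s2 \<eta>mid x a b X Y wX wY B C" for x
    by (rule principal_frame_exists[OF assms(2-5), of x]) blast
  have skew: "inn (\<eta>mid x Z u) v = - inn u (\<eta>mid x Z v)" for x Z u v
    using pf[of x] principal_frame.skew by blast
  obtain \<alpha> \<beta> where P: "P = {lp_comb r \<alpha> t \<beta> | r t. True}"
    and ind: "\<forall>r t. lp_comb r \<alpha> t \<beta> = lp_zero \<longrightarrow> r = 0 \<and> t = 0"
    using lcq unfolding two_dim_lcq_space_def by blast
  have \<alpha>\<beta>: "\<alpha> \<in> P" "\<beta> \<in> P"
  proof -
    have "lp_comb 1 \<alpha> 0 \<beta> = \<alpha>" "lp_comb 0 \<alpha> 1 \<beta> = \<beta>" by (simp_all add: lp_comb_def)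
    then show "\<alpha> \<in> P" "\<beta> \<in> P" unfolding P by (metis (mono_tags, lifting) mem_Collect_eq)+
  qed
  have in_plane: "snd \<gamma> x \<in> f x" if "\<gamma> \<in> P" for \<gamma> x
    using pf[of x] principal_frame.conserved_in_plane conserved_space_equations(5)[OF lcq that] by blast
  have snd_section: "snd \<gamma> \<in> sections_at f x" if "\<gamma> \<in> P" for \<gamma> x
    unfolding sections_at_def using conserved_space_equations(2)[OF lcq that] in_plane[OF that]
    by (auto intro!: exI[of _ UNIV])
  have const: "fst \<gamma> x = fst \<gamma> y" if "\<gamma> \<in> P" for \<gamma> x y
    by (rule ddir_zero_imp_constant[OF con conserved_space_equations(1,3)[OF lcq that]])
  define p q where "p = fst \<alpha> undefined" and "q = fst \<beta> undefined"
  have p: "fst \<alpha> x = p" and q: "fst \<beta> x = q" for x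
    unfolding p_def q_def by (rule const; rule \<alpha>\<beta>)+
  define g11 g12 g22 where "g11 = g_infty \<alpha> \<alpha>" and "g12 = g_infty \<alpha> \<beta>" and "g22 = g_infty \<beta> \<beta>"
  let ?W = "weingarten_tensor p q g22 (- g12) g11"
  have gram: "g11 = - 2 * (B * inn (a x) p * inn (a x) p + C * inn (b x) p * inn (b x) p)"
      "g12 = - 2 * (B * inn (a x) p * inn (a x) q + C * inn (b x) p * inn (b x) q)"
      "g22 = - 2 * (B * inn (a x) q * inn (a x) q + C * inn (b x) q * inn (b x) q)"
    and det: "inn (a x) p * inn (b x) q - inn (a x) q * inn (b x) p \<noteq> 0"
    and snd_value: "\<And>\<gamma>. \<gamma> \<in> P \<Longrightarrow> snd \<gamma> x = - ((B * inn (a x) (fst \<gamma> x)) *\<^sub>R a x) - (C * inn (b x) (fst \<gamma> x)) *\<^sub>R b x"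
    if pf: "principal_frame f s1 s2 \<eta>mid x a b X Y wX wY B C" for x a b X Y wX wY B C
  proof -
    show p1: "snd \<gamma> x = - ((B * inn (a x) (fst \<gamma> x)) *\<^sub>R a x) - (C * inn (b x) (fst \<gamma> x)) *\<^sub>R b x" if "\<gamma> \<in> P" for \<gamma>
      by (rule principal_frame.conserved_expansion[OF pf snd_section[OF that] conserved_space_equations(4)[OF lcq that]])
    have "\<forall>\<gamma>\<in>P. snd \<gamma> x = - ((B * inn (a x) (fst \<gamma> x)) *\<^sub>R a x) - (C * inn (b x) (fst \<gamma> x)) *\<^sub>R b x"
      "\<forall>\<gamma>\<in>P. \<forall>\<delta>\<in>P. g_infty \<gamma> \<delta> = inn (fst \<gamma> x) (snd \<delta> x) + inn (fst \<delta> x) (snd \<gamma> x)"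
      using p1 g_infty_eq[OF con lcq skew] by blast+
    note fr = conserved_space_frame[OF pf P ind this nd]
    show "g11 = - 2 * (B * inn (a x) p * inn (a x) p + C * inn (b x) p * inn (b x) p)"
      "g12 = - 2 * (B * inn (a x) p * inn (a x) q + C * inn (b x) p * inn (b x) q)"
      "g22 = - 2 * (B * inn (a x) q * inn (a x) q + C * inn (b x) q * inn (b x) q)"
      "inn (a x) p * inn (b x) q - inn (a x) q * inn (b x) p \<noteq> 0"
      using fr(1)[OF \<alpha>\<beta>(1) \<alpha>\<beta>(1)] fr(1)[OF \<alpha>\<beta>] fr(1)[OF \<alpha>\<beta>(2) \<alpha>\<beta>(2)] fr(2)
      unfolding g11_def g12_def g22_def p q .
  qed
  have gdet: "g11 * g22 - g12^2 \<noteq> 0"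
  proof -
    obtain a b X Y wX wY B C where fr: "principal_frame f s1 s2 \<eta>mid undefined a b X Y wX wY B C"
      using pf by blast
    let ?d = "inn (a undefined) p * inn (b undefined) q - inn (a undefined) q * inn (b undefined) p"
    have "g11 * g22 - g12^2 = 4 * B * C * ?d^2"
      unfolding gram[OF fr] by (simp add: power2_eq_square algebra_simps)
    then show ?thesis using principal_frame.BC[OF fr] det[OF fr] by simp
  qed
  have f_conj: "?W u v = 0" if uv: "u \<in> s1 x" "v \<in> s2 x" for x u v
  proof -
    obtain a b X Y wX wY B C where fr: "principal_frame f s1 s2 \<eta>mid x a b X Y wX wY B C" using pf by blast
    interpret principal_frame f s1 s2 \<eta>mid x a b X Y wX wY B C by (rule fr)
    obtain k l where "u = k *\<^sub>R a x" "v = l *\<^sub>R b x" using uv unfolding frame(1,2) span_single by blast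
    moreover have "?W (k *\<^sub>R a x) (l *\<^sub>R b x) = k * l * ?W (a x) (b x)"
      by (simp add: weingarten_tensor_def symprod_def field_simps)
    ultimately show ?thesis using conjugate_diagonal[OF gram[OF fr]] by simp
  qed
  have f_sep: "v = 0" if "v \<in> f x" "inn v p = 0" "inn v q = 0" for x v
  proof -
    obtain a b X Y wX wY B C where fr: "principal_frame f s1 s2 \<eta>mid x a b X Y wX wY B C" using pf by blast
    show ?thesis by (rule principal_frame.separates_plane[OF fr det[OF fr] that])
  qed
  have fh_both: "(\<forall>u\<in>sh1 x. \<forall>v\<in>sh2 x. ?W u v = 0) \<and> (\<forall>v\<in>fh x. inn v p = 0 \<longrightarrow> inn v q = 0 \<longrightarrow> v = 0)" for x
  proof -
    obtain a b X Y wX wY B C where fr: "principal_frame f s1 s2 \<eta>mid x a b X Y wX wY B C" using pf by blast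
    interpret principal_frame f s1 s2 \<eta>mid x a b X Y wX wY B C by (rule fr)
    obtain \<sigma> where \<sigma>: "\<sigma> \<in> sh x" "fh x = span {\<sigma>, inn (b x) \<sigma> *\<^sub>R a x - inn (a x) \<sigma> *\<^sub>R b x}"
      "inn (a x) \<sigma> \<noteq> 0" "inn (b x) \<sigma> \<noteq> 0" "B * (inn (a x) \<sigma>)^2 + C * (inn (b x) \<sigma>)^2 \<noteq> 0"
      "{sh1 x, sh2 x} =
        {span {inn (a x) \<sigma> *\<^sub>R \<sigma> - (m * C * inn (b x) \<sigma>) *\<^sub>R (inn (b x) \<sigma> *\<^sub>R a x - inn (a x) \<sigma> *\<^sub>R b x)},
         span {inn (b x) \<sigma> *\<^sub>R \<sigma> + (m * B * inn (a x) \<sigma>) *\<^sub>R (inn (b x) \<sigma> *\<^sub>R a x - inn (a x) \<sigma> *\<^sub>R b x)}}"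
      by (rule darboux_spheres[OF dt Uh])
    have prod: "inn \<sigma> (fst \<gamma> x) = m * (B * inn (a x) \<sigma> * inn (a x) (fst \<gamma> x) + C * inn (b x) \<sigma> * inn (b x) (fst \<gamma> x))"
      if \<gamma>: "\<gamma> \<in> P" for \<gamma>
    proof -
      have "lp_eval \<gamma> m \<in> lp_eval_space P m" unfolding lp_eval_space_def using \<gamma> by blast
      then have "inn (lp_eval \<gamma> m x) \<sigma> = 0" using Pm \<sigma>(1) unfolding perp_def by blast
      then have "inn (fst \<gamma> x) \<sigma> = - m * inn (snd \<gamma> x) \<sigma>" by (simp add: lp_eval_def)
      then show ?thesis unfolding snd_value[OF fr \<gamma>] by (simp add: inn_commute algebra_simps)
    qed
    note pr = prod[OF \<alpha>\<beta>(1), unfolded p] prod[OF \<alpha>\<beta>(2), unfolded q]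
    have ne: "sh1 x \<noteq> sh2 x" using Uh by (simp add: umbilic_free_def)
    have "?W u v = 0" if "u \<in> sh1 x" "v \<in> sh2 x" for u v
      using ne \<sigma>(6) by (intro weingarten_tensor_pair[OF conjugate_darboux[OF gram[OF fr] pr] \<sigma>(6) that]) auto
    moreover have "v = 0" if "v \<in> fh x" "inn v p = 0" "inn v q = 0" for v
      by (rule darboux_separates_plane[OF det[OF fr] \<sigma>(5) m0 \<sigma>(3) pr that(1)[unfolded \<sigma>(2)] that(2,3)])
    ultimately show ?thesis by blast
  qed
  show ?thesis
  proof (intro exI[of _ "proj_class ?W"] allI impI)
    fix qq pp
    assume h: "(\<lambda>_. qq) \<in> lp_eval_space P 0 \<and> (\<lambda>_. pp) \<in> lp_eval_space P 0 \<and> space_form_vectors qq pp"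
    have comb: "\<exists>k l. w = k *\<^sub>R p + l *\<^sub>R q" if w: "(\<lambda>_. w) \<in> lp_eval_space P 0" for w
    proof -
      obtain \<gamma> where "\<gamma> \<in> P" "(\<lambda>_. w) = lp_eval \<gamma> 0" using w unfolding lp_eval_space_def by blast
      then obtain k l where "(\<lambda>_. w) = lp_eval (lp_comb k \<alpha> l \<beta>) 0" unfolding P by blast
      then have "w = lp_eval (lp_comb k \<alpha> l \<beta>) 0 undefined" by metis
      then show ?thesis by (auto simp: lp_eval_def p q)
    qed
    obtain k l where qq: "qq = k *\<^sub>R p + l *\<^sub>R q" using comb h by blast
    obtain k' l' where pp: "pp = k' *\<^sub>R p + l' *\<^sub>R q" using comb h by blast
    have sf: "inn pp pp \<noteq> 0" "qq \<noteq> 0" "inn qq pp = 0" using h unfolding space_form_vectors_def by auto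
    define D where "D = k * l' - l * k'"
    have solve: "D *\<^sub>R p = l' *\<^sub>R qq - l *\<^sub>R pp" "D *\<^sub>R q = k *\<^sub>R pp - k' *\<^sub>R qq"
      by (simp_all add: D_def qq pp algebra_simps)
    have "D \<noteq> 0"
    proof
      assume "D = 0"
      then have e: "l' *\<^sub>R qq - l *\<^sub>R pp = 0" "k *\<^sub>R pp - k' *\<^sub>R qq = 0" using solve by simp_all
      have "inn (l' *\<^sub>R qq - l *\<^sub>R pp) pp = 0" "inn (k *\<^sub>R pp - k' *\<^sub>R qq) pp = 0" unfolding e by simp_all
      then have "l = 0" "k = 0" using sf by simp_all
      then show False using sf(2) qq by simp
    qed
    \<comment> \<open>The entries of the adjugate of the Gram matrix of \<open>g_infty\<close> in the basis of \<open>P\<close> given by \<open>qq\<close> and \<open>pp\<close>.\<close>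
    define A where "A = k'^2 * g11 + 2 * k' * l' * g12 + l'^2 * g22"
    define B where "B = - (k * k' * g11 + (k * l' + l * k') * g12 + l * l' * g22)"
    define C where "C = k^2 * g11 + 2 * k * l * g12 + l^2 * g22"
    have W: "weingarten_tensor qq pp A B C = (\<lambda>u v. D^2 * ?W u v)"
      unfolding A_def B_def C_def D_def using weingarten_tensor_change_basis[OF qq pp] by (intro ext)
    have "A * C - B^2 = D^2 * (g11 * g22 - g12^2)"
      by (simp add: A_def B_def C_def D_def power2_eq_square algebra_simps)
    then have nz: "\<not> (A = 0 \<and> B = 0 \<and> C = 0)" using \<open>D \<noteq> 0\<close> gdet by auto
    have cls: "proj_class ?W = proj_class (weingarten_tensor qq pp A B C)"
      unfolding W by (rule proj_class_scale[symmetric]) (use \<open>D \<noteq> 0\<close> in simp)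
    have orth: "inn v p = 0 \<and> inn v q = 0" if "inn v qq = 0" "inn v pp = 0" for v
    proof -
      have "D * inn v p = inn v (D *\<^sub>R p)" "D * inn v q = inn v (D *\<^sub>R q)" by simp_all
      then show ?thesis unfolding solve using that \<open>D \<noteq> 0\<close> by simp
    qed
    have "satisfies_weingarten f s1 s2 qq pp A B C"
      by (rule satisfies_weingartenI[OF U]) (use f_conj f_sep orth in \<open>auto simp: W\<close>)
    moreover have "satisfies_weingarten fh sh1 sh2 qq pp A B C"
      by (rule satisfies_weingartenI[OF Uh]) (use fh_both orth in \<open>auto simp: W\<close>)
    ultimately show "projects_to_linear_weingarten f s1 s2 qq pp (proj_class ?W) \<and>
        projects_to_linear_weingarten fh sh1 sh2 qq pp (proj_class ?W)"
      unfolding projects_to_linear_weingarten_def using nz cls by blast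
  qed
qed

end
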